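(* For every small abelian category $\mathcal A$, the categorical interpretation of $\Sigma$ associated with $\mathcal A$ is a model of $\mathcal T_{\mathrm{ab}}$. Conversely, every model of $\Sigma$ satisfying $\mathcal T_{\mathrm{ab}}$ is isomorphic to the categorical interpretation of $\Sigma$ associated with some small abelian category.
   Context: Quivers. A quiver is a tuple $Q=(V_Q,A_Q,s_Q,t_Q)$ with $V_Q$, $A_Q$ finite subsets of $\mathbb N$ and $s_Q,t_Q\colon A_Q\to V_Q$. A morphism $m\colon Q\to Q'$ is a pair of maps $m_V,m_A$ compatible with sources and targets; an embedding if both are injective. $\mathrm{PQ}_k$ has vertices $\{0,\dots,k\}$, arrows $\{0,\dots,k-1\}$, arrow $i\colon i\to i+1$; nontrivial if $k\ge1$. A path of length $k$ of $Q$ is a morphism $\mathrm{PQ}_k\to Q$; $\mathcal{BP}_Q$ is the set of pairs of paths with same start and same end. $Q$ is acyclic if all its paths are embeddings; $S$ is the set of acyclic quivers. $\mathrm{Free}(Q)$ is the free category on $Q$ (objects $V_Q$, morphisms paths, composition concatenation). A diagram in $\mathcal C$ over $Q$ is a functor $\mathrm{Free}(Q)\to\mathcal C$; $m^*(D)=D\circ\Phi_m$ where $\Phi_m$ is the induced functor; for $D$ over $\mathrm{PQ}_k$, $\mathrm{comp}(D)$ is the composite of its arrows (identity if $k=0$); $D$ over $Q$ is commutative if $\mathrm{comp}(p_1^*D)=\mathrm{comp}(p_2^*D)$ for all $(p_1,p_2)\in\mathcal{BP}_Q$. $\Sigma$ is the many-sorted first-order signature with equality $\approx$, sorts the elements of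 $S$, a function symbol $\mathrm{restr}_m$ from sort $Q$ to sort $Q'$ for each embedding $m\colon Q'\to Q$ of acyclic quivers, and a unary predicate $\mathrm{commute}_Q$ for each $Q\in S$. A model gives sets $\mathcal M_Q$, maps $\mathrm{restr}^{\mathcal M}_m$, subsets $\mathrm{commute}^{\mathcal M}_Q$; an isomorphism of models is a family of bijections commuting with all $\mathrm{restr}_m$ and matching the $\mathrm{commute}_Q$. The categorical interpretation of a small category $\mathcal C$: $\mathcal C_Q$ = diagrams over $Q$, $\mathrm{restr}_m=m^*$, $\mathrm{commute}_Q$ = commutative diagrams. Duality: $Q^\dagger=(V_Q,A_Q,t_Q,s_Q)$, $m^\dagger$ has the same underlying maps as $m$, and $\phi^\dagger$ replaces every sort $Q$ by $Q^\dagger$, $\mathrm{restr}_m$ by $\mathrm{restr}_{m^\dagger}$, $\mathrm{commute}_Q$ by $\mathrm{commute}_{Q^\dagger}$. Subquivers are identified with quivers in $S$ via fixed isomorphisms; "restriction to a subquiver" means $\mathrm{restr}$ along the corresponding embedding. Theory $\mathcal T_{\mathrm{cat}}$ (all sorts acyclic, all maps embeddings). Named quivers: $\emptyset$; $D_2$ (vertices $0,1$, no arrow); $C_2$ (vertices $0,1$, arrows $0,1\colon0\to1$, embeddings $a_0,a_1\colon\mathrm{PQ}_1\to C_2$); $T$ (vertices $0,1,2$, arrows $0\colon0\to1$, $1\colon0\to2$, $2\colon1\to2$; $e_{01},e_{12},e_{02}\colon\mathrm{PQ}_1\to T$ onto arrows $0,2,1$); $\sigma,\tau\colon\mathrm{PQ}_0\to\mathrm{PQ}_1$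 onto vertex $0$, resp. $1$; $\mathrm{sp}_{k,l},\mathrm{tp}_{k,l}\colon\mathrm{PQ}_k\to\mathrm{PQ}_l$ with vertex maps $i\mapsto i$, resp. $i\mapsto i+l-k$; $\mathrm{st}_P\colon D_2\to\mathrm{PQ}_k$ ($k\ge1$), $0\mapsto0$, $1\mapsto k$. Pushout configuration: embeddings $m_1\colon Q\to Q_1$, $m_2\colon Q\to Q_2$, $m_1'\colon Q_1\to Q'$, $m_2'\colon Q_2\to Q'$ with $m_1'm_1=m_2'm_2$, $Q'$ covered by the images of $m_1',m_2'$, and image of $m_1'm_1$ = intersection of images of $m_1'$, $m_2'$. $\mathrm{Cospan}_{m_1',m_2'}(x_1,x_2,x')$: $\mathrm{restr}_{m_1'}(x')\approx x_1\wedge\mathrm{restr}_{m_2'}(x')\approx x_2$. Axioms: EmptyEU (exactly one element of sort $\emptyset$); RestrComp ($\mathrm{restr}_m\circ\mathrm{restr}_{m'}=\mathrm{restr}_{m'\circ m}$); PushoutEU (for each pushout configuration, $\mathrm{restr}_{m_1}(x_1)\approx\mathrm{restr}_{m_2}(x_2)\to\exists!x'\,\mathrm{Cospan}_{m_1',m_2'}(x_1,x_2,x')$); with $\mathrm{Comp}(x,y,z)$ := $\exists w{:}T\,(\mathrm{restr}_{e_{01}}w\approx x\wedge\mathrm{restr}_{e_{12}}w\approx y\wedge\mathrm{restr}_{e_{02}}w\approx z\wedge\mathrm{commute}(w))$, CompE: $\forall x,y{:}\mathrm{PQ}_1\,(\mathrm{restr}_\tau x\approx\mathrm{restr}_\sigma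 y\to\exists z\,\mathrm{Comp}(x,y,z))$; $\mathrm{EqPath}_{P_1,P_2}(x_1,x_2)$ for nontrivial path-quivers := $\mathrm{restr}_{\mathrm{st}}(x_1)\approx\mathrm{restr}_{\mathrm{st}}(x_2)\wedge\forall x\,(\mathrm{Cospan}_{m_1',m_2'}(x_1,x_2,x)\to\mathrm{commute}(x))$ for a pushout configuration $(\mathrm{st}_{P_1},\mathrm{st}_{P_2},m_1',m_2')$; $\mathrm{Id}(x,y)$ := $\mathrm{restr}_\sigma y\approx x\wedge\forall z,w\,((\mathrm{Comp}(y,z,w)\to\mathrm{EqPath}(z,w))\wedge(\mathrm{Comp}(z,y,w)\to\mathrm{EqPath}(z,w)))$; IdE: $\forall x\exists y\,\mathrm{Id}(x,y)$; $\mathrm{EqPath}_{\mathrm{PQ}_0,\mathrm{PQ}_0}(x,y)$ := $x\approx y$, $\mathrm{EqPath}_{\mathrm{PQ}_0,P}(x,y)$ := $\exists z(\mathrm{Id}(x,z)\wedge\mathrm{EqPath}_{\mathrm{PQ}_1,P}(z,y))$, $\mathrm{EqPath}_{P,\mathrm{PQ}_0}(x,y)$ := $\mathrm{EqPath}_{\mathrm{PQ}_0,P}(y,x)$; reflexivity, symmetry, transitivity of EqPath; EqPathConcat: $\mathrm{EqPath}(x_1,x_2)\wedge\mathrm{EqPath}(x_1',x_2')\wedge\mathrm{restr}_{\mathrm{tp}_{0,k_1}}x_1\approx\mathrm{restr}_{\mathrm{sp}_{0,k_1'}}x_1'\to\forall x_1'',x_2''\,(\mathrm{Cospan}_{\mathrm{sp}_{k_1,k_1+k_1'},\mathrm{tp}_{k_1',k_1+k_1'}}(x_1,x_1',x_1'')\wedge\mathrm{Cospan}_{\mathrm{sp}_{k_2,k_2+k_2'},\mathrm{tp}_{k_2',k_2+k_2'}}(x_2,x_2',x_2'')\to\mathrm{EqPath}(x_1'',x_2''))$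 (sorts $\mathrm{PQ}_{k_1},\mathrm{PQ}_{k_2},\mathrm{PQ}_{k_1'},\mathrm{PQ}_{k_2'},\mathrm{PQ}_{k_i+k_i'}$); ComEq: $\forall x{:}C_2\,(\mathrm{commute}(x)\to\mathrm{restr}_{a_0}x\approx\mathrm{restr}_{a_1}x)$; PathCom$_Q$: $\forall x{:}Q\,(\bigwedge_{(p_1,p_2)\in\mathcal{BP}_Q}\mathrm{EqPath}(\mathrm{restr}_{p_1}x,\mathrm{restr}_{p_2}x)\leftrightarrow\mathrm{commute}(x))$. Theory $\mathcal T_{\mathrm{ab}}$. Mono quiver $M$: vertices $0,1,2$, arrows $g,h\colon0\to1$, $f\colon1\to2$, $k\colon0\to2$. $\mathrm{Mono}(x)$ ($x{:}\mathrm{PQ}_1$) := $\forall y{:}M$: (restriction of $y$ to arrow $f$) $\approx x$ $\wedge$ commute(restriction to the triangle $g,f,k$) $\wedge$ commute(restriction to the triangle $h,f,k$) $\to$ commute(restriction to the subquiver $\{0,1\}$ with arrows $g,h$). $\mathrm{cone}(Q)$: $Q$ plus a new vertex $v_0$ and an arrow $a_v\colon v_0\to v$ for each $v\in V_Q$; $i_Q\colon Q\to\mathrm{cone}(Q)$ the inclusion; for an embedding $m$, $\mathrm{cone}(m)$ extends $m$ by $v_0\mapsto v_0$, $a_v\mapsto a_{m(v)}$; for $a\in A_Q$ also denote $a\colon\mathrm{PQ}_1\to Q$ the embedding onto $a$. $\mathrm{Cone}_Q(x,y)$ := $\mathrm{restr}_{i_Q}(y)\approx x\wedge\bigwedge_{a\in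 A_Q}\mathrm{commute}(\mathrm{restr}_{\mathrm{cone}(a)}(y))$. $\mathrm{Limit}_Q(x,y)$ := $\mathrm{Cone}_Q(x,y)\wedge\forall z\,(\mathrm{Cone}_Q(x,z)\to\exists!w\,(\mathrm{Cone}_{\mathrm{cone}(Q)}(y,w)\wedge\mathrm{restr}_{\mathrm{cone}(i_Q)}(w)\approx z))$. $\mathrm{Colimit}_Q$ := $(\mathrm{Limit}_{Q^\dagger})^\dagger$. $\mathrm{Zero}(x)$ ($x{:}\mathrm{PQ}_0=\mathrm{cone}(\emptyset)$) := $\forall y{:}\emptyset\,(\mathrm{Limit}_\emptyset(y,x)\wedge\mathrm{Colimit}_\emptyset(y,x))$. Let $Q_0$ be the cospan quiver with vertices $a,b,o$ and arrows $f\colon a\to b$, $u\colon o\to b$, and $K=\mathrm{cone}(Q_0)$. $\mathrm{Ker}(x,y)$ ($x,y{:}\mathrm{PQ}_1$) := $\exists z{:}K$: (restriction of $z$ to arrow $f$) $\approx x$ $\wedge$ (restriction to arrow $a_a\colon v_0\to a$) $\approx y$ $\wedge$ Zero(restriction to vertex $o$) $\wedge$ $\mathrm{Limit}_{Q_0}(\mathrm{restr}_{i_{Q_0}}(z),z)$. $\mathcal T_{\mathrm{ab}}$ is $\mathcal T_{\mathrm{cat}}$ together with: ZeroE: $\exists x{:}\mathrm{PQ}_0\,\mathrm{Zero}(x)$; ProductE: $\forall x{:}D_2\,\exists y\,\mathrm{Limit}_{D_2}(x,y)$; CoproductE := ProductE$^\dagger$; KerE: $\forall x\exists y\,\mathrm{Ker}(x,y)$;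 CokerE := KerE$^\dagger$; MonoNormal: $\forall x\,(\mathrm{Mono}(x)\to\exists y\,\mathrm{Ker}(y,x))$; EpiNormal := MonoNormal$^\dagger$. *)

theory Defs
  imports "HOL-Library.FuncSet"
begin

section \<open>Quivers\<close>

record quiver =
  verts :: "nat set"
  arrs :: "nat set"
  src :: "nat \<Rightarrow> nat"
  tgt :: "nat \<Rightarrow> nat"

text \<open>All maps between finite sets are taken to be extensional (the value is \<open>undefined\<close> outside the
  domain), so that HOL equality of quivers and of morphisms is the mathematical one. This matters
  because quivers index the sorts and morphisms index the function symbols.\<close>

definition is_quiver :: "quiver \<Rightarrow> bool" where
  "is_quiver Q \<longleftrightarrow> finite (verts Q) \<and> finite (arrs Q) \<and>
     src Q \<in> arrs Q \<rightarrow>\<^sub>E verts Q \<and> tgt Q \<in> arrs Q \<rightarrow>\<^sub>E verts Q"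

record qmor =
  qdom :: quiver
  qcod :: quiver
  vmap :: "nat \<Rightarrow> nat"
  amap :: "nat \<Rightarrow> nat"

definition is_qmor :: "qmor \<Rightarrow> bool" where
  "is_qmor m \<longleftrightarrow> is_quiver (qdom m) \<and> is_quiver (qcod m) \<and>
     vmap m \<in> verts (qdom m) \<rightarrow>\<^sub>E verts (qcod m) \<and>
     amap m \<in> arrs (qdom m) \<rightarrow>\<^sub>E arrs (qcod m) \<and>
     (\<forall>a\<in>arrs (qdom m). src (qcod m) (amap m a) = vmap m (src (qdom m) a) \<and>
                          tgt (qcod m) (amap m a) = vmap m (tgt (qdom m) a))"

definition embedding :: "qmor \<Rightarrow> bool" where
  "embedding m \<longleftrightarrow> is_qmor m \<and> inj_on (vmap m) (verts (qdom m)) \<and> inj_on (amap m) (arrs (qdom m))"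

definition qcomp :: "qmor \<Rightarrow> qmor \<Rightarrow> qmor" where
  "qcomp m' m = \<lparr>qdom = qdom m, qcod = qcod m',
     vmap = compose (verts (qdom m)) (vmap m') (vmap m),
     amap = compose (arrs (qdom m)) (amap m') (amap m)\<rparr>"

definition PQ :: "nat \<Rightarrow> quiver" where
  "PQ k = \<lparr>verts = {0..k}, arrs = {0..<k}, src = (\<lambda>i\<in>{0..<k}. i), tgt = (\<lambda>i\<in>{0..<k}. Suc i)\<rparr>"

definition paths :: "quiver \<Rightarrow> qmor set" where
  "paths Q = {p. is_qmor p \<and> qcod p = Q \<and> (\<exists>k. qdom p = PQ k)}"

definition plen :: "qmor \<Rightarrow> nat" where
  "plen p = card (arrs (qdom p))"

definition pstart :: "qmor \<Rightarrow> nat" where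
  "pstart p = vmap p 0"

definition pend :: "qmor \<Rightarrow> nat" where
  "pend p = vmap p (plen p)"

definition BP :: "quiver \<Rightarrow> (qmor \<times> qmor) set" where
  "BP Q = {(p, q). p \<in> paths Q \<and> q \<in> paths Q \<and> pstart p = pstart q \<and> pend p = pend q}"

definition acyclic_quiver :: "quiver \<Rightarrow> bool" where
  "acyclic_quiver Q \<longleftrightarrow> is_quiver Q \<and> (\<forall>p\<in>paths Q. embedding p)"

definition acyclic_emb :: "qmor \<Rightarrow> bool" where
  "acyclic_emb m \<longleftrightarrow> embedding m \<and> acyclic_quiver (qdom m) \<and> acyclic_quiver (qcod m)"

definition vertex_path :: "quiver \<Rightarrow> nat \<Rightarrow> qmor" where
  "vertex_path Q v = \<lparr>qdom = PQ 0, qcod = Q, vmap = (\<lambda>i\<in>{0}. v), amap = (\<lambda>_. undefined)\<rparr>"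

definition arrow_path :: "quiver \<Rightarrow> nat \<Rightarrow> qmor" where
  "arrow_path Q a = \<lparr>qdom = PQ 1, qcod = Q,
     vmap = (\<lambda>i\<in>{0..1}. if i = 0 then src Q a else tgt Q a), amap = (\<lambda>i\<in>{0..<1}. a)\<rparr>"

definition pconcat :: "qmor \<Rightarrow> qmor \<Rightarrow> qmor" where
  "pconcat p q = \<lparr>qdom = PQ (plen p + plen q), qcod = qcod p,
     vmap = (\<lambda>i\<in>{0..plen p + plen q}. if i \<le> plen p then vmap p i else vmap q (i - plen p)),
     amap = (\<lambda>i\<in>{0..<plen p + plen q}. if i < plen p then amap p i else amap q (i - plen p))\<rparr>"

definition subq :: "quiver \<Rightarrow> nat set \<Rightarrow> nat set \<Rightarrow> quiver" where
  "subq Q V A = \<lparr>verts = V, arrs = A, src = restrict (src Q) A, tgt = restrict (tgt Q) A\<rparr>"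

definition subq_incl :: "quiver \<Rightarrow> nat set \<Rightarrow> nat set \<Rightarrow> qmor" where
  "subq_incl Q V A = \<lparr>qdom = subq Q V A, qcod = Q, vmap = (\<lambda>v\<in>V. v), amap = (\<lambda>a\<in>A. a)\<rparr>"

definition dual_quiver :: "quiver \<Rightarrow> quiver" where
  "dual_quiver Q = \<lparr>verts = verts Q, arrs = arrs Q, src = tgt Q, tgt = src Q\<rparr>"

definition dual_qmor :: "qmor \<Rightarrow> qmor" where
  "dual_qmor m = \<lparr>qdom = dual_quiver (qdom m), qcod = dual_quiver (qcod m),
     vmap = vmap m, amap = amap m\<rparr>"


section \<open>Categories, functors, diagrams\<close>

text \<open>\<open>Comp C g f\<close> is the composite of \<open>f\<close> followed by \<open>g\<close>. Only the behaviour on \<open>Ob C\<close> and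
  \<open>Mor C\<close> is meaningful.\<close>

record ('o, 'a) category =
  Ob :: "'o set"
  Mor :: "'a set"
  Dom :: "'a \<Rightarrow> 'o"
  Cod :: "'a \<Rightarrow> 'o"
  Ide :: "'o \<Rightarrow> 'a"
  Comp :: "'a \<Rightarrow> 'a \<Rightarrow> 'a"

definition Hom :: "('o, 'a) category \<Rightarrow> 'o \<Rightarrow> 'o \<Rightarrow> 'a set" where
  "Hom C x y = {f \<in> Mor C. Dom C f = x \<and> Cod C f = y}"

definition is_category :: "('o, 'a) category \<Rightarrow> bool" where
  "is_category C \<longleftrightarrow>
     (\<forall>f\<in>Mor C. Dom C f \<in> Ob C \<and> Cod C f \<in> Ob C) \<and>
     (\<forall>x\<in>Ob C. Ide C x \<in> Hom C x x) \<and>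
     (\<forall>f\<in>Mor C. \<forall>g\<in>Mor C. Cod C f = Dom C g \<longrightarrow> Comp C g f \<in> Hom C (Dom C f) (Cod C g)) \<and>
     (\<forall>f\<in>Mor C. Comp C f (Ide C (Dom C f)) = f \<and> Comp C (Ide C (Cod C f)) f = f) \<and>
     (\<forall>f\<in>Mor C. \<forall>g\<in>Mor C. \<forall>h\<in>Mor C. Cod C f = Dom C g \<and> Cod C g = Dom C h \<longrightarrow>
        Comp C h (Comp C g f) = Comp C (Comp C h g) f)"

record ('o, 'a, 'p, 'b) func =
  fob :: "'o \<Rightarrow> 'p"
  fmor :: "'a \<Rightarrow> 'b"

definition is_functor :: "('o, 'a) category \<Rightarrow> ('p, 'b) category \<Rightarrow> ('o, 'a, 'p, 'b) func \<Rightarrow> bool" where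
  "is_functor C D F \<longleftrightarrow>
     fob F \<in> Ob C \<rightarrow>\<^sub>E Ob D \<and> fmor F \<in> Mor C \<rightarrow>\<^sub>E Mor D \<and>
     (\<forall>f\<in>Mor C. Dom D (fmor F f) = fob F (Dom C f) \<and> Cod D (fmor F f) = fob F (Cod C f)) \<and>
     (\<forall>x\<in>Ob C. fmor F (Ide C x) = Ide D (fob F x)) \<and>
     (\<forall>f\<in>Mor C. \<forall>g\<in>Mor C. Cod C f = Dom C g \<longrightarrow>
        fmor F (Comp C g f) = Comp D (fmor F g) (fmor F f))"

definition func_comp ::
  "('o, 'a) category \<Rightarrow> ('p, 'b, 'q, 'c) func \<Rightarrow> ('o, 'a, 'p, 'b) func \<Rightarrow> ('o, 'a, 'q, 'c) func" where
  "func_comp C G F = \<lparr>fob = compose (Ob C) (fob G) (fob F), fmor = compose (Mor C) (fmor G) (fmor F)\<rparr>"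

definition Free :: "quiver \<Rightarrow> (nat, qmor) category" where
  "Free Q = \<lparr>Ob = verts Q, Mor = paths Q, Dom = pstart, Cod = pend,
     Ide = vertex_path Q, Comp = (\<lambda>q p. pconcat p q)\<rparr>"

definition Free_map :: "qmor \<Rightarrow> (nat, qmor, nat, qmor) func" where
  "Free_map m = \<lparr>fob = restrict (vmap m) (verts (qdom m)), fmor = restrict (qcomp m) (paths (qdom m))\<rparr>"

type_synonym ('o, 'a) diagram = "(nat, qmor, 'o, 'a) func"

definition diagrams :: "('o, 'a) category \<Rightarrow> quiver \<Rightarrow> ('o, 'a) diagram set" where
  "diagrams C Q = {D. is_functor (Free Q) C D}"

definition pull :: "qmor \<Rightarrow> ('o, 'a) diagram \<Rightarrow> ('o, 'a) diagram" where
  "pull m D = func_comp (Free (qdom m)) D (Free_map m)"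

text \<open>Composite of the arrows \<open>0, \<dots>, j - 1\<close> of a diagram over \<open>PQ k\<close>.\<close>

primrec dcomp_upto :: "('o, 'a) category \<Rightarrow> nat \<Rightarrow> ('o, 'a) diagram \<Rightarrow> nat \<Rightarrow> 'a" where
  "dcomp_upto C k D 0 = Ide C (fob D 0)"
| "dcomp_upto C k D (Suc j) = Comp C (fmor D (arrow_path (PQ k) j)) (dcomp_upto C k D j)"

definition dcomp :: "('o, 'a) category \<Rightarrow> nat \<Rightarrow> ('o, 'a) diagram \<Rightarrow> 'a" where
  "dcomp C k D = dcomp_upto C k D k"

definition commutative :: "('o, 'a) category \<Rightarrow> quiver \<Rightarrow> ('o, 'a) diagram \<Rightarrow> bool" where
  "commutative C Q D \<longleftrightarrow>
     (\<forall>(p, q)\<in>BP Q. dcomp C (plen p) (pull p D) = dcomp C (plen q) (pull q D))"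


section \<open>Abelian categories\<close>

definition op_cat :: "('o, 'a) category \<Rightarrow> ('o, 'a) category" where
  "op_cat C = \<lparr>Ob = Ob C, Mor = Mor C, Dom = Cod C, Cod = Dom C, Ide = Ide C,
     Comp = (\<lambda>g f. Comp C f g)\<rparr>"

definition terminal :: "('o, 'a) category \<Rightarrow> 'o \<Rightarrow> bool" where
  "terminal C z \<longleftrightarrow> z \<in> Ob C \<and> (\<forall>x\<in>Ob C. \<exists>!f. f \<in> Hom C x z)"

definition zero_object :: "('o, 'a) category \<Rightarrow> 'o \<Rightarrow> bool" where
  "zero_object C z \<longleftrightarrow> terminal C z \<and> terminal (op_cat C) z"

definition zero_mor :: "('o, 'a) category \<Rightarrow> 'a \<Rightarrow> bool" where
  "zero_mor C f \<longleftrightarrow> f \<in> Mor C \<and>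
     (\<exists>z u v. zero_object C z \<and> u \<in> Hom C (Dom C f) z \<and> v \<in> Hom C z (Cod C f) \<and> f = Comp C v u)"

definition is_product :: "('o, 'a) category \<Rightarrow> 'o \<Rightarrow> 'o \<Rightarrow> 'o \<Rightarrow> 'a \<Rightarrow> 'a \<Rightarrow> bool" where
  "is_product C x y p p1 p2 \<longleftrightarrow> p \<in> Ob C \<and> p1 \<in> Hom C p x \<and> p2 \<in> Hom C p y \<and>
     (\<forall>c\<in>Ob C. \<forall>f\<in>Hom C c x. \<forall>g\<in>Hom C c y.
        \<exists>!h. h \<in> Hom C c p \<and> Comp C p1 h = f \<and> Comp C p2 h = g)"

definition is_kernel :: "('o, 'a) category \<Rightarrow> 'a \<Rightarrow> 'a \<Rightarrow> bool" where
  "is_kernel C f k \<longleftrightarrow> f \<in> Mor C \<and> k \<in> Mor C \<and> Cod C k = Dom C f \<and> zero_mor C (Comp C f k) \<and>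
     (\<forall>g\<in>Mor C. Cod C g = Dom C f \<and> zero_mor C (Comp C f g) \<longrightarrow>
        (\<exists>!h. h \<in> Hom C (Dom C g) (Dom C k) \<and> Comp C k h = g))"

definition monomorphism :: "('o, 'a) category \<Rightarrow> 'a \<Rightarrow> bool" where
  "monomorphism C f \<longleftrightarrow> f \<in> Mor C \<and>
     (\<forall>g\<in>Mor C. \<forall>h\<in>Mor C. Dom C g = Dom C h \<and> Cod C g = Dom C f \<and> Cod C h = Dom C f \<and>
        Comp C f g = Comp C f h \<longrightarrow> g = h)"

definition has_products :: "('o, 'a) category \<Rightarrow> bool" where
  "has_products C \<longleftrightarrow> (\<forall>x\<in>Ob C. \<forall>y\<in>Ob C. \<exists>p p1 p2. is_product C x y p p1 p2)"

definition has_kernels :: "('o, 'a) category \<Rightarrow> bool" where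
  "has_kernels C \<longleftrightarrow> (\<forall>f\<in>Mor C. \<exists>k. is_kernel C f k)"

definition monos_normal :: "('o, 'a) category \<Rightarrow> bool" where
  "monos_normal C \<longleftrightarrow> (\<forall>k. monomorphism C k \<longrightarrow> (\<exists>f. is_kernel C f k))"

text \<open>Freyd's definition. The notions of coproduct, cokernel and (normal) epimorphism are those of
  product, kernel and (normal) monomorphism in the opposite category. Smallness is automatic, the
  objects and the morphisms being given by sets.\<close>

definition abelian_category :: "('o, 'a) category \<Rightarrow> bool" where
  "abelian_category C \<longleftrightarrow> is_category C \<and> (\<exists>z. zero_object C z) \<and>
     has_products C \<and> has_products (op_cat C) \<and>
     has_kernels C \<and> has_kernels (op_cat C) \<and>
     monos_normal C \<and> monos_normal (op_cat C)"


section \<open>The signature: formulas, structures, satisfaction\<close>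

text \<open>Variables are de Bruijn indices: \<open>Var 0\<close> is bound by the innermost quantifier. Quantifiers
  carry the sort of the variable which they bind.\<close>

datatype tm = Var nat | RestrTm qmor tm

datatype fm =
    Top
  | Equal tm tm (infix \<open>\<approx>\<close> 50)
  | Commute quiver tm
  | Neg fm
  | And fm fm (infixr \<open>\<^bold>\<and>\<close> 35)
  | Or fm fm (infixr \<open>\<^bold>\<or>\<close> 30)
  | Implies fm fm (infixr \<open>\<^bold>\<longrightarrow>\<close> 25)
  | Iff fm fm (infixr \<open>\<^bold>\<longleftrightarrow>\<close> 25)
  | Forall quiver fm
  | Exists quiver fm
  | Exists1 quiver fm

primrec has_sort :: "(nat \<Rightarrow> quiver option) \<Rightarrow> tm \<Rightarrow> quiver \<Rightarrow> bool" where
  "has_sort \<Gamma> (Var i) Q \<longleftrightarrow> \<Gamma> i = Some Q"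
| "has_sort \<Gamma> (RestrTm m t) Q \<longleftrightarrow> acyclic_emb m \<and> qdom m = Q \<and> has_sort \<Gamma> t (qcod m)"

primrec well_sorted :: "(nat \<Rightarrow> quiver option) \<Rightarrow> fm \<Rightarrow> bool" where
  "well_sorted \<Gamma> Top \<longleftrightarrow> True"
| "well_sorted \<Gamma> (s \<approx> t) \<longleftrightarrow> (\<exists>Q. has_sort \<Gamma> s Q \<and> has_sort \<Gamma> t Q)"
| "well_sorted \<Gamma> (Commute Q t) \<longleftrightarrow> acyclic_quiver Q \<and> has_sort \<Gamma> t Q"
| "well_sorted \<Gamma> (Neg \<phi>) \<longleftrightarrow> well_sorted \<Gamma> \<phi>"
| "well_sorted \<Gamma> (\<phi> \<^bold>\<and> \<psi>) \<longleftrightarrow> well_sorted \<Gamma> \<phi> \<and> well_sorted \<Gamma> \<psi>"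
| "well_sorted \<Gamma> (\<phi> \<^bold>\<or> \<psi>) \<longleftrightarrow> well_sorted \<Gamma> \<phi> \<and> well_sorted \<Gamma> \<psi>"
| "well_sorted \<Gamma> (\<phi> \<^bold>\<longrightarrow> \<psi>) \<longleftrightarrow> well_sorted \<Gamma> \<phi> \<and> well_sorted \<Gamma> \<psi>"
| "well_sorted \<Gamma> (\<phi> \<^bold>\<longleftrightarrow> \<psi>) \<longleftrightarrow> well_sorted \<Gamma> \<phi> \<and> well_sorted \<Gamma> \<psi>"
| "well_sorted \<Gamma> (Forall Q \<phi>) \<longleftrightarrow> acyclic_quiver Q \<and> well_sorted (case_nat (Some Q) \<Gamma>) \<phi>"
| "well_sorted \<Gamma> (Exists Q \<phi>) \<longleftrightarrow> acyclic_quiver Q \<and> well_sorted (case_nat (Some Q) \<Gamma>) \<phi>"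
| "well_sorted \<Gamma> (Exists1 Q \<phi>) \<longleftrightarrow> acyclic_quiver Q \<and> well_sorted (case_nat (Some Q) \<Gamma>) \<phi>"

definition sentence :: "fm \<Rightarrow> bool" where
  "sentence \<phi> \<longleftrightarrow> well_sorted (\<lambda>_. None) \<phi>"

text \<open>All sorts of a structure live in one type, which is no restriction since the sorts form a set.
  Only acyclic quivers and embeddings between them are relevant as indices.\<close>

record 'm fo_struct =
  carr :: "quiver \<Rightarrow> 'm set"
  restr :: "qmor \<Rightarrow> 'm \<Rightarrow> 'm"
  commute :: "quiver \<Rightarrow> 'm set"

definition is_structure :: "'m fo_struct \<Rightarrow> bool" where
  "is_structure M \<longleftrightarrow>
     (\<forall>m. acyclic_emb m \<longrightarrow> restr M m \<in> carr M (qcod m) \<rightarrow> carr M (qdom m)) \<and>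
     (\<forall>Q. acyclic_quiver Q \<longrightarrow> commute M Q \<subseteq> carr M Q)"

primrec tm_val :: "'m fo_struct \<Rightarrow> (nat \<Rightarrow> 'm) \<Rightarrow> tm \<Rightarrow> 'm" where
  "tm_val M e (Var i) = e i"
| "tm_val M e (RestrTm m t) = restr M m (tm_val M e t)"

primrec sat :: "'m fo_struct \<Rightarrow> (nat \<Rightarrow> 'm) \<Rightarrow> fm \<Rightarrow> bool" where
  "sat M e Top \<longleftrightarrow> True"
| "sat M e (s \<approx> t) \<longleftrightarrow> tm_val M e s = tm_val M e t"
| "sat M e (Commute Q t) \<longleftrightarrow> tm_val M e t \<in> commute M Q"
| "sat M e (Neg \<phi>) \<longleftrightarrow> \<not> sat M e \<phi>"
| "sat M e (\<phi> \<^bold>\<and> \<psi>) \<longleftrightarrow> sat M e \<phi> \<and> sat M e \<psi>"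
| "sat M e (\<phi> \<^bold>\<or> \<psi>) \<longleftrightarrow> sat M e \<phi> \<or> sat M e \<psi>"
| "sat M e (\<phi> \<^bold>\<longrightarrow> \<psi>) \<longleftrightarrow> (sat M e \<phi> \<longrightarrow> sat M e \<psi>)"
| "sat M e (\<phi> \<^bold>\<longleftrightarrow> \<psi>) \<longleftrightarrow> (sat M e \<phi> \<longleftrightarrow> sat M e \<psi>)"
| "sat M e (Forall Q \<phi>) \<longleftrightarrow> (\<forall>x\<in>carr M Q. sat M (case_nat x e) \<phi>)"
| "sat M e (Exists Q \<phi>) \<longleftrightarrow> (\<exists>x\<in>carr M Q. sat M (case_nat x e) \<phi>)"
| "sat M e (Exists1 Q \<phi>) \<longleftrightarrow> (\<exists>!x. x \<in> carr M Q \<and> sat M (case_nat x e) \<phi>)"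

definition model_of :: "'m fo_struct \<Rightarrow> fm set \<Rightarrow> bool" where
  "model_of M T \<longleftrightarrow> is_structure M \<and> (\<forall>\<phi>\<in>T. \<forall>e. sat M e \<phi>)"

definition isomorphic :: "'m fo_struct \<Rightarrow> 'n fo_struct \<Rightarrow> bool" where
  "isomorphic M N \<longleftrightarrow> (\<exists>h.
     (\<forall>Q. acyclic_quiver Q \<longrightarrow> bij_betw (h Q) (carr M Q) (carr N Q)) \<and>
     (\<forall>m. acyclic_emb m \<longrightarrow>
        (\<forall>x\<in>carr M (qcod m). h (qdom m) (restr M m x) = restr N m (h (qcod m) x))) \<and>
     (\<forall>Q. acyclic_quiver Q \<longrightarrow> (\<forall>x\<in>carr M Q. x \<in> commute M Q \<longleftrightarrow> h Q x \<in> commute N Q)))"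

definition cat_interp :: "('o, 'a) category \<Rightarrow> ('o, 'a) diagram fo_struct" where
  "cat_interp C = \<lparr>carr = diagrams C, restr = pull,
     commute = (\<lambda>Q. {D \<in> diagrams C Q. commutative C Q D})\<rparr>"

text \<open>Syntactic duality.\<close>

primrec dual_tm :: "tm \<Rightarrow> tm" where
  "dual_tm (Var i) = Var i"
| "dual_tm (RestrTm m t) = RestrTm (dual_qmor m) (dual_tm t)"

primrec dual_fm :: "fm \<Rightarrow> fm" where
  "dual_fm Top = Top"
| "dual_fm (s \<approx> t) = (dual_tm s \<approx> dual_tm t)"
| "dual_fm (Commute Q t) = Commute (dual_quiver Q) (dual_tm t)"
| "dual_fm (Neg \<phi>) = Neg (dual_fm \<phi>)"
| "dual_fm (\<phi> \<^bold>\<and> \<psi>) = (dual_fm \<phi> \<^bold>\<and> dual_fm \<psi>)"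
| "dual_fm (\<phi> \<^bold>\<or> \<psi>) = (dual_fm \<phi> \<^bold>\<or> dual_fm \<psi>)"
| "dual_fm (\<phi> \<^bold>\<longrightarrow> \<psi>) = (dual_fm \<phi> \<^bold>\<longrightarrow> dual_fm \<psi>)"
| "dual_fm (\<phi> \<^bold>\<longleftrightarrow> \<psi>) = (dual_fm \<phi> \<^bold>\<longleftrightarrow> dual_fm \<psi>)"
| "dual_fm (Forall Q \<phi>) = Forall (dual_quiver Q) (dual_fm \<phi>)"
| "dual_fm (Exists Q \<phi>) = Exists (dual_quiver Q) (dual_fm \<phi>)"
| "dual_fm (Exists1 Q \<phi>) = Exists1 (dual_quiver Q) (dual_fm \<phi>)"

text \<open>Defined formulas take terms as arguments; \<open>lift n\<close> moves a term under \<open>n\<close> further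
  quantifiers.\<close>

primrec lift :: "nat \<Rightarrow> tm \<Rightarrow> tm" where
  "lift n (Var i) = Var (i + n)"
| "lift n (RestrTm m t) = RestrTm m (lift n t)"

primrec conj_list :: "fm list \<Rightarrow> fm" where
  "conj_list [] = Top"
| "conj_list (\<phi> # \<phi>s) = (\<phi> \<^bold>\<and> conj_list \<phi>s)"

text \<open>Conjunction over a finite index set, in some fixed order.\<close>

definition conj_over :: "'i set \<Rightarrow> ('i \<Rightarrow> fm) \<Rightarrow> fm" where
  "conj_over I \<phi> = conj_list (map \<phi> (SOME is. set is = I \<and> distinct is))"


section \<open>The theory of categories\<close>

definition empty_quiver :: quiver where
  "empty_quiver = \<lparr>verts = {}, arrs = {}, src = (\<lambda>_. undefined), tgt = (\<lambda>_. undefined)\<rparr>"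

definition D2 :: quiver where
  "D2 = \<lparr>verts = {0, 1}, arrs = {}, src = (\<lambda>_. undefined), tgt = (\<lambda>_. undefined)\<rparr>"

definition C2 :: quiver where
  "C2 = \<lparr>verts = {0, 1}, arrs = {0, 1}, src = (\<lambda>a\<in>{0, 1}. 0), tgt = (\<lambda>a\<in>{0, 1}. 1)\<rparr>"

definition Tri :: quiver where
  "Tri = \<lparr>verts = {0, 1, 2}, arrs = {0, 1, 2},
     src = (\<lambda>a\<in>{0, 1, 2}. if a = 2 then 1 else 0),
     tgt = (\<lambda>a\<in>{0, 1, 2}. if a = 0 then 1 else 2)\<rparr>"

definition sp :: "nat \<Rightarrow> nat \<Rightarrow> qmor" where
  "sp k l = \<lparr>qdom = PQ k, qcod = PQ l, vmap = (\<lambda>i\<in>{0..k}. i), amap = (\<lambda>i\<in>{0..<k}. i)\<rparr>"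

definition tp :: "nat \<Rightarrow> nat \<Rightarrow> qmor" where
  "tp k l = \<lparr>qdom = PQ k, qcod = PQ l,
     vmap = (\<lambda>i\<in>{0..k}. i + l - k), amap = (\<lambda>i\<in>{0..<k}. i + l - k)\<rparr>"

definition st :: "nat \<Rightarrow> qmor" where
  "st k = \<lparr>qdom = D2, qcod = PQ k, vmap = (\<lambda>i\<in>{0, 1}. if i = 0 then 0 else k),
     amap = (\<lambda>_. undefined)\<rparr>"

definition pushout_config :: "qmor \<Rightarrow> qmor \<Rightarrow> qmor \<Rightarrow> qmor \<Rightarrow> bool" where
  "pushout_config m1 m2 m1' m2' \<longleftrightarrow>
     acyclic_emb m1 \<and> acyclic_emb m2 \<and> acyclic_emb m1' \<and> acyclic_emb m2' \<and>
     qdom m1 = qdom m2 \<and> qcod m1 = qdom m1' \<and> qcod m2 = qdom m2' \<and> qcod m1' = qcod m2' \<and>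
     qcomp m1' m1 = qcomp m2' m2 \<and>
     verts (qcod m1') = vmap m1' ` verts (qdom m1') \<union> vmap m2' ` verts (qdom m2') \<and>
     arrs (qcod m1') = amap m1' ` arrs (qdom m1') \<union> amap m2' ` arrs (qdom m2') \<and>
     vmap (qcomp m1' m1) ` verts (qdom m1) =
       vmap m1' ` verts (qdom m1') \<inter> vmap m2' ` verts (qdom m2') \<and>
     amap (qcomp m1' m1) ` arrs (qdom m1) =
       amap m1' ` arrs (qdom m1') \<inter> amap m2' ` arrs (qdom m2')"

definition Cospan_fm :: "qmor \<Rightarrow> qmor \<Rightarrow> tm \<Rightarrow> tm \<Rightarrow> tm \<Rightarrow> fm" where
  "Cospan_fm m1' m2' x1 x2 x' = (RestrTm m1' x' \<approx> x1 \<^bold>\<and> RestrTm m2' x' \<approx> x2)"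

definition EmptyEU :: fm where
  "EmptyEU = Exists1 empty_quiver Top"

definition RestrComp :: "qmor \<Rightarrow> qmor \<Rightarrow> fm" where
  "RestrComp m m' = Forall (qcod m') (RestrTm m (RestrTm m' (Var 0)) \<approx> RestrTm (qcomp m' m) (Var 0))"

definition PushoutEU :: "qmor \<Rightarrow> qmor \<Rightarrow> qmor \<Rightarrow> qmor \<Rightarrow> fm" where
  "PushoutEU m1 m2 m1' m2' = Forall (qcod m1) (Forall (qcod m2)
     (RestrTm m1 (Var 1) \<approx> RestrTm m2 (Var 0) \<^bold>\<longrightarrow>
      Exists1 (qcod m1') (Cospan_fm m1' m2' (Var 2) (Var 1) (Var 0))))"

definition Comp_fm :: "tm \<Rightarrow> tm \<Rightarrow> tm \<Rightarrow> fm" where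
  "Comp_fm x y z = Exists Tri
     (RestrTm (arrow_path Tri 0) (Var 0) \<approx> lift 1 x \<^bold>\<and>
      RestrTm (arrow_path Tri 2) (Var 0) \<approx> lift 1 y \<^bold>\<and>
      RestrTm (arrow_path Tri 1) (Var 0) \<approx> lift 1 z \<^bold>\<and>
      Commute Tri (Var 0))"

definition CompE :: fm where
  "CompE = Forall (PQ 1) (Forall (PQ 1)
     (RestrTm (tp 0 1) (Var 1) \<approx> RestrTm (sp 0 1) (Var 0) \<^bold>\<longrightarrow>
      Exists (PQ 1) (Comp_fm (Var 2) (Var 1) (Var 0))))"

text \<open>The chosen pushout of \<open>st k\<close> and \<open>st l\<close> for \<open>k, l \<ge> 1\<close>: two paths of lengths \<open>k\<close> and \<open>l\<close> glued
  at both ends. The first path consists of the vertices \<open>0, \<dots>, k\<close> and of the arrows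
  \<open>0, \<dots>, k - 1\<close>, the second one of the vertices \<open>0, k + 1, \<dots>, k + l - 1, k\<close> and of the arrows
  \<open>k, \<dots>, k + l - 1\<close>, in this order.\<close>

definition bipath_vert :: "nat \<Rightarrow> nat \<Rightarrow> nat \<Rightarrow> nat" where
  "bipath_vert k l i = (if i = 0 then 0 else if i = l then k else k + i)"

definition bipath :: "nat \<Rightarrow> nat \<Rightarrow> quiver" where
  "bipath k l = \<lparr>verts = {0..<k + l}, arrs = {0..<k + l},
     src = (\<lambda>a\<in>{0..<k + l}. if a < k then a else bipath_vert k l (a - k)),
     tgt = (\<lambda>a\<in>{0..<k + l}. if a < k then Suc a else bipath_vert k l (Suc (a - k)))\<rparr>"

definition bipath1 :: "nat \<Rightarrow> nat \<Rightarrow> qmor" where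
  "bipath1 k l = \<lparr>qdom = PQ k, qcod = bipath k l, vmap = (\<lambda>i\<in>{0..k}. i), amap = (\<lambda>i\<in>{0..<k}. i)\<rparr>"

definition bipath2 :: "nat \<Rightarrow> nat \<Rightarrow> qmor" where
  "bipath2 k l = \<lparr>qdom = PQ l, qcod = bipath k l,
     vmap = (\<lambda>i\<in>{0..l}. bipath_vert k l i), amap = (\<lambda>i\<in>{0..<l}. k + i)\<rparr>"

definition EqPath_pos :: "nat \<Rightarrow> nat \<Rightarrow> tm \<Rightarrow> tm \<Rightarrow> fm" where
  "EqPath_pos k l x1 x2 =
     (RestrTm (st k) x1 \<approx> RestrTm (st l) x2 \<^bold>\<and>
      Forall (bipath k l)
        (Cospan_fm (bipath1 k l) (bipath2 k l) (lift 1 x1) (lift 1 x2) (Var 0) \<^bold>\<longrightarrow>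
         Commute (bipath k l) (Var 0)))"

definition Id_fm :: "tm \<Rightarrow> tm \<Rightarrow> fm" where
  "Id_fm x y =
     (RestrTm (sp 0 1) y \<approx> x \<^bold>\<and>
      Forall (PQ 1) (Forall (PQ 1)
        ((Comp_fm (lift 2 y) (Var 1) (Var 0) \<^bold>\<longrightarrow> EqPath_pos 1 1 (Var 1) (Var 0)) \<^bold>\<and>
         (Comp_fm (Var 1) (lift 2 y) (Var 0) \<^bold>\<longrightarrow> EqPath_pos 1 1 (Var 1) (Var 0)))))"

definition IdE :: fm where
  "IdE = Forall (PQ 0) (Exists (PQ 1) (Id_fm (Var 1) (Var 0)))"

definition EqPath_zero_pos :: "nat \<Rightarrow> tm \<Rightarrow> tm \<Rightarrow> fm" where
  "EqPath_zero_pos l x y =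
     Exists (PQ 1) (Id_fm (lift 1 x) (Var 0) \<^bold>\<and> EqPath_pos 1 l (Var 0) (lift 1 y))"

definition EqPath :: "nat \<Rightarrow> nat \<Rightarrow> tm \<Rightarrow> tm \<Rightarrow> fm" where
  "EqPath k l x y =
     (if k = 0 \<and> l = 0 then x \<approx> y
      else if k = 0 then EqPath_zero_pos l x y
      else if l = 0 then EqPath_zero_pos k y x
      else EqPath_pos k l x y)"

definition EqPathRefl :: "nat \<Rightarrow> fm" where
  "EqPathRefl k = Forall (PQ k) (EqPath k k (Var 0) (Var 0))"

definition EqPathSym :: "nat \<Rightarrow> nat \<Rightarrow> fm" where
  "EqPathSym k l = Forall (PQ k) (Forall (PQ l)
     (EqPath k l (Var 1) (Var 0) \<^bold>\<longrightarrow> EqPath l k (Var 0) (Var 1)))"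

definition EqPathTrans :: "nat \<Rightarrow> nat \<Rightarrow> nat \<Rightarrow> fm" where
  "EqPathTrans k l n = Forall (PQ k) (Forall (PQ l) (Forall (PQ n)
     (EqPath k l (Var 2) (Var 1) \<^bold>\<and> EqPath l n (Var 1) (Var 0) \<^bold>\<longrightarrow> EqPath k n (Var 2) (Var 0))))"

text \<open>Here \<open>k1', k2'\<close> are the lengths of the second factors. The outer variables are, in order,
  \<open>x1, x2, x1', x2'\<close>; the inner ones are \<open>x1'', x2''\<close>.\<close>

definition EqPathConcat :: "nat \<Rightarrow> nat \<Rightarrow> nat \<Rightarrow> nat \<Rightarrow> fm" where
  "EqPathConcat k1 k2 k1' k2' =
     Forall (PQ k1) (Forall (PQ k2) (Forall (PQ k1') (Forall (PQ k2')
       (EqPath k1 k2 (Var 3) (Var 2) \<^bold>\<and> EqPath k1' k2' (Var 1) (Var 0) \<^bold>\<and>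
        RestrTm (tp 0 k1) (Var 3) \<approx> RestrTm (sp 0 k1') (Var 1) \<^bold>\<longrightarrow>
        Forall (PQ (k1 + k1')) (Forall (PQ (k2 + k2'))
          (Cospan_fm (sp k1 (k1 + k1')) (tp k1' (k1 + k1')) (Var 5) (Var 3) (Var 1) \<^bold>\<and>
           Cospan_fm (sp k2 (k2 + k2')) (tp k2' (k2 + k2')) (Var 4) (Var 2) (Var 0) \<^bold>\<longrightarrow>
           EqPath (k1 + k1') (k2 + k2') (Var 1) (Var 0)))))))"

definition ComEq :: fm where
  "ComEq = Forall C2 (Commute C2 (Var 0) \<^bold>\<longrightarrow>
     RestrTm (arrow_path C2 0) (Var 0) \<approx> RestrTm (arrow_path C2 1) (Var 0))"

definition PathCom :: "quiver \<Rightarrow> fm" where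
  "PathCom Q = Forall Q
     (conj_over (BP Q) (\<lambda>(p, q). EqPath (plen p) (plen q) (RestrTm p (Var 0)) (RestrTm q (Var 0)))
      \<^bold>\<longleftrightarrow> Commute Q (Var 0))"

definition T_cat :: "fm set" where
  "T_cat =
     {EmptyEU}
     \<union> {RestrComp m m' |m m'. acyclic_emb m \<and> acyclic_emb m' \<and> qcod m = qdom m'}
     \<union> {PushoutEU m1 m2 m1' m2' |m1 m2 m1' m2'. pushout_config m1 m2 m1' m2'}
     \<union> {CompE, IdE}
     \<union> {EqPathRefl k |k. True}
     \<union> {EqPathSym k l |k l. True}
     \<union> {EqPathTrans k l n |k l n. True}
     \<union> {EqPathConcat k1 k2 k1' k2' |k1 k2 k1' k2'. True}
     \<union> {ComEq}
     \<union> {PathCom Q |Q. acyclic_quiver Q}"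


section \<open>The theory of abelian categories\<close>

text \<open>In \<open>MonoQ\<close> the arrows \<open>g, h, f, k\<close> are \<open>0, 1, 2, 3\<close>.\<close>

definition MonoQ :: quiver where
  "MonoQ = \<lparr>verts = {0, 1, 2}, arrs = {0, 1, 2, 3},
     src = (\<lambda>a\<in>{0, 1, 2, 3}. if a = 2 then 1 else 0),
     tgt = (\<lambda>a\<in>{0, 1, 2, 3}. if a \<le> 1 then 1 else 2)\<rparr>"

definition Mono_fm :: "tm \<Rightarrow> fm" where
  "Mono_fm x = Forall MonoQ
     (RestrTm (arrow_path MonoQ 2) (Var 0) \<approx> lift 1 x \<^bold>\<and>
      Commute (subq MonoQ {0, 1, 2} {0, 2, 3}) (RestrTm (subq_incl MonoQ {0, 1, 2} {0, 2, 3}) (Var 0)) \<^bold>\<and>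
      Commute (subq MonoQ {0, 1, 2} {1, 2, 3}) (RestrTm (subq_incl MonoQ {0, 1, 2} {1, 2, 3}) (Var 0)) \<^bold>\<longrightarrow>
      Commute (subq MonoQ {0, 1} {0, 1}) (RestrTm (subq_incl MonoQ {0, 1} {0, 1}) (Var 0)))"

definition fresh :: "nat set \<Rightarrow> nat" where
  "fresh X = (if X = {} then 0 else Suc (Max X))"

definition apex :: "quiver \<Rightarrow> nat" where
  "apex Q = fresh (verts Q)"

definition leg :: "quiver \<Rightarrow> nat \<Rightarrow> nat" where
  "leg Q v = fresh (arrs Q) + v"

definition cone :: "quiver \<Rightarrow> quiver" where
  "cone Q = \<lparr>verts = insert (apex Q) (verts Q), arrs = arrs Q \<union> leg Q ` verts Q,
     src = (\<lambda>a\<in>arrs Q \<union> leg Q ` verts Q. if a \<in> arrs Q then src Q a else apex Q),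
     tgt = (\<lambda>a\<in>arrs Q \<union> leg Q ` verts Q. if a \<in> arrs Q then tgt Q a else a - fresh (arrs Q))\<rparr>"

definition cone_incl :: "quiver \<Rightarrow> qmor" where
  "cone_incl Q = \<lparr>qdom = Q, qcod = cone Q, vmap = (\<lambda>v\<in>verts Q. v), amap = (\<lambda>a\<in>arrs Q. a)\<rparr>"

definition cone_mor :: "qmor \<Rightarrow> qmor" where
  "cone_mor m = \<lparr>qdom = cone (qdom m), qcod = cone (qcod m),
     vmap = (\<lambda>v\<in>verts (cone (qdom m)). if v \<in> verts (qdom m) then vmap m v else apex (qcod m)),
     amap = (\<lambda>a\<in>arrs (cone (qdom m)). if a \<in> arrs (qdom m) then amap m a
               else leg (qcod m) (vmap m (a - fresh (arrs (qdom m)))))\<rparr>"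

definition Cone_fm :: "quiver \<Rightarrow> tm \<Rightarrow> tm \<Rightarrow> fm" where
  "Cone_fm Q x y =
     (RestrTm (cone_incl Q) y \<approx> x \<^bold>\<and>
      conj_over (arrs Q) (\<lambda>a. Commute (cone (PQ 1)) (RestrTm (cone_mor (arrow_path Q a)) y)))"

definition Limit_fm :: "quiver \<Rightarrow> tm \<Rightarrow> tm \<Rightarrow> fm" where
  "Limit_fm Q x y =
     (Cone_fm Q x y \<^bold>\<and>
      Forall (cone Q)
        (Cone_fm Q (lift 1 x) (Var 0) \<^bold>\<longrightarrow>
         Exists1 (cone (cone Q))
           (Cone_fm (cone Q) (lift 2 y) (Var 0) \<^bold>\<and>
            RestrTm (cone_mor (cone_incl Q)) (Var 0) \<approx> Var 1)))"

text \<open>The dual of a formula in two variables, applied to terms: since duality is an involution,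
  dualising the arguments first makes the outer dualisation leave them unchanged.\<close>

definition Colimit_fm :: "quiver \<Rightarrow> tm \<Rightarrow> tm \<Rightarrow> fm" where
  "Colimit_fm Q x y = dual_fm (Limit_fm (dual_quiver Q) (dual_tm x) (dual_tm y))"

definition Zero_fm :: "tm \<Rightarrow> fm" where
  "Zero_fm x = Forall empty_quiver
     (Limit_fm empty_quiver (Var 0) (lift 1 x) \<^bold>\<and> Colimit_fm empty_quiver (Var 0) (lift 1 x))"

text \<open>The vertices \<open>a, b, o\<close> are \<open>0, 1, 2\<close> and the arrows \<open>f, u\<close> are \<open>0, 1\<close>.\<close>

definition CospanQ :: quiver where
  "CospanQ = \<lparr>verts = {0, 1, 2}, arrs = {0, 1},
     src = (\<lambda>a\<in>{0, 1}. if a = 0 then 0 else 2), tgt = (\<lambda>a\<in>{0, 1}. 1)\<rparr>"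

definition Ker_fm :: "tm \<Rightarrow> tm \<Rightarrow> fm" where
  "Ker_fm x y = Exists (cone CospanQ)
     (RestrTm (arrow_path (cone CospanQ) 0) (Var 0) \<approx> lift 1 x \<^bold>\<and>
      RestrTm (arrow_path (cone CospanQ) (leg CospanQ 0)) (Var 0) \<approx> lift 1 y \<^bold>\<and>
      Zero_fm (RestrTm (vertex_path (cone CospanQ) 2) (Var 0)) \<^bold>\<and>
      Limit_fm CospanQ (RestrTm (cone_incl CospanQ) (Var 0)) (Var 0))"

definition ZeroE :: fm where
  "ZeroE = Exists (PQ 0) (Zero_fm (Var 0))"

definition ProductE :: fm where
  "ProductE = Forall D2 (Exists (cone D2) (Limit_fm D2 (Var 1) (Var 0)))"

definition KerE :: fm where
  "KerE = Forall (PQ 1) (Exists (PQ 1) (Ker_fm (Var 1) (Var 0)))"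

definition MonoNormal :: fm where
  "MonoNormal = Forall (PQ 1) (Mono_fm (Var 0) \<^bold>\<longrightarrow> Exists (PQ 1) (Ker_fm (Var 0) (Var 1)))"

definition T_ab :: "fm set" where
  "T_ab = T_cat \<union> {ZeroE, ProductE, dual_fm ProductE, KerE, dual_fm KerE,
                    MonoNormal, dual_fm MonoNormal}"


section \<open>Adequacy checks\<close>

text \<open>None of the following enters the definitions above. It is proved that \<open>cone empty_quiver\<close> is
  literally \<open>PQ 0\<close>, that the two paths of \<open>bipath k l\<close> form a pushout configuration with \<open>st k\<close>
  and \<open>st l\<close>, that every element of \<open>T_ab\<close> is a sentence over the signature, and that
  \<open>cat_interp C\<close> is a structure for every category \<open>C\<close>.\<close>

lemma cone_empty: "cone empty_quiver = PQ 0"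
  by (auto simp: cone_def empty_quiver_def PQ_def apex_def fresh_def)

lemma dual_dual: "dual_quiver (dual_quiver Q) = Q" "dual_qmor (dual_qmor m) = m"
  by (simp_all add: dual_quiver_def dual_qmor_def)

lemma dual_dual_tm: "dual_tm (dual_tm t) = t" by (induction t) (simp_all add: dual_dual)

definition ranked :: "quiver \<Rightarrow> bool" where
  "ranked Q \<longleftrightarrow> is_quiver Q \<and> (\<exists>r::nat \<Rightarrow> nat. \<forall>a\<in>arrs Q. r (src Q a) < r (tgt Q a))"

lemma PQ_simps[simp]: "verts (PQ k) = {0..k}" "arrs (PQ k) = {0..<k}"
  "i < k \<Longrightarrow> src (PQ k) i = i" "i < k \<Longrightarrow> tgt (PQ k) i = Suc i" by (auto simp: PQ_def)

lemma path_ranked: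
  assumes p: "p \<in> paths Q" and r: "\<forall>a\<in>arrs Q. (r::nat\<Rightarrow>nat) (src Q a) < r (tgt Q a)"
  shows "embedding p"
proof -
  from p obtain k where k: "qdom p = PQ k" "qcod p = Q" and m: "is_qmor p" by (auto simp: paths_def)
  have st: "src Q (amap p i) = vmap p i" "tgt Q (amap p i) = vmap p (Suc i)" "amap p i \<in> arrs Q" if "i < k" for i
    using m that unfolding is_qmor_def k by (auto simp: k)
  have step: "r (vmap p i) < r (vmap p (Suc i))" if "i < k" for i using st[OF that] r by metis
  have mono: "i < j \<Longrightarrow> j \<le> k \<Longrightarrow> r (vmap p i) < r (vmap p j)" for i j
    by (induction j) (use step in \<open>force simp: less_Suc_eq Suc_le_eq\<close>)+
  have iv: "inj_on (vmap p) {0..k}"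
    by (rule inj_onI) (metis mono atLeastAtMost_iff less_irrefl linorder_neqE_nat)
  have ia: "inj_on (amap p) {0..<k}"
    by (rule inj_onI) (metis st(1) iv inj_onD atLeastLessThan_iff atLeastAtMost_iff less_imp_le)
  show ?thesis using m iv ia by (simp add: embedding_def k)
qed

lemma ranked_acyclic: "ranked Q \<Longrightarrow> acyclic_quiver Q"
  unfolding ranked_def acyclic_quiver_def using path_ranked by blast

lemma ranked_dual: assumes "ranked Q" shows "ranked (dual_quiver Q)"
proof -
  from assms obtain r :: "nat \<Rightarrow> nat" where q: "is_quiver Q" and r: "\<forall>a\<in>arrs Q. r (src Q a) < r (tgt Q a)"
    by (auto simp: ranked_def)
  let ?N = "Max (r ` verts Q)"
  have "r v \<le> ?N" if "v \<in> verts Q" for v using q that by (simp add: is_quiver_def)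
  then have "\<forall>a\<in>arrs Q. ?N - r (tgt Q a) < ?N - r (src Q a)"
    using r q by (metis PiE_mem diff_less_mono2 is_quiver_def less_le_trans)
  then show ?thesis using q by (auto simp: ranked_def dual_quiver_def is_quiver_def intro!: exI[of _ "\<lambda>v. ?N - r v"])
qed

lemma fresh_notin: "finite X \<Longrightarrow> fresh X + n \<notin> X"
proof
  assume "finite X" "fresh X + n \<in> X"
  then have "fresh X + n \<le> Max X" "X \<noteq> {}" by auto
  then show False by (simp add: fresh_def)
qed

lemma cone_simps: assumes "is_quiver Q"
  shows "apex Q \<notin> verts Q" "leg Q v \<notin> arrs Q" 
  "a \<in> arrs Q \<Longrightarrow> src (cone Q) a = src Q a" "a \<in> arrs Q \<Longrightarrow> tgt (cone Q) a = tgt Q a"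
  "v \<in> verts Q \<Longrightarrow> src (cone Q) (leg Q v) = apex Q" "v \<in> verts Q \<Longrightarrow> tgt (cone Q) (leg Q v) = v"
  "verts (cone Q) = insert (apex Q) (verts Q)" "arrs (cone Q) = arrs Q \<union> leg Q ` verts Q"
  "leg Q v - fresh (arrs Q) = v"
  using assms fresh_notin[of "verts Q" 0] fresh_notin[of "arrs Q"]
  by (auto simp: is_quiver_def apex_def leg_def cone_def)

lemma src_in: "is_quiver Q \<Longrightarrow> a \<in> arrs Q \<Longrightarrow> src Q a \<in> verts Q"
  and tgt_in: "is_quiver Q \<Longrightarrow> a \<in> arrs Q \<Longrightarrow> tgt Q a \<in> verts Q"
  by (auto simp: is_quiver_def)

lemma cone_quiver: assumes q: "is_quiver Q" shows "is_quiver (cone Q)"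
proof -
  have "src (cone Q) \<in> arrs (cone Q) \<rightarrow>\<^sub>E verts (cone Q)"
    by (rule PiE_I) (use q in \<open>auto simp: cone_simps[OF q] src_in\<close>, auto simp: cone_def)
  moreover have "tgt (cone Q) \<in> arrs (cone Q) \<rightarrow>\<^sub>E verts (cone Q)"
    by (rule PiE_I) (use q in \<open>auto simp: cone_simps[OF q] tgt_in\<close>, auto simp: cone_def)
  ultimately show ?thesis using q unfolding is_quiver_def[of "cone Q"] by (auto simp: cone_simps[OF q] is_quiver_def)
qed

lemma ranked_cone: assumes "ranked Q" shows "ranked (cone Q)"
proof -
  from assms obtain r :: "nat \<Rightarrow> nat" where q: "is_quiver Q" and r: "\<forall>a\<in>arrs Q. r (src Q a) < r (tgt Q a)"
    by (auto simp: ranked_def)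
  have "\<forall>a\<in>arrs (cone Q). (\<lambda>v. if v = apex Q then 0 else Suc (r v)) (src (cone Q) a) < (\<lambda>v. if v = apex Q then 0 else Suc (r v)) (tgt (cone Q) a)"
    using r by (auto simp: cone_simps[OF q]) (metis cone_simps(1) q tgt_in)+
  then show ?thesis using cone_quiver[OF q] unfolding ranked_def by (intro conjI exI[of _ "\<lambda>v. if v = apex Q then 0 else Suc (r v)"])
qed

lemma ranked_concrete: "ranked empty_quiver" "ranked D2" "ranked C2" "ranked Tri" "ranked MonoQ"
  by (auto simp: ranked_def is_quiver_def empty_quiver_def D2_def C2_def Tri_def MonoQ_def
     intro!: exI[of _ id])

lemma ranked_CospanQ: "ranked CospanQ"
  by (auto simp: ranked_def is_quiver_def CospanQ_def intro!: exI[of _ "\<lambda>x. if x = 1 then 1 else 0"])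

lemma ranked_PQ: "ranked (PQ k)"
  by (auto simp: ranked_def is_quiver_def PQ_def intro!: exI[of _ id])

lemma ranked_bipath: "0 < k \<Longrightarrow> 0 < l \<Longrightarrow> ranked (bipath k l)"
  unfolding ranked_def is_quiver_def bipath_def
  apply (auto simp: bipath_vert_def intro!: exI[of _ "\<lambda>v. if v = k then k + l else if v < k then v else v - k"])
  done

lemma pushout_config_bipath:
  assumes "0 < k" "0 < l" shows "pushout_config (st k) (st l) (bipath1 k l) (bipath2 k l)"
proof -
  note r = ranked_acyclic[OF ranked_bipath[OF assms]] ranked_acyclic[OF ranked_PQ] ranked_acyclic[OF ranked_concrete(2)]
  have iq: "is_quiver (bipath k l)" "is_quiver (PQ n)" "is_quiver D2" for n
    using r by (auto simp: acyclic_quiver_def)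
  have s: "acyclic_emb (st n)" if "0 < n" for n
    unfolding acyclic_emb_def embedding_def is_qmor_def using that r iq
    by (auto simp: st_def D2_def inj_on_def)
  have b1: "acyclic_emb (bipath1 k l)"
    unfolding acyclic_emb_def embedding_def is_qmor_def using assms r iq
    by (auto simp: bipath1_def inj_on_def bipath_def bipath_vert_def)
  have b2: "acyclic_emb (bipath2 k l)"
    unfolding acyclic_emb_def embedding_def is_qmor_def using assms r iq
    by (auto simp: bipath2_def inj_on_def bipath_def bipath_vert_def)
  have im1: "vmap (bipath1 k l) ` {0..k} = {0..k}" "amap (bipath1 k l) ` {0..<k} = {0..<k}"
    by (auto simp: bipath1_def)
  have "vmap (bipath2 k l) ` {1..<l} = (\<lambda>i. k + i) ` {1..<l}"
    by (rule image_cong) (auto simp: bipath2_def bipath_vert_def)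
  also have "\<dots> = {k+1..<k+l}" by (simp add: image_add_atLeastLessThan add.commute)
  finally have "vmap (bipath2 k l) ` ({0,l} \<union> {1..<l}) = {0,k} \<union> {k+1..<k+l}"
    unfolding image_Un using assms by (simp add: bipath2_def bipath_vert_def insert_commute)
  moreover have "{0..l} = {0,l} \<union> {1..<l}" using assms by auto
  ultimately have im2: "vmap (bipath2 k l) ` {0..l} = {0,k} \<union> {k+1..<k+l}" by simp
  have im3: "amap (bipath2 k l) ` {0..<l} = {k..<k+l}"
    by (auto simp: bipath2_def image_iff)
  have e: "qcomp (bipath1 k l) (st k) = qcomp (bipath2 k l) (st l)"
    using assms by (auto simp: qcomp_def st_def bipath1_def bipath2_def bipath_vert_def compose_def D2_def)
  have d: "qdom (st n) = D2" "qdom (bipath1 k l) = PQ k" "qdom (bipath2 k l) = PQ l" "qcod (bipath1 k l) = bipath k l"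
    "qcod (bipath2 k l) = bipath k l" "qcod (st n) = PQ n" for n
    by (simp_all add: st_def bipath1_def bipath2_def)
  have w: "verts (bipath k l) = {0..<k + l}" "arrs (bipath k l) = {0..<k + l}"
    "vmap (qcomp (bipath1 k l) (st k)) ` verts D2 = {0, k}"
    "amap (qcomp (bipath1 k l) (st k)) ` arrs D2 = {}"
    by (auto simp: bipath_def qcomp_def d D2_def st_def bipath1_def compose_def image_iff)
  have x: "{0..<k + l} = {0..k} \<union> ({0, k} \<union> {k + 1..<k + l})" "{0..<k + l} = {0..<k} \<union> {k..<k + l}"
    "{0, k} = {0..k} \<inter> ({0, k} \<union> {k + 1..<k + l})" "{} = {0..<k} \<inter> {k..<k + l}"
    using assms by auto
  show ?thesis unfolding pushout_config_def d PQ_simps im1 im2 im3 w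
    by (intro conjI s b1 b2 e x assms refl)
qed

lemma acyclic_emb_qcomp: assumes "acyclic_emb m" "acyclic_emb m'" "qcod m = qdom m'"
  shows "acyclic_emb (qcomp m' m)"
  using assms src_in[of "qdom m"] tgt_in[of "qdom m"] unfolding acyclic_emb_def embedding_def is_qmor_def qcomp_def
  by (auto simp: PiE_iff inj_on_def compose_def extensional_def)

lemma well_sorted_conj_list: "well_sorted \<Gamma> (conj_list xs) \<longleftrightarrow> (\<forall>x\<in>set xs. well_sorted \<Gamma> x)" by (induction xs) auto

lemma well_sorted_conj_over: "finite I \<Longrightarrow> well_sorted \<Gamma> (conj_over I f) \<longleftrightarrow> (\<forall>i\<in>I. well_sorted \<Gamma> (f i))"
  unfolding conj_over_def well_sorted_conj_list
  using someI_ex[OF finite_distinct_list[of I]] by simp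

lemma has_sort_lift: "has_sort \<Gamma> (lift n t) Q \<longleftrightarrow> has_sort (\<lambda>i. \<Gamma> (i + n)) t Q" by (induction t arbitrary: Q) auto

lemma shift_case_nat: "(\<lambda>i. case_nat a G (i + 1)) = G" "(\<lambda>i. case_nat a (case_nat b G) (i + 2)) = G" "(\<lambda>i. case_nat a G (Suc i)) = G"
  "(\<lambda>i. case_nat a (case_nat b G) (Suc (Suc i))) = G"
  by (auto simp: fun_eq_iff numeral_2_eq_2)

lemma has_sort_lift_case_nat: "has_sort (case_nat a \<Gamma>) (lift 1 t) Q \<longleftrightarrow> has_sort \<Gamma> t Q" 
  "has_sort (case_nat a (case_nat b \<Gamma>)) (lift 2 t) Q \<longleftrightarrow> has_sort \<Gamma> t Q" 
  "has_sort (case_nat a \<Gamma>) (lift (Suc 0) t) Q \<longleftrightarrow> has_sort \<Gamma> t Q" 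
  unfolding has_sort_lift by (simp_all add: shift_case_nat)

lemma acyclic_is_quiver: "acyclic_quiver Q \<Longrightarrow> is_quiver Q" by (simp add: acyclic_quiver_def)

lemma arrow_emb: assumes "ranked Q" "a \<in> arrs Q" shows "acyclic_emb (arrow_path Q a)"
proof -
  from assms have q: "is_quiver Q" and ne: "src Q a \<noteq> tgt Q a" by (auto simp: ranked_def)
  show ?thesis unfolding acyclic_emb_def embedding_def is_qmor_def
    using assms q acyclic_is_quiver[OF ranked_acyclic[OF ranked_PQ, of 1]] ne ranked_acyclic[OF ranked_PQ, of 1] ranked_acyclic[OF assms(1)]
    by (auto simp: arrow_path_def inj_on_def src_in tgt_in PQ_def)
qed

lemma vertex_emb: assumes "ranked Q" "a \<in> verts Q" shows "acyclic_emb (vertex_path Q a)"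
proof -
  show ?thesis unfolding acyclic_emb_def embedding_def is_qmor_def
    using assms acyclic_is_quiver[OF ranked_acyclic[OF ranked_PQ, of 0]] ranked_acyclic[OF ranked_PQ, of 0] ranked_acyclic[OF assms(1)]
    by (auto simp: vertex_path_def inj_on_def src_in tgt_in PQ_def acyclic_is_quiver)
qed

lemma sptp_emb: "k \<le> l \<Longrightarrow> acyclic_emb (sp k l)" "k \<le> l \<Longrightarrow> acyclic_emb (tp k l)" 
  unfolding acyclic_emb_def embedding_def is_qmor_def
    using acyclic_is_quiver[OF ranked_acyclic[OF ranked_PQ, of k]] ranked_acyclic[OF ranked_PQ, of k] 
       acyclic_is_quiver[OF ranked_acyclic[OF ranked_PQ, of l]] ranked_acyclic[OF ranked_PQ, of l]
    by (auto simp: sp_def tp_def inj_on_def PQ_def acyclic_is_quiver)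

lemma qmor_dom_cod[simp]: "qdom (arrow_path Q a) = PQ 1" "qcod (arrow_path Q a) = Q"
  "qdom (vertex_path Q a) = PQ 0" "qcod (vertex_path Q a) = Q"
  "qdom (sp k l) = PQ k" "qcod (sp k l) = PQ l" "qdom (tp k l) = PQ k" "qcod (tp k l) = PQ l"
  "qdom (st l) = D2" "qcod (st l) = PQ l"
  "qdom (bipath1 k l) = PQ k" "qdom (bipath2 k l) = PQ l" "qcod (bipath1 k l) = bipath k l"
    "qcod (bipath2 k l) = bipath k l"
   "qdom (cone_incl Q) = Q" "qcod (cone_incl Q) = cone Q" "qdom (cone_mor m) = cone (qdom m)" "qcod (cone_mor m) = cone (qcod m)"
   "qdom (subq_incl Q V A) = subq Q V A" "qcod (subq_incl Q V A) = Q"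
   "qdom (qcomp m' m) = qdom m" "qcod (qcomp m' m) = qcod m'"
   by (simp_all add: arrow_path_def vertex_path_def sp_def tp_def st_def bipath1_def bipath2_def cone_incl_def cone_mor_def subq_incl_def qcomp_def)

lemma Comp_ws: assumes "has_sort \<Gamma> x (PQ 1)" "has_sort \<Gamma> y (PQ 1)" "has_sort \<Gamma> z (PQ 1)"
  shows "well_sorted \<Gamma> (Comp_fm x y z)"
  using assms arrow_emb[OF ranked_concrete(4)] ranked_acyclic[OF ranked_concrete(4)]
  by (auto simp: Comp_fm_def has_sort_lift_case_nat Tri_def)

lemma EqPath_pos_ws: assumes "0 < k" "0 < l" "has_sort \<Gamma> x (PQ k)" "has_sort \<Gamma> y (PQ l)" 
  shows "well_sorted \<Gamma> (EqPath_pos k l x y)"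
  using assms pushout_config_bipath[OF assms(1,2)] 
  by (auto simp: EqPath_pos_def has_sort_lift_case_nat pushout_config_def Cospan_fm_def acyclic_emb_def)

lemma Id_ws: assumes "has_sort \<Gamma> x (PQ 0)" "has_sort \<Gamma> y (PQ 1)" 
  shows "well_sorted \<Gamma> (Id_fm x y)"
  using assms sptp_emb ranked_acyclic[OF ranked_PQ]
  by (auto simp: Id_fm_def has_sort_lift_case_nat intro!: Comp_ws EqPath_pos_ws)

lemma EqPath_ws: assumes "has_sort \<Gamma> x (PQ k)" "has_sort \<Gamma> y (PQ l)" 
  shows "well_sorted \<Gamma> (EqPath k l x y)"
  using assms sptp_emb ranked_acyclic[OF ranked_PQ]
  by (auto simp: EqPath_def EqPath_zero_pos_def has_sort_lift_case_nat intro!: Id_ws EqPath_pos_ws)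

lemma finite_paths: assumes "acyclic_quiver Q" shows "finite (paths Q)"
proof -
  let ?B = "\<Union>k\<in>{..card (verts Q)}. (\<lambda>(v,a). \<lparr>qdom = PQ k, qcod = Q, vmap = v, amap = a\<rparr>) ` (({0..k} \<rightarrow>\<^sub>E verts Q) \<times> ({0..<k} \<rightarrow>\<^sub>E arrs Q))"
  have "finite ?B" using acyclic_is_quiver[OF assms] by (auto simp: is_quiver_def intro!: finite_PiE)
  moreover have "paths Q \<subseteq> ?B"
  proof
    fix p assume p: "p \<in> paths Q"
    then obtain k where k: "qdom p = PQ k" "qcod p = Q" "is_qmor p" by (auto simp: paths_def)
    have "embedding p" using p assms by (auto simp: acyclic_quiver_def)
    then have "inj_on (vmap p) {0..k}" "vmap p ` {0..k} \<subseteq> verts Q" using k by (auto simp: embedding_def is_qmor_def)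
    then have "card {0..k} \<le> card (verts Q)" using acyclic_is_quiver[OF assms] card_inj_on_le unfolding is_quiver_def by blast
    moreover have "p = \<lparr>qdom = PQ k, qcod = Q, vmap = vmap p, amap = amap p\<rparr>" using k by simp
    moreover have "vmap p \<in> {0..k} \<rightarrow>\<^sub>E verts Q" "amap p \<in> {0..<k} \<rightarrow>\<^sub>E arrs Q" using k(3) unfolding is_qmor_def k by simp_all
    ultimately show "p \<in> ?B" by (auto intro!: bexI[of _ k] image_eqI[of _ _ "(vmap p, amap p)"])
  qed
  ultimately show ?thesis using finite_subset by blast
qed

lemma finite_BP: assumes "acyclic_quiver Q" shows "finite (BP Q)"
  by (rule finite_subset[of _ "paths Q \<times> paths Q"]) (use finite_paths[OF assms] in \<open>auto simp: BP_def\<close>)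

lemma plen_PQ: "p \<in> paths Q \<Longrightarrow> PQ (plen p) = qdom p" by (auto simp: paths_def plen_def)

lemma plen_sort: assumes "acyclic_quiver Q" "p \<in> paths Q" shows "has_sort (case_nat (Some Q) \<Gamma>) (RestrTm p (Var 0)) (PQ (plen p))"
proof -
 have "embedding p" using assms by (auto simp: acyclic_quiver_def)
 moreover obtain k where "qdom p = PQ k" "qcod p = Q" using assms by (auto simp: paths_def)
 ultimately have "acyclic_emb p" "qcod p = Q" using assms ranked_acyclic[OF ranked_PQ] by (auto simp: acyclic_emb_def)
 then show ?thesis using plen_PQ[OF assms(2)] by simp
qed

lemma T_cat_sentences: assumes "\<phi> \<in> T_cat" shows "sentence \<phi>"
proof -
  have aPQ: "acyclic_quiver (PQ k)" for k using ranked_acyclic[OF ranked_PQ] .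
  have "sentence EmptyEU"
    by (simp add: sentence_def EmptyEU_def ranked_acyclic ranked_concrete)
  moreover have "sentence (RestrComp m m')"
    if "acyclic_emb m" "acyclic_emb m'" "qcod m = qdom m'" for m m'
    using that acyclic_emb_qcomp[OF that] by (auto simp: sentence_def RestrComp_def) (simp add: acyclic_emb_def)
  moreover have "sentence (PushoutEU m1 m2 m1' m2')" if "pushout_config m1 m2 m1' m2'" for m1 m2 m1' m2'
    using that
    by (auto simp: sentence_def PushoutEU_def pushout_config_def Cospan_fm_def numeral_2_eq_2)
      (auto simp: acyclic_emb_def)
  moreover have "sentence IdE" "sentence CompE" "sentence (EqPathRefl k)" "sentence (EqPathSym k l)" "sentence (EqPathTrans k l n)" for k l n
    by (auto simp: sentence_def IdE_def CompE_def EqPathRefl_def EqPathSym_def EqPathTrans_def aPQ sptp_emb numeral_2_eq_2 intro!: Id_ws Comp_ws EqPath_ws)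
  moreover have "sentence (EqPathConcat k1 k2 k1' k2')" for k1 k2 k1' k2'
    by (auto simp: sentence_def EqPathConcat_def Cospan_fm_def aPQ sptp_emb eval_nat_numeral intro!: Id_ws Comp_ws EqPath_ws)
  moreover have "sentence ComEq"
    using arrow_emb[OF ranked_concrete(3)] by (auto simp: sentence_def ComEq_def ranked_acyclic ranked_concrete C2_def[THEN arg_cong[of _ _ arrs]])
  moreover have "sentence (PathCom Q)" if "acyclic_quiver Q" for Q
    using that plen_sort[OF that] finite_BP[OF that] by (auto simp: sentence_def PathCom_def well_sorted_conj_over BP_def intro!: EqPath_ws)
  ultimately show ?thesis
    using assms unfolding T_cat_def by (elim UnE CollectE exE conjE insertE emptyE) simp_all
qed

lemma dual_acyclic: assumes a: "acyclic_quiver Q" shows "acyclic_quiver (dual_quiver Q)"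
proof -
  have q: "is_quiver (dual_quiver Q)" using acyclic_is_quiver[OF a] by (auto simp: is_quiver_def dual_quiver_def)
  have "embedding p" if p: "p \<in> paths (dual_quiver Q)" for p
  proof -
    obtain k where k: "qdom p = PQ k" "qcod p = dual_quiver Q" and m: "is_qmor p" using p by (auto simp: paths_def)
    have vm: "\<And>i. i \<le> k \<Longrightarrow> vmap p i \<in> verts Q" "\<And>i. i < k \<Longrightarrow> amap p i \<in> arrs Q"
      "\<And>i. i < k \<Longrightarrow> tgt Q (amap p i) = vmap p i"  "\<And>i. i < k \<Longrightarrow> src Q (amap p i) = vmap p (Suc i)"
      using m unfolding is_qmor_def k by (auto simp: dual_quiver_def)
    define q where "q = \<lparr>qdom = PQ k, qcod = Q, vmap = (\<lambda>i\<in>{0..k}. vmap p (k - i)), amap = (\<lambda>i\<in>{0..<k}. amap p (k - Suc i))\<rparr>"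
    have "q \<in> paths Q" unfolding paths_def is_qmor_def using acyclic_is_quiver[OF a] acyclic_is_quiver[OF ranked_acyclic[OF ranked_PQ]]
      by (auto simp: q_def vm Suc_diff_Suc)
    then have "embedding q" using a by (auto simp: acyclic_quiver_def)
    then have "inj_on (vmap q) {0..k}" "inj_on (amap q) {0..<k}" by (auto simp: embedding_def q_def)
    then have i: "inj_on (\<lambda>i. vmap p (k - i)) {0..k}" "inj_on (\<lambda>i. amap p (k - Suc i)) {0..<k}"
       unfolding q_def by simp_all
    have "inj_on (vmap p) {0..k}" 
      apply (rule inj_onI)
      subgoal for x y using inj_onD[OF i(1), of "k - x" "k - y"] by auto
      done
    moreover have "inj_on (amap p) {0..<k}" 
      apply (rule inj_onI)
      subgoal for x y using inj_onD[OF i(2), of "k - Suc x" "k - Suc y"] by auto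
      done
    ultimately show ?thesis using m by (simp add: embedding_def k)
  qed
  then show ?thesis using q by (auto simp: acyclic_quiver_def)
qed

lemma is_quiver_dual: "is_quiver Q \<Longrightarrow> is_quiver (dual_quiver Q)" by (auto simp: is_quiver_def dual_quiver_def)

lemma dual_emb: "acyclic_emb m \<Longrightarrow> acyclic_emb (dual_qmor m)"
  unfolding acyclic_emb_def embedding_def is_qmor_def
  using dual_acyclic by (auto simp: dual_qmor_def is_quiver_dual) (auto simp: dual_quiver_def)

lemma ws_dual_tm: "has_sort \<Gamma> t Q \<Longrightarrow> has_sort (map_option dual_quiver \<circ> \<Gamma>) (dual_tm t) (dual_quiver Q)"
  using dual_emb by (induction t arbitrary: Q) (auto simp: dual_qmor_def)

lemma dual_case_nat: "map_option dual_quiver \<circ> case_nat (Some Q) \<Gamma> = case_nat (Some (dual_quiver Q)) (map_option dual_quiver \<circ> \<Gamma>)"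
  by (auto simp: fun_eq_iff split: nat.split)

lemma ws_dual_fm: "well_sorted \<Gamma> \<phi> \<Longrightarrow> well_sorted (map_option dual_quiver \<circ> \<Gamma>) (dual_fm \<phi>)"
proof (induction \<phi> arbitrary: \<Gamma>)
  case (Equal s t)
  then show ?case unfolding dual_fm.simps well_sorted.simps by (meson ws_dual_tm)
next
  case (Commute Q t)
  then show ?case unfolding dual_fm.simps well_sorted.simps by (meson ws_dual_tm dual_acyclic)
next
  case (Forall Q \<phi>)
  then show ?case using dual_acyclic Forall.IH[of "case_nat (Some Q) \<Gamma>", unfolded dual_case_nat] by (simp add: comp_def)
next
  case (Exists Q \<phi>)
  then show ?case using dual_acyclic Exists.IH[of "case_nat (Some Q) \<Gamma>", unfolded dual_case_nat] by (simp add: comp_def)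
next
  case (Exists1 Q \<phi>)
  then show ?case using dual_acyclic Exists1.IH[of "case_nat (Some Q) \<Gamma>", unfolded dual_case_nat] by (simp add: comp_def)
qed simp_all

lemma sentence_dual: "sentence \<phi> \<Longrightarrow> sentence (dual_fm \<phi>)"
  using ws_dual_fm[of "\<lambda>_. None" \<phi>] by (auto simp: sentence_def comp_def)

lemma cone_incl_emb: assumes "ranked Q" shows "acyclic_emb (cone_incl Q)"
proof -
  have q: "is_quiver Q" using assms by (simp add: ranked_def)
  show ?thesis unfolding acyclic_emb_def embedding_def is_qmor_def
  using assms q cone_quiver[OF q] ranked_acyclic ranked_cone by (auto simp: cone_incl_def cone_simps[OF q] inj_on_def src_in tgt_in)
qed

lemma cone_mor_emb: assumes m: "embedding m" and r: "ranked (qdom m)" "ranked (qcod m)" shows "acyclic_emb (cone_mor m)"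
proof -
  have q: "is_quiver (qdom m)" "is_quiver (qcod m)" using r by (auto simp: ranked_def)
  note c = cone_simps[OF q(1)] cone_simps[OF q(2)]
  have M: "\<And>v. v \<in> verts (qdom m) \<Longrightarrow> vmap m v \<in> verts (qcod m)" "\<And>v. v \<in> arrs (qdom m) \<Longrightarrow> amap m v \<in> arrs (qcod m)"
    "\<And>a. a \<in> arrs (qdom m) \<Longrightarrow> src (qcod m) (amap m a) = vmap m (src (qdom m) a)"
    "\<And>a. a \<in> arrs (qdom m) \<Longrightarrow> tgt (qcod m) (amap m a) = vmap m (tgt (qdom m) a)"
    "inj_on (vmap m) (verts (qdom m))" "inj_on (amap m) (arrs (qdom m))"
    using m by (auto simp: embedding_def is_qmor_def)
  have V: "vmap (cone_mor m) v = vmap m v" if "v \<in> verts (qdom m)" for v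
    using that by (auto simp: cone_mor_def c)
  have V2: "vmap (cone_mor m) (apex (qdom m)) = apex (qcod m)" by (auto simp: cone_mor_def c)
  have A: "a \<in> arrs (qdom m) \<Longrightarrow> amap (cone_mor m) a = amap m a" 
     "v \<in> verts (qdom m) \<Longrightarrow> amap (cone_mor m) (leg (qdom m) v) = leg (qcod m) (vmap m v)" for a v
    by (auto simp: cone_mor_def c)
  have lf: "leg Q v = leg Q w \<longleftrightarrow> v = w" for Q v w by (simp add: leg_def)
  have ne: "vmap m v \<noteq> apex (qcod m)" if "v \<in> verts (qdom m)" for v
    using M(1)[OF that] c by metis
  have ne2: "amap m a \<noteq> leg (qcod m) w" if "a \<in> arrs (qdom m)" for a w
    using M(2)[OF that] c by metis
  have "inj_on (vmap (cone_mor m)) (verts (cone (qdom m)))"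
    unfolding cone_simps(7)[OF q(1)]
  proof (rule inj_onI)
    fix x y
    assume "x \<in> insert (apex (qdom m)) (verts (qdom m))" "y \<in> insert (apex (qdom m)) (verts (qdom m))"
      and "vmap (cone_mor m) x = vmap (cone_mor m) y"
    then show "x = y" using V V2 ne inj_onD[OF M(5)] by (metis insert_iff)
  qed
  moreover have "inj_on (amap (cone_mor m)) (arrs (cone (qdom m)))"
    unfolding cone_simps(8)[OF q(1)]
  proof (rule inj_onI)
    fix x y
    assume "x \<in> arrs (qdom m) \<union> leg (qdom m) ` verts (qdom m)"
      and "y \<in> arrs (qdom m) \<union> leg (qdom m) ` verts (qdom m)"
      and "amap (cone_mor m) x = amap (cone_mor m) y"
    then show "x = y"
      by (elim UnE imageE) (simp_all add: A ne2 ne2[symmetric] lf inj_on_eq_iff[OF M(5)] inj_on_eq_iff[OF M(6)])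
  qed
  moreover have "is_qmor (cone_mor m)"
  proof -
    have "vmap (cone_mor m) \<in> verts (cone (qdom m)) \<rightarrow>\<^sub>E verts (cone (qcod m))"
    proof (rule PiE_I)
      fix v assume "v \<in> verts (cone (qdom m))"
      then show "vmap (cone_mor m) v \<in> verts (cone (qcod m))"
        unfolding cone_simps(7)[OF q(1)] cone_simps(7)[OF q(2)] using M(1) V V2 by fastforce
    qed (simp add: cone_mor_def)
    moreover have "amap (cone_mor m) \<in> arrs (cone (qdom m)) \<rightarrow>\<^sub>E arrs (cone (qcod m))"
    proof (rule PiE_I)
      fix a assume "a \<in> arrs (cone (qdom m))"
      then show "amap (cone_mor m) a \<in> arrs (cone (qcod m))"
        unfolding cone_simps(8)[OF q(1)] cone_simps(8)[OF q(2)] using M(1,2) A by fastforce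
    qed (simp add: cone_mor_def)
    moreover have "src (cone (qcod m)) (amap (cone_mor m) a) = vmap (cone_mor m) (src (cone (qdom m)) a) \<and>
        tgt (cone (qcod m)) (amap (cone_mor m) a) = vmap (cone_mor m) (tgt (cone (qdom m)) a)"
      if "a \<in> arrs (cone (qdom m))" for a
      using that unfolding cone_simps(8)[OF q(1)]
    proof (elim UnE imageE)
      assume "a \<in> arrs (qdom m)"
      then show ?thesis
        by (simp add: A(1) M(2,3,4) V src_in[OF q(1)] tgt_in[OF q(1)]
            cone_simps(3,4)[OF q(1)] cone_simps(3,4)[OF q(2)])
    next
      fix v assume "a = leg (qdom m) v" "v \<in> verts (qdom m)"
      then show ?thesis
        by (simp add: A(2) M(1) V V2 cone_simps(5,6)[OF q(1)] cone_simps(5,6)[OF q(2)])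
    qed
    ultimately show ?thesis
      unfolding is_qmor_def qmor_dom_cod using cone_quiver[OF q(1)] cone_quiver[OF q(2)] by blast
  qed
  ultimately show ?thesis using r ranked_acyclic ranked_cone by (auto simp: acyclic_emb_def embedding_def)
qed

lemma Cone_ws: assumes "ranked Q" "has_sort \<Gamma> x Q" "has_sort \<Gamma> y (cone Q)" 
  shows "well_sorted \<Gamma> (Cone_fm Q x y)"
proof -
  have f: "finite (arrs Q)" using assms by (auto simp: ranked_def is_quiver_def)
  have "acyclic_emb (cone_mor (arrow_path Q a))" if "a \<in> arrs Q" for a
    using that assms arrow_emb[OF assms(1) that] ranked_PQ by (intro cone_mor_emb) (auto simp: acyclic_emb_def)
  then show ?thesis using assms f cone_incl_emb[OF assms(1)] ranked_acyclic[OF ranked_cone[OF ranked_PQ, of 1]]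
    by (auto simp: Cone_fm_def well_sorted_conj_over)
qed

lemma Limit_ws: assumes "ranked Q" "has_sort \<Gamma> x Q" "has_sort \<Gamma> y (cone Q)" 
  shows "well_sorted \<Gamma> (Limit_fm Q x y)"
proof -
  have "acyclic_emb (cone_mor (cone_incl Q))"
   using cone_incl_emb[OF assms(1)] ranked_cone[OF assms(1)] assms by (intro cone_mor_emb) (auto simp: acyclic_emb_def)
  then show ?thesis
  using assms ranked_acyclic ranked_cone by (auto simp: Limit_fm_def has_sort_lift_case_nat intro!: Cone_ws)
qed

lemma Colimit_ws: assumes "ranked Q" "has_sort \<Gamma> x Q" "has_sort \<Gamma> y (dual_quiver (cone (dual_quiver Q)))" 
  shows "well_sorted \<Gamma> (Colimit_fm Q x y)"
proof -
  have "well_sorted (map_option dual_quiver \<circ> \<Gamma>) (Limit_fm (dual_quiver Q) (dual_tm x) (dual_tm y))"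
    using Limit_ws[OF ranked_dual[OF assms(1)]] ws_dual_tm[OF assms(2)] ws_dual_tm[OF assms(3)] by (simp add: dual_dual)
  from ws_dual_fm[OF this] show ?thesis
    by (simp add: Colimit_fm_def comp_def option.map_comp dual_dual option.map_ident)
qed

lemma dual_empty: "dual_quiver empty_quiver = empty_quiver" by (simp add: dual_quiver_def empty_quiver_def)

lemma dual_PQ0: "dual_quiver (PQ 0) = PQ 0" by (simp add: dual_quiver_def PQ_def restrict_def)

lemma Zero_ws: assumes "has_sort \<Gamma> x (PQ 0)" shows "well_sorted \<Gamma> (Zero_fm x)"
  using assms by (auto simp: Zero_fm_def has_sort_lift_case_nat dual_empty cone_empty dual_PQ0 ranked_concrete ranked_acyclic intro!: Limit_ws Colimit_ws)

lemma Ker_ws: assumes "has_sort \<Gamma> x (PQ 1)" "has_sort \<Gamma> y (PQ 1)" shows "well_sorted \<Gamma> (Ker_fm x y)"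
proof -
  have q: "is_quiver CospanQ" using ranked_CospanQ by (simp add: ranked_def)
  note r = ranked_cone[OF ranked_CospanQ]
  have "acyclic_emb (arrow_path (cone CospanQ) 0)" "acyclic_emb (arrow_path (cone CospanQ) (leg CospanQ 0))"
    by (rule arrow_emb[OF r], simp add: cone_simps[OF q], simp add: CospanQ_def)+
  moreover have "acyclic_emb (vertex_path (cone CospanQ) 2)"
    by (rule vertex_emb[OF r], simp add: cone_simps[OF q], simp add: CospanQ_def)
  ultimately show ?thesis using assms ranked_acyclic[OF r] cone_incl_emb[OF ranked_CospanQ]
    by (auto simp: Ker_fm_def has_sort_lift_case_nat intro!: Zero_ws Limit_ws ranked_CospanQ)
qed

lemma subq_emb: assumes "ranked Q" "V \<subseteq> verts Q" "A \<subseteq> arrs Q" "src Q ` A \<subseteq> V" "tgt Q ` A \<subseteq> V" 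
  shows "acyclic_emb (subq_incl Q V A)"
proof -
  have q: "is_quiver Q" using assms(1) by (simp add: ranked_def)
  obtain r :: "nat \<Rightarrow> nat" where r: "\<forall>a\<in>arrs Q. r (src Q a) < r (tgt Q a)"
    using assms(1) by (auto simp: ranked_def)
  have "is_quiver (subq Q V A)"
    using assms q finite_subset unfolding is_quiver_def by (auto simp: subq_def)
  moreover have "\<forall>a\<in>arrs (subq Q V A). r (src (subq Q V A) a) < r (tgt (subq Q V A) a)"
    using r assms by (auto simp: subq_def)
  ultimately have "ranked (subq Q V A)" unfolding ranked_def by blast
  then show ?thesis unfolding acyclic_emb_def embedding_def is_qmor_def
    using assms q ranked_acyclic acyclic_is_quiver by (auto simp: subq_incl_def inj_on_def) (auto simp: subq_def)
qed

lemma Mono_ws: assumes "has_sort \<Gamma> x (PQ 1)" shows "well_sorted \<Gamma> (Mono_fm x)"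
proof -
  have "acyclic_emb (arrow_path MonoQ 2)"  by (rule arrow_emb[OF ranked_concrete(5)], simp add: MonoQ_def)
  moreover have "acyclic_emb (subq_incl MonoQ {0, 1, 2} {0, 2, 3})" "acyclic_emb (subq_incl MonoQ {0, 1, 2} {1, 2, 3})"
     "acyclic_emb (subq_incl MonoQ {0, 1} {0, 1})"
    by (rule subq_emb[OF ranked_concrete(5)]; simp add: MonoQ_def)+
  moreover have "acyclic_quiver (subq MonoQ {0, 1, 2} {0, 2, 3})" "acyclic_quiver (subq MonoQ {0, 1, 2} {1, 2, 3})"
     "acyclic_quiver (subq MonoQ {0, 1} {0, 1})" using calculation by (simp_all add: acyclic_emb_def)
  ultimately show ?thesis using assms ranked_acyclic[OF ranked_concrete(5)] by (auto simp: Mono_fm_def has_sort_lift_case_nat)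
qed

lemma T_ab_sentences: assumes "\<phi> \<in> T_ab" shows "sentence \<phi>"
proof -
  have "sentence ZeroE" "sentence KerE" "sentence ProductE" "sentence MonoNormal"
    by (auto simp: sentence_def ZeroE_def KerE_def ProductE_def MonoNormal_def ranked_acyclic ranked_PQ ranked_cone ranked_concrete
      intro!: Zero_ws Ker_ws Mono_ws Limit_ws)
  then show ?thesis using assms T_cat_sentences sentence_dual unfolding T_ab_def by auto
qed

lemma pstart_pconcat: "p \<in> paths Q \<Longrightarrow> pstart (pconcat p q) = pstart p" by (simp add: pstart_def pconcat_def)

lemma path_data: "m \<in> paths Q \<Longrightarrow> vmap m \<in> {0..plen m} \<rightarrow>\<^sub>E verts Q \<and> amap m \<in> {0..<plen m} \<rightarrow>\<^sub>E arrs Q \<and> qdom m = PQ (plen m) \<and> qcod m = Q \<and>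
  (\<forall>i<plen m. src Q (amap m i) = vmap m i \<and> tgt Q (amap m i) = vmap m (Suc i))"
  by (auto simp: paths_def is_qmor_def plen_def)

lemma pathI: "is_quiver Q \<Longrightarrow> v \<in> {0..k} \<rightarrow>\<^sub>E verts Q \<Longrightarrow> a \<in> {0..<k} \<rightarrow>\<^sub>E arrs Q \<Longrightarrow> 
  (\<And>i. i<k \<Longrightarrow> src Q (a i) = v i \<and> tgt Q (a i) = v (Suc i)) \<Longrightarrow> \<lparr>qdom=PQ k,qcod=Q,vmap=v,amap=a\<rparr> \<in> paths Q"
  using acyclic_is_quiver[OF ranked_acyclic[OF ranked_PQ]]
  by (auto simp: paths_def is_qmor_def)

lemma plen_simps: "plen (pconcat p q) = plen p + plen q" "plen (vertex_path Q v) = 0" "plen (arrow_path Q a) = 1" "plen (qcomp m p) = plen p"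
  by (simp_all add: plen_def pconcat_def vertex_path_def arrow_path_def qcomp_def)

lemma is_category_Free: assumes "is_quiver Q" shows "is_category (Free Q)"
proof -
  have 1: "pconcat p q \<in> paths Q" "pend (pconcat p q) = pend q" if "p \<in> paths Q" "q \<in> paths Q" "pend p = pstart q" for p q
  proof -
    show "pconcat p q \<in> paths Q"
    unfolding pconcat_def using path_data[OF that(1)] path_data[OF that(2)] that(3) assms
      by (auto intro!: pathI simp: pend_def pstart_def PiE_iff less_diff_conv2 Suc_diff_le)
    show "pend (pconcat p q) = pend q" using that(3)
      by (auto simp: pend_def plen_simps pstart_def) (auto simp: pconcat_def)
  qed
  have 2: "vertex_path Q v \<in> paths Q" if "v \<in> verts Q" for v
    unfolding vertex_path_def using assms that by (intro pathI) auto
  have 3: "pstart p \<in> verts Q" "pend p \<in> verts Q" if "p \<in> paths Q" for p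
    using path_data[OF that] by (auto simp: pstart_def pend_def PiE_iff)
  have 4: "pstart (vertex_path Q v) = v" "pend (vertex_path Q v) = v" for v
    by (simp_all add: pstart_def pend_def plen_simps) (simp_all add: vertex_path_def)
  have 5: "pconcat (vertex_path Q (pstart p)) p = p" "pconcat p (vertex_path Q (pend p)) = p"
    if "p \<in> paths Q" for p
  proof -
    note pd = path_data[OF that]
    show "pconcat (vertex_path Q (pstart p)) p = p"
    proof (rule qmor.equality)
      show "vmap (pconcat (vertex_path Q (pstart p)) p) = vmap p"
        using pd by (auto simp: pconcat_def plen_simps fun_eq_iff PiE_iff extensional_def pstart_def vertex_path_def plen_def)
      show "amap (pconcat (vertex_path Q (pstart p)) p) = amap p"
        using pd by (auto simp: pconcat_def plen_simps fun_eq_iff PiE_iff extensional_def)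
    qed (use pd in \<open>simp_all add: pconcat_def plen_def vertex_path_def\<close>)
    show "pconcat p (vertex_path Q (pend p)) = p"
    proof (rule qmor.equality)
      show "vmap (pconcat p (vertex_path Q (pend p))) = vmap p"
        using pd by (auto simp: pconcat_def plen_simps fun_eq_iff PiE_iff extensional_def)
      show "amap (pconcat p (vertex_path Q (pend p))) = amap p"
        using pd by (auto simp: pconcat_def plen_simps fun_eq_iff PiE_iff extensional_def)
    qed (use pd in \<open>simp_all add: pconcat_def plen_simps\<close>)
  qed
  have 6: "pconcat (pconcat p q) r = pconcat p (pconcat q r)" if "pend p = pstart q" "pend q = pstart r" for p q r
  proof (rule qmor.equality)
    show "vmap (pconcat (pconcat p q) r) = vmap (pconcat p (pconcat q r))"
      by (auto simp: pconcat_def plen_def fun_eq_iff add.assoc)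
    show "amap (pconcat (pconcat p q) r) = amap (pconcat p (pconcat q r))"
      by (auto simp: pconcat_def plen_def fun_eq_iff add.assoc)
  qed (simp_all add: pconcat_def plen_def add.assoc)
  show ?thesis
    unfolding is_category_def Hom_def Free_def by (simp add: 1 2 3 4 5 6 pstart_pconcat)
qed

lemma qcomp_paths: "is_qmor m \<Longrightarrow> p \<in> paths (qdom m) \<Longrightarrow> qcomp m p \<in> paths (qcod m)"
  unfolding qcomp_def using path_data[of p "qdom m"]
  by (auto intro!: pathI simp: compose_def PiE_iff is_qmor_def)

lemma pull_diagrams: assumes "is_qmor m" "is_category C" "D \<in> diagrams C (qcod m)" shows "pull m D \<in> diagrams C (qdom m)"
proof -
  have F: "is_functor (Free (qcod m)) C D" using assms by (simp add: diagrams_def)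
  have Q: "is_quiver (qdom m)" "is_quiver (qcod m)" using assms by (auto simp: is_qmor_def)
  have V: "\<And>v. v \<in> verts (qdom m) \<Longrightarrow> vmap m v \<in> verts (qcod m)" using assms by (auto simp: is_qmor_def)
  have e: "pstart (qcomp m p) = vmap m (pstart p)" "pend (qcomp m p) = vmap m (pend p)" "pstart p \<in> verts (qdom m)" "pend p \<in> verts (qdom m)" if "p \<in> paths (qdom m)" for p
   using path_data[OF that] by (auto simp: pstart_def pend_def plen_simps) (auto simp: qcomp_def compose_def)
  have v: "qcomp m (vertex_path (qdom m) v) = vertex_path (qcod m) (vmap m v)" for v
    by (auto simp: qcomp_def vertex_path_def compose_def fun_eq_iff)
  have c: "qcomp m (pconcat p q) = pconcat (qcomp m p) (qcomp m q)" if "p \<in> paths (qdom m)" "q \<in> paths (qdom m)" for p q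
  proof -
    have sel: "vmap (qcomp m r) = compose (verts (qdom r)) (vmap m) (vmap r)"
      "amap (qcomp m r) = compose (arrs (qdom r)) (amap m) (amap r)" for r
      by (simp_all add: qcomp_def)
    have dom: "qdom p = PQ (plen p)" "qdom q = PQ (plen q)"
      using path_data[OF that(1)] path_data[OF that(2)] by simp_all
    have dom': "qdom (pconcat p q) = PQ (plen p + plen q)" by (simp add: pconcat_def)
    show ?thesis
    proof (rule qmor.equality)
      show "vmap (qcomp m (pconcat p q)) = vmap (pconcat (qcomp m p) (qcomp m q))"
        unfolding sel dom' unfolding pconcat_def plen_simps qmor.select_convs sel dom
        by (auto simp: compose_def fun_eq_iff)
      show "amap (qcomp m (pconcat p q)) = amap (pconcat (qcomp m p) (qcomp m q))"
        unfolding sel dom' unfolding pconcat_def plen_simps qmor.select_convs sel dom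
        by (auto simp: compose_def fun_eq_iff)
      show "qdom (qcomp m (pconcat p q)) = qdom (pconcat (qcomp m p) (qcomp m q))"
        unfolding qmor_dom_cod dom' by (simp add: pconcat_def plen_simps)
      show "qcod (qcomp m (pconcat p q)) = qcod (pconcat (qcomp m p) (qcomp m q))"
        by (simp add: pconcat_def)
    qed simp
  qed
  note FC = is_category_Free[OF Q(1), unfolded is_category_def Hom_def]
  show ?thesis using FC F unfolding diagrams_def is_functor_def
    by (auto simp: pull_def func_comp_def Free_def Free_map_def V qcomp_paths[OF assms(1)] e v c compose_def PiE_iff)
qed

lemma cat_interp_structure: "is_category C \<Longrightarrow> is_structure (cat_interp C)"
  by (auto simp: is_structure_def cat_interp_def acyclic_emb_def embedding_def pull_diagrams)

end

theory Submission
  imports Defs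
begin

text \<open>By the universal property of \<open>Free Q\<close>, a diagram over \<open>Q\<close> amounts to a family of objects and
  arrows indexed by \<open>Q\<close>, and it commutes iff parallel walks have equal composites. In this form the
  interpretation of the opposite category is literally the dual of the interpretation of the category,
  so every dual axiom comes for free, and a cone over a limit cone is the same as an arrow into the
  apex, so that \<open>Limit\<close> acquires its usual meaning.

  Conversely, let \<open>M\<close> be a model. Since adding a vertex or an arrow to a quiver is a pushout, an
  element of sort \<open>Q\<close> is the same as a compatible family of elements of the sorts \<open>PQ 0\<close> and \<open>PQ 1\<close>.
  These two sorts are the objects and the arrows of a category: \<open>EqPath\<close> relates every path to exactly
  one arrow, its composite, and compatibility with concatenation gives associativity. Hence \<open>M\<close> is
  isomorphic to the interpretation of that category, which is abelian because it satisfies the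
  remaining axioms.\<close>

section \<open>Walks\<close>

text \<open>A diagram stores a value for every path, and the paths of the dual quiver are other maps
  than those of the quiver; so for \<open>cat_interp\<close> duality would hold only up to
  isomorphism. A family stores values on vertices and arrows alone, which makes
  \<open>dual_struct_fam_interp\<close> an equality. The price is that satisfaction has to be
  carried along isomorphisms; this rests on well-sorted formulas, since an isomorphism is a
  bijection sort by sort. Each further axiom is shown equivalent to a property of the category, so
  that \<open>fam_interp_T_ab\<close> serves both halves of the theorem. In a model, acyclicity
  supplies two facts. An arrow has two distinct ends, so it can be attached along \<open>D2\<close>.
  A path with equal ends is trivial, so two parallel paths are both trivial, hence equal, or both of
  positive length; therefore \<open>EqPath\<close> with a path of length zero, whose definition
  passes through \<open>Id\<close>, never has to be evaluated there.\<close>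

primrec qwalk :: "quiver \<Rightarrow> nat \<Rightarrow> nat list \<Rightarrow> nat \<Rightarrow> bool" where
  "qwalk Q v [] w \<longleftrightarrow> v = w \<and> v \<in> verts Q"
| "qwalk Q v (a # as) w \<longleftrightarrow> a \<in> arrs Q \<and> src Q a = v \<and> qwalk Q (tgt Q a) as w"

definition arrow_list :: "qmor \<Rightarrow> nat list" where
  "arrow_list p = map (amap p) [0..<plen p]"

text \<open>Inverse of \<open>arrow_list\<close>. The empty list does not know where it starts, so
  the start vertex is an argument.\<close>

primrec path_of :: "quiver \<Rightarrow> nat \<Rightarrow> nat list \<Rightarrow> qmor" where
  "path_of Q v [] = vertex_path Q v"
| "path_of Q v (a # as) = pconcat (arrow_path Q a) (path_of Q (tgt Q a) as)"

lemma qwalk_append: "qwalk Q v (as @ bs) w \<longleftrightarrow> (\<exists>u. qwalk Q v as u \<and> qwalk Q u bs w)"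
  if "is_quiver Q"
  using that
proof (induction as arbitrary: v)
  case Nil
  have "v \<in> verts Q" if "qwalk Q v bs w" using that \<open>is_quiver Q\<close> by (cases bs) (auto dest: src_in)
  then show ?case by auto
qed auto

lemma qwalk_verts: "is_quiver Q \<Longrightarrow> qwalk Q v as w \<Longrightarrow> v \<in> verts Q \<and> w \<in> verts Q"
  by (induction as arbitrary: v) (auto dest: src_in)

lemma qwalk_arrs: "qwalk Q v as w \<Longrightarrow> set as \<subseteq> arrs Q"
  by (induction as arbitrary: v) auto

lemma qmorD:
  assumes "is_qmor m"
  shows "is_quiver (qdom m)" "is_quiver (qcod m)"
    "v \<in> verts (qdom m) \<Longrightarrow> vmap m v \<in> verts (qcod m)"
    "a \<in> arrs (qdom m) \<Longrightarrow> amap m a \<in> arrs (qcod m)"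
    "a \<in> arrs (qdom m) \<Longrightarrow> src (qcod m) (amap m a) = vmap m (src (qdom m) a)"
    "a \<in> arrs (qdom m) \<Longrightarrow> tgt (qcod m) (amap m a) = vmap m (tgt (qdom m) a)"
  using assms by (auto simp: is_qmor_def)

lemma acyclic_embD:
  assumes "acyclic_emb m"
  shows "is_qmor m" "acyclic_quiver (qdom m)" "acyclic_quiver (qcod m)"
    "inj_on (vmap m) (verts (qdom m))" "inj_on (amap m) (arrs (qdom m))"
  using assms by (auto simp: acyclic_emb_def embedding_def)

lemma qwalk_image:
  "is_qmor m \<Longrightarrow> qwalk (qdom m) v as w \<Longrightarrow> qwalk (qcod m) (vmap m v) (map (amap m) as) (vmap m w)"
  by (induction as arbitrary: v) (auto simp: qmorD)

lemma qwalk_PQ: "i \<le> j \<Longrightarrow> j \<le> k \<Longrightarrow> qwalk (PQ k) i [i..<j] j"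
  by (induction "j - i" arbitrary: i) (auto simp: upt_conv_Cons)

text \<open>A path is the image, under itself, of the full walk through
  \<open>PQ (plen p)\<close>.\<close>

lemma path_qwalk:
  assumes "p \<in> paths Q"
  shows "qwalk Q (pstart p) (arrow_list p) (pend p)"
proof -
  have "is_qmor p" "qdom p = PQ (plen p)" "qcod p = Q" using assms path_data[OF assms] by (auto simp: paths_def)
  then show ?thesis
    using qwalk_image[of p 0 "[0..<plen p]" "plen p"] qwalk_PQ[of 0 "plen p" "plen p"]
    by (simp add: pstart_def pend_def arrow_list_def)
qed

text \<open>The arrows determine every vertex but the first: vertex \<open>Suc j\<close> is the
  target of arrow \<open>j\<close>. The start vertex is what distinguishes trivial paths.\<close>

lemma path_eqI:
  assumes "p \<in> paths Q" "q \<in> paths Q" "pstart p = pstart q" "arrow_list p = arrow_list q"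
  shows "p = q"
proof -
  note P = path_data[OF assms(1)] and Q = path_data[OF assms(2)]
  have len: "plen p = plen q" using arg_cong[OF assms(4), of length] by (simp add: arrow_list_def)
  have am: "amap p i = amap q i" if "i < plen p" for i
    using arg_cong[OF assms(4), of "\<lambda>as. as ! i"] that len by (simp add: arrow_list_def)
  have vm: "vmap p i = vmap q i" if "i \<le> plen p" for i
  proof (cases i)
    case 0
    then show ?thesis using assms(3) by (simp add: pstart_def)
  next
    case (Suc j)
    then show ?thesis using P Q am[of j] len that by (metis Suc_le_eq)
  qed
  show ?thesis
  proof (rule qmor.equality)
    show "vmap p = vmap q"
      by (rule PiE_ext[of _ "{0..plen p}" "\<lambda>_. verts Q"]) (use P Q len vm in auto)
    show "amap p = amap q"
      by (rule PiE_ext[of _ "{0..<plen p}" "\<lambda>_. arrs Q"]) (use P Q len am in auto)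
  qed (use P Q len in auto)
qed

lemma arrow_list_simps:
  "arrow_list (vertex_path Q v) = []"
  "arrow_list (arrow_path Q a) = [a]"
  "arrow_list (pconcat p q) = arrow_list p @ arrow_list q"
proof -
  show "arrow_list (pconcat p q) = arrow_list p @ arrow_list q"
    by (rule nth_equalityI) (auto simp: arrow_list_def plen_simps nth_append, auto simp: pconcat_def)
qed (auto simp: arrow_list_def plen_simps, auto simp: arrow_path_def)

lemma arrow_list_qcomp: "p \<in> paths Q \<Longrightarrow> arrow_list (qcomp m p) = map (amap m) (arrow_list p)"
  using path_data[of p Q] by (auto simp: arrow_list_def plen_simps) (auto simp: qcomp_def compose_def)

lemma pstart_simps: "pstart (vertex_path Q v) = v" "pend (vertex_path Q v) = v"
  "pstart (arrow_path Q a) = src Q a" "pend (arrow_path Q a) = tgt Q a"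
  by (simp_all add: pstart_def pend_def plen_simps) (simp_all add: vertex_path_def arrow_path_def)

lemma pstart_qcomp: "p \<in> paths Q \<Longrightarrow> pstart (qcomp m p) = vmap m (pstart p)"
   "p \<in> paths Q \<Longrightarrow> pend (qcomp m p) = vmap m (pend p)"
  using path_data[of p Q] by (auto simp: pstart_def pend_def plen_simps) (auto simp: qcomp_def compose_def)

lemma vertex_path_paths: "is_quiver Q \<Longrightarrow> v \<in> verts Q \<Longrightarrow> vertex_path Q v \<in> paths Q"
  using is_category_Free[of Q] by (auto simp: is_category_def Hom_def Free_def)

lemma arrow_path_paths: "is_quiver Q \<Longrightarrow> a \<in> arrs Q \<Longrightarrow> arrow_path Q a \<in> paths Q"
  unfolding arrow_path_def by (rule pathI) (auto dest: src_in tgt_in)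

lemma pconcat_paths:
  assumes "is_quiver Q" "p \<in> paths Q" "q \<in> paths Q" "pend p = pstart q"
  shows "pconcat p q \<in> paths Q" "pend (pconcat p q) = pend q"
  using is_category_Free[OF assms(1)] assms(2-4) by (auto simp: is_category_def Hom_def Free_def)

lemma path_of:
  assumes Q: "is_quiver Q" and "qwalk Q v as w"
  shows "path_of Q v as \<in> paths Q \<and> pstart (path_of Q v as) = v \<and> pend (path_of Q v as) = w \<and>
    arrow_list (path_of Q v as) = as"
  using assms(2)
proof (induction as arbitrary: v)
  case Nil
  then show ?case using Q by (auto simp: vertex_path_paths pstart_simps arrow_list_simps)
next
  case (Cons a as)
  then have a: "a \<in> arrs Q" "src Q a = v" "qwalk Q (tgt Q a) as w" by auto
  note IH = Cons.IH[OF a(3)] and p = arrow_path_paths[OF Q a(1)]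
  show ?case
    using pconcat_paths[OF Q p, of "path_of Q (tgt Q a) as"] IH a(2)
    by (simp add: pstart_simps arrow_list_simps pstart_pconcat[OF p])
qed

lemma path_of_arrow_list:
  assumes "is_quiver Q" "p \<in> paths Q"
  shows "path_of Q (pstart p) (arrow_list p) = p"
  using path_of[OF assms(1) path_qwalk[OF assms(2)]] by (intro path_eqI) (use assms in auto)


section \<open>Diagrams as families of objects and arrows\<close>

type_synonym ('o, 'a) family = "(nat \<Rightarrow> 'o) \<times> (nat \<Rightarrow> 'a)"

text \<open>The conjunct \<open>is_quiver Q\<close> makes the set empty at ill-formed records, so
  that the comparison with the dual structure is an equality at every argument. Extensionality
  reduces equality of families to equality at vertices and arrows.\<close>

definition families :: "('o, 'a) category \<Rightarrow> quiver \<Rightarrow> ('o, 'a) family set" where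
  "families C Q = {x. is_quiver Q \<and> fst x \<in> verts Q \<rightarrow>\<^sub>E Ob C \<and> snd x \<in> arrs Q \<rightarrow>\<^sub>E Mor C \<and>
     (\<forall>a\<in>arrs Q. Dom C (snd x a) = fst x (src Q a) \<and> Cod C (snd x a) = fst x (tgt Q a))}"

definition fam_pull :: "qmor \<Rightarrow> ('o, 'a) family \<Rightarrow> ('o, 'a) family" where
  "fam_pull m x = (compose (verts (qdom m)) (fst x) (vmap m), compose (arrs (qdom m)) (snd x) (amap m))"

text \<open>A left fold starting from the identity: its recursion splits off the last arrow, exactly
  as \<open>dcomp_upto\<close> does.\<close>

definition walk_comp :: "('o, 'a) category \<Rightarrow> ('o, 'a) family \<Rightarrow> nat \<Rightarrow> nat list \<Rightarrow> 'a" where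
  "walk_comp C x v as = foldl (\<lambda>g a. Comp C (snd x a) g) (Ide C (fst x v)) as"

definition fam_commute :: "('o, 'a) category \<Rightarrow> quiver \<Rightarrow> ('o, 'a) family set" where
  "fam_commute C Q = {x \<in> families C Q. \<forall>v w as bs.
     qwalk Q v as w \<and> qwalk Q v bs w \<longrightarrow> walk_comp C x v as = walk_comp C x v bs}"

definition fam_interp :: "('o, 'a) category \<Rightarrow> ('o, 'a) family fo_struct" where
  "fam_interp C = \<lparr>carr = families C, restr = fam_pull, commute = fam_commute C\<rparr>"

lemma fam_interp_simps[simp]: "carr (fam_interp C) = families C" "restr (fam_interp C) = fam_pull"
  "commute (fam_interp C) = fam_commute C"
  by (simp_all add: fam_interp_def)

lemma familiesD:
  assumes "x \<in> families C Q"
  shows "v \<in> verts Q \<Longrightarrow> fst x v \<in> Ob C" "a \<in> arrs Q \<Longrightarrow> snd x a \<in> Mor C"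
    "a \<in> arrs Q \<Longrightarrow> Dom C (snd x a) = fst x (src Q a)" "a \<in> arrs Q \<Longrightarrow> Cod C (snd x a) = fst x (tgt Q a)"
  using assms by (auto simp: families_def)

lemma families_quiver: "x \<in> families C Q \<Longrightarrow> is_quiver Q"
  by (simp add: families_def)

lemma families_eqI:
  assumes "x \<in> families C Q" "y \<in> families C' Q" "\<And>v. v \<in> verts Q \<Longrightarrow> fst x v = fst y v"
    "\<And>a. a \<in> arrs Q \<Longrightarrow> snd x a = snd y a"
  shows "x = y"
proof (rule prod_eqI)
  show "fst x = fst y"
    by (rule extensionalityI[of _ "verts Q"]) (use assms in \<open>auto simp: families_def PiE_iff\<close>)
  show "snd x = snd y"
    by (rule extensionalityI[of _ "arrs Q"]) (use assms in \<open>auto simp: families_def PiE_iff\<close>)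
qed

lemma familiesI:
  assumes "\<And>v. v \<in> verts Q \<Longrightarrow> u v \<in> Ob C" "\<And>a. a \<in> arrs Q \<Longrightarrow> f a \<in> Mor C"
    "\<And>a. a \<in> arrs Q \<Longrightarrow> Dom C (f a) = u (src Q a)" "\<And>a. a \<in> arrs Q \<Longrightarrow> Cod C (f a) = u (tgt Q a)"
    "is_quiver Q"
  shows "(restrict u (verts Q), restrict f (arrs Q)) \<in> families C Q"
  using assms by (auto simp: families_def dest: src_in tgt_in)

lemma fam_pull_simps[simp]:
  "v \<in> verts (qdom m) \<Longrightarrow> fst (fam_pull m x) v = fst x (vmap m v)"
  "a \<in> arrs (qdom m) \<Longrightarrow> snd (fam_pull m x) a = snd x (amap m a)"
  by (auto simp: fam_pull_def compose_def)

lemma fam_commuteD: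
  assumes "x \<in> fam_commute C Q" "qwalk Q v as w" "qwalk Q v bs w"
  shows "walk_comp C x v as = walk_comp C x v bs"
proof -
  have "\<forall>v w as bs. qwalk Q v as w \<and> qwalk Q v bs w \<longrightarrow> walk_comp C x v as = walk_comp C x v bs"
    using assms(1) by (simp add: fam_commute_def)
  from this[rule_format, OF conjI[OF assms(2,3)]] show ?thesis .
qed

lemma fam_commuteI:
  assumes "x \<in> families C Q"
    "\<And>v w as bs. qwalk Q v as w \<Longrightarrow> qwalk Q v bs w \<Longrightarrow> walk_comp C x v as = walk_comp C x v bs"
  shows "x \<in> fam_commute C Q"
  using assms(1) unfolding fam_commute_def mem_Collect_eq
  by (intro conjI allI impI) (auto intro: assms(2))

lemma fam_pull_families: "is_qmor m \<Longrightarrow> x \<in> families C (qcod m) \<Longrightarrow> fam_pull m x \<in> families C (qdom m)"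
  unfolding families_def
  by (auto simp: PiE_iff qmorD src_in tgt_in) (simp_all add: fam_pull_def)

lemma fam_pull_qcomp:
  "is_qmor m \<Longrightarrow> qcod m = qdom m' \<Longrightarrow> fam_pull m (fam_pull m' x) = fam_pull (qcomp m' m) x"
  by (rule prod_eqI)
    (auto simp: fam_pull_def qcomp_def compose_def restrict_def fun_eq_iff dest: qmorD(3,4)[of m])

lemma fam_interp_structure: "is_structure (fam_interp C)"
  by (auto simp: is_structure_def fam_pull_families acyclic_embD fam_commute_def)

section \<open>Composites along walks\<close>

lemma categoryD:
  assumes "is_category C"
  shows "f \<in> Mor C \<Longrightarrow> Dom C f \<in> Ob C" "f \<in> Mor C \<Longrightarrow> Cod C f \<in> Ob C"
    "x \<in> Ob C \<Longrightarrow> Ide C x \<in> Mor C" "x \<in> Ob C \<Longrightarrow> Dom C (Ide C x) = x" "x \<in> Ob C \<Longrightarrow> Cod C (Ide C x) = x"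
    "f \<in> Mor C \<Longrightarrow> g \<in> Mor C \<Longrightarrow> Cod C f = Dom C g \<Longrightarrow> Comp C g f \<in> Mor C"
    "f \<in> Mor C \<Longrightarrow> g \<in> Mor C \<Longrightarrow> Cod C f = Dom C g \<Longrightarrow> Dom C (Comp C g f) = Dom C f"
    "f \<in> Mor C \<Longrightarrow> g \<in> Mor C \<Longrightarrow> Cod C f = Dom C g \<Longrightarrow> Cod C (Comp C g f) = Cod C g"
    "f \<in> Mor C \<Longrightarrow> Dom C f = x \<Longrightarrow> Comp C f (Ide C x) = f"
    "f \<in> Mor C \<Longrightarrow> Cod C f = x \<Longrightarrow> Comp C (Ide C x) f = f"
    "f \<in> Mor C \<Longrightarrow> g \<in> Mor C \<Longrightarrow> h \<in> Mor C \<Longrightarrow> Cod C f = Dom C g \<Longrightarrow> Cod C g = Dom C h \<Longrightarrow>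
       Comp C h (Comp C g f) = Comp C (Comp C h g) f"
  using assms by (auto simp: is_category_def Hom_def)

lemma walk_comp_simps[simp]:
  "walk_comp C x v [] = Ide C (fst x v)"
  "walk_comp C x v (as @ [a]) = Comp C (snd x a) (walk_comp C x v as)"
  by (simp_all add: walk_comp_def)

lemma walk_comp_pull:
  assumes "v \<in> verts (qdom m)" "set as \<subseteq> arrs (qdom m)"
  shows "walk_comp C (fam_pull m x) v as = walk_comp C x (vmap m v) (map (amap m) as)"
  using assms(2)
proof (induction as rule: rev_induct)
  case Nil
  then show ?case using assms(1) by simp
next
  case (snoc a as)
  then show ?case by (simp only: map_append list.map walk_comp_simps) simp
qed

lemma walk_comp_Hom:
  assumes C: "is_category C" and Q: "is_quiver Q" and x: "x \<in> families C Q" and "qwalk Q v as w"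
  shows "walk_comp C x v as \<in> Mor C" "Dom C (walk_comp C x v as) = fst x v"
    "Cod C (walk_comp C x v as) = fst x w"
proof -
  have "walk_comp C x v as \<in> Mor C \<and> Dom C (walk_comp C x v as) = fst x v \<and>
    Cod C (walk_comp C x v as) = fst x w"
    using assms(4)
  proof (induction as arbitrary: w rule: rev_induct)
    case Nil
    then show ?case using C x by (auto simp: categoryD familiesD)
  next
    case (snoc a as)
    then obtain u where u: "qwalk Q v as u" "a \<in> arrs Q" "src Q a = u" "tgt Q a = w"
      using Q by (auto simp: qwalk_append)
    then show ?case using snoc.IH[OF u(1)] C x by (auto simp: categoryD familiesD)
  qed
  then show "walk_comp C x v as \<in> Mor C" "Dom C (walk_comp C x v as) = fst x v"
    "Cod C (walk_comp C x v as) = fst x w" by auto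
qed

lemma walk_comp_append:
  assumes C: "is_category C" and Q: "is_quiver Q" and x: "x \<in> families C Q"
    and "qwalk Q v as u" "qwalk Q u bs w"
  shows "walk_comp C x v (as @ bs) = Comp C (walk_comp C x u bs) (walk_comp C x v as)"
  using assms(5)
proof (induction bs arbitrary: w rule: rev_induct)
  case Nil
  then show ?case using walk_comp_Hom[OF C Q x assms(4)] C by (auto simp: categoryD)
next
  case (snoc b bs)
  then obtain u' where u': "qwalk Q u bs u'" "b \<in> arrs Q" "src Q b = u'"
    using Q by (auto simp: qwalk_append)
  have "walk_comp C x v (as @ bs @ [b]) = Comp C (snd x b) (walk_comp C x v (as @ bs))"
    using walk_comp_simps(2)[of C x v "as @ bs" b] by simp
  then show ?case
    using snoc.IH[OF u'(1)] u' walk_comp_Hom[OF C Q x assms(4)] walk_comp_Hom[OF C Q x u'(1)] C x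
    by (simp add: categoryD familiesD)
qed

text \<open>The recursion at the other end. It is needed for \<open>path_of\<close>, which splits
  off the first arrow, and for duality, where reversal exchanges the first and the last
  arrow.\<close>

lemma walk_comp_Cons:
  assumes C: "is_category C" and Q: "is_quiver Q" and x: "x \<in> families C Q" and "qwalk Q v (a # as) w"
  shows "walk_comp C x v (a # as) = Comp C (walk_comp C x (tgt Q a) as) (snd x a)"
proof -
  have a: "qwalk Q v [a] (tgt Q a)" "qwalk Q (tgt Q a) as w" using assms(4) Q by (auto simp: tgt_in)
  have "walk_comp C x v [a] = snd x a"
    using a(1) C x walk_comp_simps(2)[of C x v "[]" a] by (simp add: categoryD familiesD)
  then show ?thesis using walk_comp_append[OF C Q x a] by simp
qed


section \<open>Isomorphisms of structures\<close>

text \<open>\<open>isomorphic\<close> with its witness exposed, so that isomorphisms can be composed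
  and used to transport environments.\<close>

definition struct_iso :: "(quiver \<Rightarrow> 'm \<Rightarrow> 'n) \<Rightarrow> 'm fo_struct \<Rightarrow> 'n fo_struct \<Rightarrow> bool" where
  "struct_iso h M N \<longleftrightarrow>
     (\<forall>Q. acyclic_quiver Q \<longrightarrow> bij_betw (h Q) (carr M Q) (carr N Q)) \<and>
     (\<forall>m. acyclic_emb m \<longrightarrow>
        (\<forall>x\<in>carr M (qcod m). h (qdom m) (restr M m x) = restr N m (h (qcod m) x))) \<and>
     (\<forall>Q. acyclic_quiver Q \<longrightarrow> (\<forall>x\<in>carr M Q. x \<in> commute M Q \<longleftrightarrow> h Q x \<in> commute N Q))"

lemma isomorphicI: "struct_iso h M N \<Longrightarrow> isomorphic M N"
  unfolding isomorphic_def struct_iso_def by (rule exI[of _ h])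

lemma struct_isoD:
  assumes "struct_iso h M N"
  shows "acyclic_quiver Q \<Longrightarrow> bij_betw (h Q) (carr M Q) (carr N Q)"
    "acyclic_quiver Q \<Longrightarrow> x \<in> carr M Q \<Longrightarrow> h Q x \<in> carr N Q"
    "acyclic_emb m \<Longrightarrow> x \<in> carr M (qcod m) \<Longrightarrow> h (qdom m) (restr M m x) = restr N m (h (qcod m) x)"
    "acyclic_quiver Q \<Longrightarrow> x \<in> carr M Q \<Longrightarrow> x \<in> commute M Q \<longleftrightarrow> h Q x \<in> commute N Q"
  using assms by (simp_all add: struct_iso_def) (blast dest: bij_betw_apply)

lemma struct_iso_trans:
  assumes h: "struct_iso h M N" and h': "struct_iso h' N P"
  shows "struct_iso (\<lambda>Q. h' Q \<circ> h Q) M P"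
  unfolding struct_iso_def
proof (intro conjI allI impI ballI)
  show "bij_betw (h' Q \<circ> h Q) (carr M Q) (carr P Q)" if "acyclic_quiver Q" for Q
    using struct_isoD(1)[OF h that] struct_isoD(1)[OF h' that] by (rule bij_betw_trans)
  show "(h' (qdom m) \<circ> h (qdom m)) (restr M m x) = restr P m ((h' (qcod m) \<circ> h (qcod m)) x)"
    if "acyclic_emb m" "x \<in> carr M (qcod m)" for m x
    using struct_isoD(3)[OF h that] struct_isoD(2)[OF h acyclic_embD(3)[OF that(1)] that(2)]
      struct_isoD(3)[OF h' that(1)] by simp
  show "x \<in> commute M Q \<longleftrightarrow> (h' Q \<circ> h Q) x \<in> commute P Q" if "acyclic_quiver Q" "x \<in> carr M Q" for Q x
    using struct_isoD(2,4)[OF h that] struct_isoD(4)[OF h' that(1)] by simp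
qed

section \<open>Transfer of satisfaction along an isomorphism\<close>

lemma has_sort_acyclic:
  "has_sort \<Gamma> t Q \<Longrightarrow> (\<And>i Q. \<Gamma> i = Some Q \<Longrightarrow> acyclic_quiver Q) \<Longrightarrow> acyclic_quiver Q"
  by (induction t arbitrary: Q) (auto simp: acyclic_emb_def)

lemma tm_val_iso:
  assumes h: "struct_iso h M N" and M: "is_structure M"
    and e: "\<And>i Q. \<Gamma> i = Some Q \<Longrightarrow> e i \<in> carr M Q \<and> e' i = h Q (e i)"
    and "has_sort \<Gamma> t Q"
  shows "tm_val M e t \<in> carr M Q \<and> tm_val N e' t = h Q (tm_val M e t)"
  using assms(4)
proof (induction t arbitrary: Q)
  case (Var i)
  then show ?case using e by auto
next
  case (RestrTm m t)
  then have m: "acyclic_emb m" "qdom m = Q" and t: "has_sort \<Gamma> t (qcod m)" by auto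
  have "restr M m (tm_val M e t) \<in> carr M (qdom m)"
    "h (qdom m) (restr M m (tm_val M e t)) = restr N m (h (qcod m) (tm_val M e t))"
    using RestrTm.IH[OF t] m(1) struct_isoD(3)[OF h m(1)] M by (auto simp: is_structure_def)
  then show ?case using RestrTm.IH[OF t] m(2) by simp
qed

text \<open>Well-sortedness puts both sides of an equation into one sort, on which \<open>h\<close>
  is injective, and lets every quantifier range over a sort on which \<open>h\<close> is bijective.
  The context \<open>\<Gamma>\<close> records for which variables \<open>e'\<close> has to be the
  image of \<open>e\<close>.\<close>

lemma sat_iso:
  assumes h: "struct_iso h M N" and M: "is_structure M"
    and "well_sorted \<Gamma> \<phi>"
    and "\<And>i Q. \<Gamma> i = Some Q \<Longrightarrow> acyclic_quiver Q \<and> e i \<in> carr M Q \<and> e' i = h Q (e i)"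
  shows "sat M e \<phi> \<longleftrightarrow> sat N e' \<phi>"
  using assms(3,4)
proof (induction \<phi> arbitrary: \<Gamma> e e')
  case (Equal s t)
  then obtain Q where Q: "has_sort \<Gamma> s Q" "has_sort \<Gamma> t Q" by auto
  have "acyclic_quiver Q" by (rule has_sort_acyclic[OF Q(1)]) (use Equal(2) in blast)
  then have "inj_on (h Q) (carr M Q)" using h by (auto simp: struct_iso_def bij_betw_def)
  moreover have "tm_val M e s \<in> carr M Q \<and> tm_val N e' s = h Q (tm_val M e s)"
    by (rule tm_val_iso[OF h M _ Q(1)]) (use Equal(2) in blast)
  moreover have "tm_val M e t \<in> carr M Q \<and> tm_val N e' t = h Q (tm_val M e t)"
    by (rule tm_val_iso[OF h M _ Q(2)]) (use Equal(2) in blast)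
  ultimately show ?case by (auto dest: inj_onD)
next
  case (Commute Q t)
  then have Q: "has_sort \<Gamma> t Q" "acyclic_quiver Q" by auto
  have "tm_val M e t \<in> carr M Q \<and> tm_val N e' t = h Q (tm_val M e t)"
    by (rule tm_val_iso[OF h M _ Q(1)]) (use Commute(2) in blast)
  then show ?case using h Q(2) by (auto simp: struct_iso_def)
next
  case (Forall Q \<phi>)
  have b: "bij_betw (h Q) (carr M Q) (carr N Q)" using h Forall(2) by (auto simp: struct_iso_def)
  have "sat M (case_nat x e) \<phi> \<longleftrightarrow> sat N (case_nat (h Q x) e') \<phi>" if "x \<in> carr M Q" for x
    by (rule Forall.IH) (use Forall.prems that in \<open>auto split: nat.splits\<close>)
  then show ?case by (simp add: bij_betw_imp_surj_on[OF b, symmetric])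
next
  case (Exists Q \<phi>)
  have b: "bij_betw (h Q) (carr M Q) (carr N Q)" using h Exists(2) by (auto simp: struct_iso_def)
  have "sat M (case_nat x e) \<phi> \<longleftrightarrow> sat N (case_nat (h Q x) e') \<phi>" if "x \<in> carr M Q" for x
    by (rule Exists.IH) (use Exists.prems that in \<open>auto split: nat.splits\<close>)
  then show ?case by (simp add: bij_betw_imp_surj_on[OF b, symmetric])
next
  case (Exists1 Q \<phi>)
  have b: "bij_betw (h Q) (carr M Q) (carr N Q)" using h Exists1(2) by (auto simp: struct_iso_def)
  have e: "sat M (case_nat x e) \<phi> \<longleftrightarrow> sat N (case_nat (h Q x) e') \<phi>" if "x \<in> carr M Q" for x
    by (rule Exists1.IH) (use Exists1.prems that in \<open>auto split: nat.splits\<close>)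
  have "(\<exists>!x. x \<in> carr M Q \<and> sat M (case_nat x e) \<phi>) \<longleftrightarrow> (\<exists>!y. y \<in> carr N Q \<and> sat N (case_nat y e') \<phi>)"
    (is "?l \<longleftrightarrow> ?r")
  proof
    assume ?l
    then obtain x where x: "x \<in> carr M Q" "sat M (case_nat x e) \<phi>"
      and u: "\<And>y. y \<in> carr M Q \<Longrightarrow> sat M (case_nat y e) \<phi> \<Longrightarrow> y = x" by blast
    show ?r
    proof (rule ex1I[of _ "h Q x"])
      show "h Q x \<in> carr N Q \<and> sat N (case_nat (h Q x) e') \<phi>"
        using x e bij_betw_apply[OF b] by simp
      fix y assume y: "y \<in> carr N Q \<and> sat N (case_nat y e') \<phi>"
      then obtain z where "z \<in> carr M Q" "y = h Q z" using bij_betw_imp_surj_on[OF b] by blast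
      then show "y = h Q x" using y e u by simp
    qed
  next
    assume ?r
    then obtain y where y: "y \<in> carr N Q" "sat N (case_nat y e') \<phi>"
      and u: "\<And>z. z \<in> carr N Q \<Longrightarrow> sat N (case_nat z e') \<phi> \<Longrightarrow> z = y" by blast
    from y(1) obtain x where x: "x \<in> carr M Q" "y = h Q x" using bij_betw_imp_surj_on[OF b] by blast
    show ?l
    proof (rule ex1I[of _ x])
      show "x \<in> carr M Q \<and> sat M (case_nat x e) \<phi>" using x y(2) e by simp
      fix z assume z: "z \<in> carr M Q \<and> sat M (case_nat z e) \<phi>"
      then have "h Q z = h Q x" using u[of "h Q z"] e[of z] bij_betw_apply[OF b, of z] x(2) z by simp
      then show "z = x" using z x(1) bij_betw_imp_inj_on[OF b] by (auto dest: inj_onD)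
    qed
  qed
  then show ?case by simp
next
  case (And \<phi> \<psi>)
  then show ?case unfolding well_sorted.simps sat.simps by metis
next
  case (Or \<phi> \<psi>)
  then show ?case unfolding well_sorted.simps sat.simps by metis
next
  case (Implies \<phi> \<psi>)
  then show ?case unfolding well_sorted.simps sat.simps by metis
next
  case (Iff \<phi> \<psi>)
  then show ?case unfolding well_sorted.simps sat.simps by metis
next
  case (Neg \<phi>)
  then show ?case unfolding well_sorted.simps sat.simps by metis
qed simp

text \<open>A sentence is well-sorted in the empty context, where the condition relating the two
  environments is vacuous; hence \<open>e\<close> and \<open>e'\<close> may be arbitrary.\<close>

lemma model_of_iso:
  assumes "struct_iso h M N" "is_structure M" "is_structure N" "\<And>\<phi>. \<phi> \<in> T \<Longrightarrow> sentence \<phi>"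
  shows "model_of M T \<longleftrightarrow> model_of N T"
proof -
  have "sat M e \<phi> \<longleftrightarrow> sat N e' \<phi>" if "\<phi> \<in> T" for \<phi> e e'
    by (rule sat_iso[OF assms(1,2) assms(4)[OF that, unfolded sentence_def]]) simp
  then show ?thesis using assms(2,3) unfolding model_of_def by blast
qed

section \<open>Families compared with functors on the free category\<close>

definition family_functor ::
  "('o, 'a) category \<Rightarrow> quiver \<Rightarrow> ('o, 'a) family \<Rightarrow> ('o, 'a) diagram" where
  "family_functor C Q x =
     \<lparr>fob = fst x, fmor = (\<lambda>p\<in>paths Q. walk_comp C x (pstart p) (arrow_list p))\<rparr>"

lemma family_functor_diagrams:
  assumes C: "is_category C" and Q: "is_quiver Q" and x: "x \<in> families C Q"
  shows "family_functor C Q x \<in> diagrams C Q"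
proof -
  note wH = walk_comp_Hom[OF C Q x path_qwalk]
  have "walk_comp C x (pstart p) (arrow_list (pconcat p q)) =
      Comp C (walk_comp C x (pstart q) (arrow_list q)) (walk_comp C x (pstart p) (arrow_list p))"
    if "p \<in> paths Q" "q \<in> paths Q" "pend p = pstart q" for p q
    using walk_comp_append[OF C Q x path_qwalk[OF that(1)]] path_qwalk[OF that(2)] that(3)
    by (simp add: arrow_list_simps)
  then show ?thesis
    unfolding diagrams_def is_functor_def
    using x wH Q by (auto simp: family_functor_def Free_def vertex_path_paths pconcat_paths
        arrow_list_simps pstart_simps pstart_pconcat families_def)
qed

lemma family_functor_arrow:
  assumes "is_category C" "is_quiver Q" "x \<in> families C Q" "a \<in> arrs Q"
  shows "fmor (family_functor C Q x) (arrow_path Q a) = snd x a"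
  using assms walk_comp_simps(2)[of C x "src Q a" "[]" a]
  by (simp add: family_functor_def arrow_path_paths arrow_list_simps pstart_simps categoryD familiesD)

text \<open>This is the universal property of \<open>Free Q\<close>. For surjectivity, the values of
  \<open>D\<close> on the arrow paths form a family \<open>x\<close>; every path is a concatenation
  of arrow paths, so functoriality and induction on the list of arrows give back
  \<open>D\<close>.\<close>

lemma family_functor_bij:
  assumes C: "is_category C" and Q: "is_quiver Q"
  shows "bij_betw (family_functor C Q) (families C Q) (diagrams C Q)"
proof -
  have "inj_on (family_functor C Q) (families C Q)"
  proof (rule inj_onI)
    fix x y assume x: "x \<in> families C Q" and y: "y \<in> families C Q"
      and e: "family_functor C Q x = family_functor C Q y"
    have "fst x = fst y" using arg_cong[OF e, of fob] by (simp add: family_functor_def)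
    moreover have "snd x a = snd y a" if "a \<in> arrs Q" for a
      using family_functor_arrow[OF C Q x that] family_functor_arrow[OF C Q y that] e by simp
    ultimately show "x = y" by (intro families_eqI[OF x y]) auto
  qed
  moreover have "D \<in> family_functor C Q ` families C Q" if "D \<in> diagrams C Q" for D
  proof -
    have F: "fob D \<in> verts Q \<rightarrow>\<^sub>E Ob C" "fmor D \<in> paths Q \<rightarrow>\<^sub>E Mor C"
      "\<And>p. p \<in> paths Q \<Longrightarrow> Dom C (fmor D p) = fob D (pstart p) \<and> Cod C (fmor D p) = fob D (pend p)"
      "\<And>v. v \<in> verts Q \<Longrightarrow> fmor D (vertex_path Q v) = Ide C (fob D v)"
      "\<And>p q. p \<in> paths Q \<Longrightarrow> q \<in> paths Q \<Longrightarrow> pend p = pstart q \<Longrightarrow>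
        fmor D (pconcat p q) = Comp C (fmor D q) (fmor D p)"
      using that by (auto simp: diagrams_def is_functor_def Free_def)
    define x where "x = (restrict (fob D) (verts Q), restrict (\<lambda>a. fmor D (arrow_path Q a)) (arrs Q))"
    have x: "x \<in> families C Q"
      unfolding x_def by (rule familiesI)
        (use F(1,2) F(3)[OF arrow_path_paths[OF Q]] arrow_path_paths[OF Q] Q in \<open>auto simp: pstart_simps\<close>)
    have walk: "fmor D (path_of Q v as) = walk_comp C x v as" if "qwalk Q v as w" for v as w
      using that
    proof (induction as arbitrary: v)
      case Nil
      then show ?case using F(4) by (auto simp: x_def)
    next
      case (Cons a as)
      then have a: "a \<in> arrs Q" "qwalk Q (tgt Q a) as w" by auto
      then have "fmor D (path_of Q v (a # as)) =
          Comp C (fmor D (path_of Q (tgt Q a) as)) (fmor D (arrow_path Q a))"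
        using path_of[OF Q a(2)] by (simp add: F(5) arrow_path_paths[OF Q] pstart_simps)
      then show ?case using Cons.IH[OF a(2)] walk_comp_Cons[OF C Q x Cons.prems] a by (simp add: x_def)
    qed
    have "family_functor C Q x = D"
    proof (rule func.equality)
      show "fob (family_functor C Q x) = fob D"
        using F(1) by (simp add: family_functor_def x_def PiE_iff extensional_restrict)
      have "walk_comp C x (pstart p) (arrow_list p) = fmor D p" if "p \<in> paths Q" for p
        using walk[OF path_qwalk[OF that]] path_of_arrow_list[OF Q that] by simp
      then show "fmor (family_functor C Q x) = fmor D"
        using F(2) by (auto simp: family_functor_def PiE_iff extensional_def fun_eq_iff)
    qed simp
    then show ?thesis using x by blast
  qed
  ultimately show ?thesis
    unfolding bij_betw_def using family_functor_diagrams[OF C Q] by blast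
qed

lemma family_functor_pull:
  assumes C: "is_category C" and m: "is_qmor m" and x: "x \<in> families C (qcod m)"
  shows "family_functor C (qdom m) (fam_pull m x) = pull m (family_functor C (qcod m) x)"
proof (rule func.equality)
  have "walk_comp C (fam_pull m x) (pstart p) (arrow_list p) =
      walk_comp C x (pstart (qcomp m p)) (arrow_list (qcomp m p))" if "p \<in> paths (qdom m)" for p
    using walk_comp_pull[of "pstart p" m "arrow_list p"] path_qwalk[OF that] m
      qwalk_verts[OF _ path_qwalk[OF that]] qwalk_arrs[OF path_qwalk[OF that]]
    by (simp add: pstart_qcomp[OF that] arrow_list_qcomp[OF that] qmorD)
  then show "fmor (family_functor C (qdom m) (fam_pull m x)) = fmor (pull m (family_functor C (qcod m) x))"
    using m by (auto simp: family_functor_def pull_def func_comp_def Free_def Free_map_def compose_def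
        fun_eq_iff qcomp_paths)
qed (use m in \<open>auto simp: family_functor_def pull_def func_comp_def Free_def Free_map_def fam_pull_def
      compose_def fun_eq_iff\<close>)

text \<open>Pulling back along \<open>p\<close> moves the computation to \<open>PQ (plen p)\<close>,
  where arrow \<open>j\<close> is the \<open>j\<close>-th arrow path and both recursions split off
  the last arrow.\<close>

lemma dcomp_family_functor:
  assumes C: "is_category C" and Q: "is_quiver Q" and x: "x \<in> families C Q" and p: "p \<in> paths Q"
  shows "dcomp C (plen p) (pull p (family_functor C Q x)) = walk_comp C x (pstart p) (arrow_list p)"
proof -
  have pm: "is_qmor p" "qdom p = PQ (plen p)" "qcod p = Q" using p path_data[OF p] by (auto simp: paths_def)
  have PQ: "is_quiver (PQ k)" for k by (rule acyclic_is_quiver[OF ranked_acyclic[OF ranked_PQ]])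
  let ?y = "fam_pull p x"
  have y: "?y \<in> families C (PQ (plen p))" using fam_pull_families[of p x C] pm x by simp
  have "pull p (family_functor C Q x) = family_functor C (PQ (plen p)) ?y"
    using family_functor_pull[OF C pm(1)] x pm by simp
  moreover have "dcomp_upto C (plen p) (family_functor C (PQ (plen p)) ?y) j =
      walk_comp C ?y 0 [0..<j]" if "j \<le> plen p" for j
    using that
  proof (induction j)
    case 0
    then show ?case by (simp add: family_functor_def)
  next
    case (Suc j)
    then show ?case by (simp add: family_functor_arrow[OF C PQ y])
  qed
  ultimately show ?thesis
    using walk_comp_pull[of 0 p "[0..<plen p]" C x] pm(2)
    by (simp add: dcomp_def pstart_def arrow_list_def)
qed

text \<open>\<open>path_of\<close> and \<open>arrow_list\<close> match pairs of parallel walks with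
  the elements of \<open>BP Q\<close>.\<close>

lemma fam_commute_iff_BP:
  assumes x: "x \<in> families C Q"
  shows "x \<in> fam_commute C Q \<longleftrightarrow> (\<forall>(p, r)\<in>BP Q.
    walk_comp C x (pstart p) (arrow_list p) = walk_comp C x (pstart r) (arrow_list r))" (is "_ \<longleftrightarrow> ?r")
proof
  assume x: "x \<in> fam_commute C Q"
  show ?r
  proof (rule ballI, rule case_prodI2)
    fix b p r assume "b \<in> BP Q" "b = (p, r)"
    then have w: "qwalk Q (pstart p) (arrow_list p) (pend p)" "qwalk Q (pstart p) (arrow_list r) (pend p)"
      and "pstart r = pstart p"
      using path_qwalk[of p Q] path_qwalk[of r Q] by (simp_all add: BP_def)
    then show "walk_comp C x (pstart p) (arrow_list p) = walk_comp C x (pstart r) (arrow_list r)"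
      using fam_commuteD[OF x w] by simp
  qed
next
  assume r: ?r
  note q = families_quiver[OF x]
  have "walk_comp C x v as = walk_comp C x v bs" if "qwalk Q v as w" "qwalk Q v bs w" for v w as bs
  proof -
    have "(path_of Q v as, path_of Q v bs) \<in> BP Q" using path_of[OF q] that by (auto simp: BP_def)
    then show ?thesis using r path_of[OF q that(1)] path_of[OF q that(2)] by auto
  qed
  then show "x \<in> fam_commute C Q" by (rule fam_commuteI[OF x])
qed

lemma fam_interp_iso:
  assumes C: "is_category C"
  shows "struct_iso (family_functor C) (fam_interp C) (cat_interp C)"
proof -
  have "x \<in> fam_commute C Q \<longleftrightarrow> family_functor C Q x \<in> commute (cat_interp C) Q"
    if x: "x \<in> families C Q" for Q x
  proof -
    note q = families_quiver[OF x]
    have "commutative C Q (family_functor C Q x) \<longleftrightarrow>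
      (\<forall>(p, r)\<in>BP Q. walk_comp C x (pstart p) (arrow_list p) = walk_comp C x (pstart r) (arrow_list r))"
      unfolding commutative_def using dcomp_family_functor[OF C q x] by (auto simp: BP_def)
    then show ?thesis
      using fam_commute_iff_BP[OF x] family_functor_diagrams[OF C q x] by (simp add: cat_interp_def)
  qed
  then show ?thesis
    unfolding struct_iso_def using family_functor_bij[OF C] family_functor_pull[OF C]
    by (auto simp: acyclic_is_quiver acyclic_embD cat_interp_def)
qed


section \<open>Duality\<close>

definition dual_struct :: "'m fo_struct \<Rightarrow> 'm fo_struct" where
  "dual_struct M = \<lparr>carr = (\<lambda>Q. carr M (dual_quiver Q)), restr = (\<lambda>m. restr M (dual_qmor m)),
     commute = (\<lambda>Q. commute M (dual_quiver Q))\<rparr>"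

lemma tm_val_dual: "tm_val M e (dual_tm t) = tm_val (dual_struct M) e t"
  by (induction t) (simp_all add: dual_struct_def)

lemma sat_dual: "sat M e (dual_fm \<phi>) \<longleftrightarrow> sat (dual_struct M) e \<phi>"
  by (induction \<phi> arbitrary: e) (simp_all add: tm_val_dual, simp_all add: dual_struct_def)

lemma op_cat_simps[simp]: "Ob (op_cat C) = Ob C" "Mor (op_cat C) = Mor C" "Dom (op_cat C) = Cod C"
  "Cod (op_cat C) = Dom C" "Ide (op_cat C) = Ide C" "Comp (op_cat C) g f = Comp C f g"
  "op_cat (op_cat C) = C"
  by (simp_all add: op_cat_def)

lemma is_category_op: "is_category C \<Longrightarrow> is_category (op_cat C)"
  unfolding is_category_def Hom_def by auto

lemma dual_quiver_simps[simp]: "verts (dual_quiver Q) = verts Q" "arrs (dual_quiver Q) = arrs Q"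
  "src (dual_quiver Q) = tgt Q" "tgt (dual_quiver Q) = src Q"
  by (simp_all add: dual_quiver_def)

lemma qwalk_dual: "is_quiver Q \<Longrightarrow> qwalk (dual_quiver Q) v as w \<longleftrightarrow> qwalk Q w (rev as) v"
  by (induction as arbitrary: v) (auto simp: qwalk_append src_in dest: src_in tgt_in)

lemma families_op: "families (op_cat C) Q = families C (dual_quiver Q)"
  using is_quiver_dual[of Q] is_quiver_dual[of "dual_quiver Q"] by (auto simp: families_def dual_dual)

text \<open>Splitting off the last arrow of \<open>rev (a # as)\<close> in the opposite category is
  splitting off the first arrow of \<open>a # as\<close> in \<open>C\<close>, which is
  \<open>walk_comp_Cons\<close>.\<close>

lemma walk_comp_op:
  assumes C: "is_category C" and Q: "is_quiver Q" and x: "x \<in> families C Q" and "qwalk Q v as w"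
  shows "walk_comp (op_cat C) x w (rev as) = walk_comp C x v as"
  using assms(4)
proof (induction as arbitrary: v)
  case (Cons a as)
  then have "qwalk Q (tgt Q a) as w" by simp
  then show ?case using Cons.IH walk_comp_Cons[OF C Q x Cons.prems] by simp
qed simp

lemma fam_commute_op:
  assumes C: "is_category C" and Q: "is_quiver Q"
  shows "fam_commute (op_cat C) Q = fam_commute C (dual_quiver Q)"
proof -
  have Q': "is_quiver (dual_quiver Q)" using Q by (rule is_quiver_dual)
  have d: "qwalk Q v as w \<longleftrightarrow> qwalk (dual_quiver Q) w (rev as) v" for v as w
    using qwalk_dual[OF Q', of v as w] by (simp add: dual_dual)
  have "(\<forall>v w as bs. qwalk Q v as w \<and> qwalk Q v bs w \<longrightarrow> walk_comp (op_cat C) x v as = walk_comp (op_cat C) x v bs)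
    \<longleftrightarrow> (\<forall>v w as bs. qwalk (dual_quiver Q) v as w \<and> qwalk (dual_quiver Q) v bs w \<longrightarrow> walk_comp C x v as = walk_comp C x v bs)"
    (is "?l \<longleftrightarrow> ?r") if x: "x \<in> families C (dual_quiver Q)" for x
  proof
    assume l: ?l
    show ?r
    proof (intro allI impI)
      fix v w as bs assume "qwalk (dual_quiver Q) v as w \<and> qwalk (dual_quiver Q) v bs w"
      then show "walk_comp C x v as = walk_comp C x v bs"
        using l[unfolded d, rule_format, where v = w and w = v and as = "rev as" and bs = "rev bs"] walk_comp_op[OF C Q' x, of v as w]
          walk_comp_op[OF C Q' x, of v bs w] by simp
    qed
  next
    assume r: ?r
    show ?l
    proof (intro allI impI)
      fix v w as bs assume "qwalk Q v as w \<and> qwalk Q v bs w"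
      then show "walk_comp (op_cat C) x v as = walk_comp (op_cat C) x v bs"
        using r[rule_format, where v = w and w = v and as = "rev as" and bs = "rev bs"] walk_comp_op[OF C Q' x, of w "rev as" v]
          walk_comp_op[OF C Q' x, of w "rev bs" v] by (simp add: d)
    qed
  qed
  then show ?thesis unfolding fam_commute_def families_op by (intro Collect_cong conj_cong refl)
qed

text \<open>A family over the dual quiver is literally a family for the opposite category, and
  \<open>dual_qmor\<close> keeps everything that \<open>fam_pull\<close> reads.\<close>

lemma dual_struct_fam_interp:
  assumes "is_category C"
  shows "dual_struct (fam_interp C) = fam_interp (op_cat C)"
proof -
  have "fam_commute (op_cat C) Q = fam_commute C (dual_quiver Q)" for Q
  proof (cases "is_quiver Q")
    case False
    then have "\<not> is_quiver (dual_quiver Q)" using is_quiver_dual[of "dual_quiver Q"] by (auto simp: dual_dual)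
    then show ?thesis using False by (auto simp: fam_commute_def dest: families_quiver)
  qed (rule fam_commute_op[OF assms])
  then show ?thesis
    by (simp add: dual_struct_def fam_interp_def families_op fam_pull_def dual_qmor_def fun_eq_iff)
qed

lemma sat_dual_fam:
  "is_category C \<Longrightarrow> sat (fam_interp C) e (dual_fm \<phi>) \<longleftrightarrow> sat (fam_interp (op_cat C)) e \<phi>"
  by (simp add: sat_dual dual_struct_fam_interp)

section \<open>Semantics of the defined formulas\<close>

lemma tm_val_lift: "tm_val M e (lift n t) = tm_val M (\<lambda>i. e (i + n)) t"
  by (induction t) simp_all

lemma tm_val_lift_case_nat[simp]:
  "tm_val M (case_nat x e) (lift 1 t) = tm_val M e t"
  "tm_val M (case_nat x e) (lift (Suc 0) t) = tm_val M e t"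
  "tm_val M (case_nat y (case_nat x e)) (lift 2 t) = tm_val M e t"
  by (simp_all add: tm_val_lift shift_case_nat)

lemma sat_conj_list: "sat M e (conj_list \<phi>s) \<longleftrightarrow> (\<forall>\<phi>\<in>set \<phi>s. sat M e \<phi>)"
  by (induction \<phi>s) auto

lemma sat_conj_over: "finite I \<Longrightarrow> sat M e (conj_over I \<phi>) \<longleftrightarrow> (\<forall>i\<in>I. sat M e (\<phi> i))"
  unfolding conj_over_def sat_conj_list using someI_ex[OF finite_distinct_list[of I]] by simp

text \<open>From here on the defined formulas are read as relations on the elements of an arbitrary
  structure. Models and interpretations of categories then share one unfolding, and the de Bruijn
  indices disappear.\<close>

definition comp_rel :: "'m fo_struct \<Rightarrow> 'm \<Rightarrow> 'm \<Rightarrow> 'm \<Rightarrow> bool" where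
  "comp_rel M x y z \<longleftrightarrow> (\<exists>w\<in>carr M Tri. restr M (arrow_path Tri 0) w = x \<and>
     restr M (arrow_path Tri 2) w = y \<and> restr M (arrow_path Tri 1) w = z \<and> w \<in> commute M Tri)"

definition eq_pos_rel :: "'m fo_struct \<Rightarrow> nat \<Rightarrow> nat \<Rightarrow> 'm \<Rightarrow> 'm \<Rightarrow> bool" where
  "eq_pos_rel M k l x y \<longleftrightarrow> restr M (st k) x = restr M (st l) y \<and>
     (\<forall>w\<in>carr M (bipath k l). restr M (bipath1 k l) w = x \<and> restr M (bipath2 k l) w = y \<longrightarrow>
        w \<in> commute M (bipath k l))"

definition id_rel :: "'m fo_struct \<Rightarrow> 'm \<Rightarrow> 'm \<Rightarrow> bool" where
  "id_rel M x y \<longleftrightarrow> restr M (sp 0 1) y = x \<and> (\<forall>z\<in>carr M (PQ 1). \<forall>w\<in>carr M (PQ 1).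
     (comp_rel M y z w \<longrightarrow> eq_pos_rel M 1 1 z w) \<and> (comp_rel M z y w \<longrightarrow> eq_pos_rel M 1 1 z w))"

definition eq_zero_pos_rel :: "'m fo_struct \<Rightarrow> nat \<Rightarrow> 'm \<Rightarrow> 'm \<Rightarrow> bool" where
  "eq_zero_pos_rel M l x y \<longleftrightarrow> (\<exists>z\<in>carr M (PQ 1). id_rel M x z \<and> eq_pos_rel M 1 l z y)"

definition eq_rel :: "'m fo_struct \<Rightarrow> nat \<Rightarrow> nat \<Rightarrow> 'm \<Rightarrow> 'm \<Rightarrow> bool" where
  "eq_rel M k l x y =
     (if k = 0 \<and> l = 0 then x = y
      else if k = 0 then eq_zero_pos_rel M l x y
      else if l = 0 then eq_zero_pos_rel M k y x
      else eq_pos_rel M k l x y)"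

lemma sat_defined:
  "sat M e (Comp_fm s t u) \<longleftrightarrow> comp_rel M (tm_val M e s) (tm_val M e t) (tm_val M e u)"
  "sat M e (EqPath_pos k l s t) \<longleftrightarrow> eq_pos_rel M k l (tm_val M e s) (tm_val M e t)"
  by (simp_all add: Comp_fm_def comp_rel_def EqPath_pos_def eq_pos_rel_def Cospan_fm_def)

lemma sat_Id_fm: "sat M e (Id_fm s t) \<longleftrightarrow> id_rel M (tm_val M e s) (tm_val M e t)"
  by (simp add: Id_fm_def id_rel_def sat_defined)

lemma sat_EqPath: "sat M e (EqPath k l s t) \<longleftrightarrow> eq_rel M k l (tm_val M e s) (tm_val M e t)"
  by (simp add: EqPath_def eq_rel_def EqPath_zero_pos_def eq_zero_pos_rel_def sat_defined sat_Id_fm)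


section \<open>Walks in the named quivers\<close>

lemma bipath_simps[simp]: "verts (bipath k l) = {0..<k + l}" "arrs (bipath k l) = {0..<k + l}"
  by (simp_all add: bipath_def)

text \<open>Off the source, a vertex of the first path has no outgoing arrow except the next one of
  that path, and the common end \<open>k\<close> has none at all.\<close>

lemma qwalk_bipath_upper:
  "qwalk (bipath k l) v as w \<Longrightarrow> 0 < v \<Longrightarrow> v \<le> k \<Longrightarrow> v \<le> w \<and> w \<le> k \<and> as = [v..<w]"
proof (induction as arbitrary: v)
  case (Cons a as)
  then have "a < k + l" "src (bipath k l) a = v" "qwalk (bipath k l) (tgt (bipath k l) a) as w" by auto
  moreover from this have "a < k \<and> a = v"
    using Cons.prems(2,3) by (auto simp: bipath_def bipath_vert_def split: if_splits)
  ultimately show ?case using Cons.IH[of "Suc v"] Cons.prems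
    by (auto simp: bipath_def upt_conv_Cons)
qed auto

text \<open>The same for the second path. Its vertices are addressed by their position
  \<open>i\<close>, because position \<open>l\<close> is the vertex \<open>k\<close>.\<close>

lemma qwalk_bipath_lower:
  "qwalk (bipath k l) v as w \<Longrightarrow> 0 < k \<Longrightarrow> 0 < i \<Longrightarrow> i \<le> l \<Longrightarrow> v = bipath_vert k l i \<Longrightarrow>
    \<exists>j. i \<le> j \<and> j \<le> l \<and> w = bipath_vert k l j \<and> as = [k + i..<k + j]"
proof (induction as arbitrary: v i)
  case Nil
  then show ?case by (intro exI[of _ i]) simp
next
  case (Cons a as)
  then have a: "a < k + l" "src (bipath k l) a = v" "qwalk (bipath k l) (tgt (bipath k l) a) as w" by auto
  then have ai: "a = k + i \<and> i < l"
    using Cons.prems(2-5) by (auto simp: bipath_def bipath_vert_def split: if_splits)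
  then have "tgt (bipath k l) a = bipath_vert k l (Suc i)" by (simp add: bipath_def)
  with Cons.IH[OF a(3), of "Suc i"] ai Cons.prems obtain j where
    "Suc i \<le> j" "j \<le> l" "w = bipath_vert k l j" "as = [k + Suc i..<k + j]" by auto
  then show ?case using ai by (intro exI[of _ j]) (auto simp: upt_conv_Cons)
qed

lemma qwalk_bipath_zero:
  assumes "0 < k" "0 < l" "qwalk (bipath k l) 0 as w"
  obtains "w \<le> k" "as = [0..<w]" | j where "0 < j" "j \<le> l" "w = bipath_vert k l j" "as = [k..<k + j]"
proof (cases as)
  case Nil
  then show ?thesis using that(1) assms by simp
next
  case (Cons a bs)
  then have a: "a < k + l" "src (bipath k l) a = 0" "qwalk (bipath k l) (tgt (bipath k l) a) bs w"
    using assms by auto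
  then consider "a = 0" | "a = k"
    using assms by (auto simp: bipath_def bipath_vert_def split: if_splits)
  then show ?thesis
  proof cases
    case 1
    then have "tgt (bipath k l) a = 1" using assms by (simp add: bipath_def)
    then show ?thesis using qwalk_bipath_upper[of k l 1 bs w] a(3) assms(1) 1 Cons that(1)
      by (auto simp: upt_conv_Cons)
  next
    case 2
    then have "tgt (bipath k l) a = bipath_vert k l 1" using assms by (simp add: bipath_def)
    then obtain j where "1 \<le> j" "j \<le> l" "w = bipath_vert k l j" "bs = [k + 1..<k + j]"
      using qwalk_bipath_lower[of k l _ bs w 1] a(3) assms by auto
    then show ?thesis using 2 Cons that(2)[of j] by (simp add: upt_conv_Cons)
  qed
qed

text \<open>The two sides meet only at their ends. So two different parallel walks have to leave the
  source along different sides and can meet again only at the sink, after each has run through its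
  whole side.\<close>

lemma qwalk_bipath_parallel:
  assumes k: "0 < k" and l: "0 < l" and as: "qwalk (bipath k l) v as w" and bs: "qwalk (bipath k l) v bs w"
  obtains "as = bs" | "v = 0" "as = [0..<k]" "bs = [k..<k + l]" | "v = 0" "as = [k..<k + l]" "bs = [0..<k]"
proof -
  have v: "v < k + l" using qwalk_verts[OF _ as] acyclic_is_quiver[OF ranked_acyclic[OF ranked_bipath[OF k l]]] by simp
  have inj: "bipath_vert k l i = bipath_vert k l j \<Longrightarrow> i = j"
    if "0 < i" "i \<le> l" "0 < j" "j \<le> l" for i j
    using that k by (auto simp: bipath_vert_def split: if_splits)
  \<comment> \<open>Away from the source, the only vertex on both sides is the sink
    \<open>k\<close>, at position \<open>l\<close> of the second side.\<close>
  have upper: "j = l \<and> i = k" if "bipath_vert k l j = i" "i \<le> k" "0 < j" "j \<le> l" for i j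
    using that k by (auto simp: bipath_vert_def split: if_splits)
  consider "v = 0" | "0 < v" "v \<le> k" | i where "0 < i" "i < l" "v = k + i"
  proof (cases "v \<le> k")
    case False
    then show ?thesis using that(3)[of "v - k"] v by auto
  qed (use that in auto)
  then show ?thesis
  proof cases
    case 1
    show ?thesis
    proof (rule qwalk_bipath_zero[OF k l as[unfolded 1]])
      assume a: "w \<le> k" "as = [0..<w]"
      show ?thesis
      proof (rule qwalk_bipath_zero[OF k l bs[unfolded 1]])
        fix j assume j: "0 < j" "j \<le> l" "w = bipath_vert k l j" "bs = [k..<k + j]"
        then show ?thesis using upper[of j w] a 1 by (intro that(2)) auto
      qed (use a that(1) in auto)
    next
      fix j assume j: "0 < j" "j \<le> l" "w = bipath_vert k l j" "as = [k..<k + j]"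
      show ?thesis
      proof (rule qwalk_bipath_zero[OF k l bs[unfolded 1]])
        assume b: "w \<le> k" "bs = [0..<w]"
        then show ?thesis using upper[of j w] j 1 by (intro that(3)) auto
      next
        fix j' assume j': "0 < j'" "j' \<le> l" "w = bipath_vert k l j'" "bs = [k..<k + j']"
        then show ?thesis using inj[of j j'] j that(1) by simp
      qed
    qed
  next
    case 2
    then show ?thesis using qwalk_bipath_upper[OF as] qwalk_bipath_upper[OF bs] that(1) by simp
  next
    case 3
    then have "v = bipath_vert k l i" by (simp add: bipath_vert_def)
    then obtain j j' where "i \<le> j" "j \<le> l" "w = bipath_vert k l j" "as = [k + i..<k + j]"
      "i \<le> j'" "j' \<le> l" "w = bipath_vert k l j'" "bs = [k + i..<k + j']"
      using qwalk_bipath_lower[OF as k 3(1)] qwalk_bipath_lower[OF bs k 3(1)] 3 by auto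
    then show ?thesis using inj[of j j'] 3 that(1) by simp
  qed
qed

lemma qwalk_bipath_sides:
  assumes "0 < k" "0 < l"
  shows "qwalk (bipath k l) 0 [0..<k] k" "qwalk (bipath k l) 0 [k..<k + l] k"
proof -
  have m: "is_qmor (bipath1 k l)" "is_qmor (bipath2 k l)"
    using pushout_config_bipath[OF assms] by (auto simp: pushout_config_def acyclic_embD)
  have "map (amap (bipath1 k l)) [0..<k] = [0..<k]"
    by (rule nth_equalityI) (auto simp: bipath1_def)
  then show "qwalk (bipath k l) 0 [0..<k] k"
    using qwalk_image[OF m(1), of 0 "[0..<k]" k] qwalk_PQ[of 0 k k]
    by (simp add: bipath1_def)
  have "map (amap (bipath2 k l)) [0..<l] = [k..<k + l]"
    by (rule nth_equalityI) (auto simp: bipath2_def)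
  then show "qwalk (bipath k l) 0 [k..<k + l] k"
    using qwalk_image[OF m(2), of 0 "[0..<l]" l] qwalk_PQ[of 0 l l] assms
    by (simp add: bipath2_def bipath_vert_def)
qed

lemma fam_commute_bipath:
  assumes "0 < k" "0 < l" "x \<in> families C (bipath k l)"
  shows "x \<in> fam_commute C (bipath k l) \<longleftrightarrow> walk_comp C x 0 [0..<k] = walk_comp C x 0 [k..<k + l]"
    (is "_ \<longleftrightarrow> ?e")
proof
  assume e: ?e
  show "x \<in> fam_commute C (bipath k l)"
  proof (rule fam_commuteI[OF assms(3)])
    fix v w as bs assume "qwalk (bipath k l) v as w" "qwalk (bipath k l) v bs w"
    then show "walk_comp C x v as = walk_comp C x v bs"
      by (rule qwalk_bipath_parallel[OF assms(1,2)]) (use e in auto)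
  qed
qed (rule fam_commuteD[OF _ qwalk_bipath_sides[OF assms(1,2)]])

text \<open>Hence \<open>ComEq\<close> and \<open>EqPath_pos 1 1\<close> speak about the same sort;
  this is what will make related arrows equal.\<close>

lemma C2_eq_bipath: "C2 = bipath 1 1"
  by (auto simp: C2_def bipath_def bipath_vert_def fun_eq_iff)

lemma fam_commute_C2:
  assumes C: "is_category C" and x: "x \<in> families C C2"
  shows "x \<in> fam_commute C C2 \<longleftrightarrow> snd x 0 = snd x 1"
proof -
  have "walk_comp C x 0 [a] = snd x a" if "a \<in> {0, 1}" for a
    using walk_comp_simps(2)[of C x 0 "[]" a] familiesD(2,3)[OF x, of a] C that
    by (auto simp: categoryD C2_def)
  then show ?thesis using fam_commute_bipath[of 1 1 x C] x by (simp add: C2_eq_bipath)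
qed

text \<open>The only two different parallel walks are \<open>[p, q]\<close> and \<open>[r]\<close>.
  The labels are arbitrary because triangles occur as \<open>Tri\<close>, as
  \<open>cone (PQ 1)\<close> and inside \<open>MonoQ\<close>.\<close>

lemma fam_commute_triangle:
  assumes C: "is_category C" and x: "x \<in> families C Q"
    and verts: "verts Q = {a, b, c}" "distinct [a, b, c]"
    and arrs: "arrs Q = {p, q, r}" "src Q p = a" "tgt Q p = b" "src Q q = b" "tgt Q q = c"
      "src Q r = a" "tgt Q r = c"
  shows "x \<in> fam_commute C Q \<longleftrightarrow> Comp C (snd x q) (snd x p) = snd x r"
proof -
  \<comment> \<open>All walks are listed, starting from the sink \<open>c\<close> and going
    backwards.\<close>
  have wc: "qwalk Q c as w \<longleftrightarrow> as = [] \<and> w = c" for as w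
    using verts arrs by (cases as) auto
  have wb: "qwalk Q b as w \<longleftrightarrow> as = [] \<and> w = b \<or> as = [q] \<and> w = c" for as w
    using verts arrs wc by (cases as) auto
  have wa: "qwalk Q a as w \<longleftrightarrow> as = [] \<and> w = a \<or> as = [p] \<and> w = b \<or> as = [p, q] \<and> w = c \<or> as = [r] \<and> w = c"
    for as w
    using verts arrs wb wc by (cases as) auto
  have pq: "walk_comp C x a [p, q] = Comp C (snd x q) (snd x p)" "walk_comp C x a [r] = snd x r"
    using walk_comp_simps(2)[of C x a "[p]" q] walk_comp_simps(2)[of C x a "[]" p]
      walk_comp_simps(2)[of C x a "[]" r] familiesD(2,3)[OF x] arrs C by (auto simp: categoryD)
  show ?thesis
  proof
    assume "x \<in> fam_commute C Q"
    then show "Comp C (snd x q) (snd x p) = snd x r"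
      using fam_commuteD[of x C Q a "[p, q]" c "[r]"] pq by (simp add: wa del: qwalk.simps)
  next
    assume e: "Comp C (snd x q) (snd x p) = snd x r"
    show "x \<in> fam_commute C Q"
    proof (rule fam_commuteI[OF x])
      fix v w as bs assume w: "qwalk Q v as w" "qwalk Q v bs w"
      then have "v = a \<or> v = b \<or> v = c" using qwalk_verts[OF families_quiver[OF x]] verts by auto
      then consider "v = a" | "v = b" | "v = c" by blast
      then show "walk_comp C x v as = walk_comp C x v bs"
      proof cases
        case 1
        then show ?thesis using w[unfolded 1 wa] verts(2) by (elim disjE conjE) (simp_all add: pq e)
      next
        case 2
        then show ?thesis using w[unfolded 2 wb] verts(2) by (elim disjE conjE) simp_all
      next
        case 3
        then show ?thesis using w[unfolded 3 wc] by simp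
      qed
    qed
  qed
qed


section \<open>Gluing families\<close>

text \<open>The set-theoretic pushout along injections: the overlap of the two images comes from
  \<open>A0\<close>, where the two functions agree. It is applied once to vertices and once to
  arrows.\<close>

lemma glue_functions:
  assumes "inj_on g1 A1" "inj_on g2 A2" "k1 ` A0 \<subseteq> A1" "k2 ` A0 \<subseteq> A2"
    and "\<And>a. a \<in> A0 \<Longrightarrow> g1 (k1 a) = g2 (k2 a)" "\<And>a. a \<in> A0 \<Longrightarrow> f1 (k1 a) = f2 (k2 a)"
    and "g1 ` A1 \<inter> g2 ` A2 \<subseteq> (\<lambda>a. g1 (k1 a)) ` A0"
  obtains f where "\<And>a. a \<in> A1 \<Longrightarrow> f (g1 a) = f1 a" "\<And>a. a \<in> A2 \<Longrightarrow> f (g2 a) = f2 a"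
proof -
  define f where "f b = (if b \<in> g1 ` A1 then f1 (inv_into A1 g1 b) else f2 (inv_into A2 g2 b))" for b
  have "f (g1 a) = f1 a" if "a \<in> A1" for a using that assms(1) by (simp add: f_def)
  moreover have "f (g2 a) = f2 a" if a: "a \<in> A2" for a
  proof (cases "g2 a \<in> g1 ` A1")
    case True
    then obtain c where c: "c \<in> A0" "g2 a = g1 (k1 c)" using a assms(7) by auto
    then have "a = k2 c" using assms(2,4,5) a by (metis image_subset_iff inj_onD)
    moreover have "k1 c \<in> A1" using c assms(3) by auto
    then have "f (g1 (k1 c)) = f1 (k1 c)" using assms(1) by (simp add: f_def)
    ultimately show ?thesis using c assms(6) by simp
  qed (use a assms(2) in \<open>simp add: f_def\<close>)
  ultimately show thesis by (rule that)
qed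

lemma pushout_configD:
  assumes "pushout_config m1 m2 m1' m2'"
  shows "acyclic_emb m1" "acyclic_emb m2" "acyclic_emb m1'" "acyclic_emb m2'"
    "qdom m1 = qdom m2" "qcod m1 = qdom m1'" "qcod m2 = qdom m2'" "qcod m1' = qcod m2'"
    "qcomp m1' m1 = qcomp m2' m2"
    "verts (qcod m2') = vmap m1' ` verts (qdom m1') \<union> vmap m2' ` verts (qdom m2')"
    "arrs (qcod m2') = amap m1' ` arrs (qdom m1') \<union> amap m2' ` arrs (qdom m2')"
  using assms by (auto simp: pushout_config_def)

text \<open>The images of the two embeddings cover the pushout quiver.\<close>

lemma families_jointly_determined:
  assumes "pushout_config m1 m2 m1' m2'" "x \<in> families C (qcod m1')" "y \<in> families C (qcod m1')"
    "fam_pull m1' x = fam_pull m1' y" "fam_pull m2' x = fam_pull m2' y"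
  shows "x = y"
proof (rule families_eqI[OF assms(2,3)])
  note p = pushout_configD[OF assms(1)]
  have v: "fst x (vmap m v) = fst y (vmap m v)" if "fam_pull m x = fam_pull m y" "v \<in> verts (qdom m)" for m v
    using that by (metis fam_pull_simps(1))
  have a: "snd x (amap m a) = snd y (amap m a)" if "fam_pull m x = fam_pull m y" "a \<in> arrs (qdom m)" for m a
    using that by (metis fam_pull_simps(2))
  show "fst x v = fst y v" if "v \<in> verts (qcod m1')" for v
    using that v[OF assms(4)] v[OF assms(5)] unfolding p by auto
  show "snd x a = snd y a" if "a \<in> arrs (qcod m1')" for a
    using that a[OF assms(4)] a[OF assms(5)] unfolding p by auto
qed

text \<open>Objects and arrows are glued separately. Each arrow of the pushout comes from one of the
  two pieces, and there the conditions on its source and target are inherited.\<close>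

lemma families_glue:
  assumes cfg: "pushout_config m1 m2 m1' m2'"
    and x1: "x1 \<in> families C (qcod m1)" and x2: "x2 \<in> families C (qcod m2)"
    and eq: "fam_pull m1 x1 = fam_pull m2 x2"
  shows "\<exists>!x. x \<in> families C (qcod m1') \<and> fam_pull m1' x = x1 \<and> fam_pull m2' x = x2"
proof -
  note p = pushout_configD[OF cfg]
  note q = acyclic_embD(1)[OF p(1)] acyclic_embD(1)[OF p(2)] acyclic_embD(1)[OF p(3)] acyclic_embD(1)[OF p(4)]
  let ?V0 = "verts (qdom m1)" and ?A0 = "arrs (qdom m1)"
  let ?V1 = "verts (qdom m1')" and ?A1 = "arrs (qdom m1')"
  let ?V2 = "verts (qdom m2')" and ?A2 = "arrs (qdom m2')"
  have ve: "vmap m1' (vmap m1 v) = vmap m2' (vmap m2 v)" if "v \<in> ?V0" for v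
    using fun_cong[OF arg_cong[OF p(9), of vmap], of v] that p(5) by (simp add: qcomp_def compose_def)
  have ae: "amap m1' (amap m1 a) = amap m2' (amap m2 a)" if "a \<in> ?A0" for a
    using fun_cong[OF arg_cong[OF p(9), of amap], of a] that p(5) by (simp add: qcomp_def compose_def)
  have vi: "vmap m1' ` ?V1 \<inter> vmap m2' ` ?V2 \<subseteq> (\<lambda>v. vmap m1' (vmap m1 v)) ` ?V0"
  proof -
    have "vmap m1' ` ?V1 \<inter> vmap m2' ` ?V2 = vmap (qcomp m1' m1) ` ?V0"
      using cfg unfolding pushout_config_def by (elim conjE) (rule sym)
    then show ?thesis by (simp add: qcomp_def compose_def)
  qed
  have ai: "amap m1' ` ?A1 \<inter> amap m2' ` ?A2 \<subseteq> (\<lambda>a. amap m1' (amap m1 a)) ` ?A0"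
  proof -
    have "amap m1' ` ?A1 \<inter> amap m2' ` ?A2 = amap (qcomp m1' m1) ` ?A0"
      using cfg unfolding pushout_config_def by (elim conjE) (rule sym)
    then show ?thesis by (simp add: qcomp_def compose_def)
  qed
  have vx: "fst x1 (vmap m1 v) = fst x2 (vmap m2 v)" if "v \<in> ?V0" for v
    using eq that p(5) by (metis fam_pull_simps(1))
  have ax: "snd x1 (amap m1 a) = snd x2 (amap m2 a)" if "a \<in> ?A0" for a
    using eq that p(5) by (metis fam_pull_simps(2))
  have vs: "vmap m1 ` ?V0 \<subseteq> ?V1" "vmap m2 ` ?V0 \<subseteq> ?V2" "amap m1 ` ?A0 \<subseteq> ?A1" "amap m2 ` ?A0 \<subseteq> ?A2"
    using qmorD(3,4)[OF q(1)] qmorD(3,4)[OF q(2)] unfolding p by auto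
  obtain u where u: "\<And>v. v \<in> ?V1 \<Longrightarrow> u (vmap m1' v) = fst x1 v" "\<And>v. v \<in> ?V2 \<Longrightarrow> u (vmap m2' v) = fst x2 v"
    using glue_functions[where ?f1.0 = "fst x1" and ?f2.0 = "fst x2",
        OF acyclic_embD(4)[OF p(3)] acyclic_embD(4)[OF p(4)] vs(1,2) ve vx vi] by blast
  obtain f where f: "\<And>a. a \<in> ?A1 \<Longrightarrow> f (amap m1' a) = snd x1 a" "\<And>a. a \<in> ?A2 \<Longrightarrow> f (amap m2' a) = snd x2 a"
    using glue_functions[where ?f1.0 = "snd x1" and ?f2.0 = "snd x2",
        OF acyclic_embD(5)[OF p(3)] acyclic_embD(5)[OF p(4)] vs(3,4) ae ax ai] by blast
  let ?Q = "qcod m2'"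
  define x where "x = (restrict u (verts ?Q), restrict f (arrs ?Q))"
  have 1: "x \<in> families C ?Q"
    unfolding x_def
  proof (rule familiesI)
    show "u v \<in> Ob C" if "v \<in> verts ?Q" for v
      using that u familiesD(1)[OF x1] familiesD(1)[OF x2] unfolding p by auto
    have f': "f a \<in> Mor C \<and> Dom C (f a) = u (src ?Q a) \<and> Cod C (f a) = u (tgt ?Q a)" if "a \<in> arrs ?Q" for a
      using that unfolding p(11)
    proof
      assume "a \<in> amap m1' ` ?A1"
      then obtain b where b: "b \<in> ?A1" "a = amap m1' b" by auto
      then have "src ?Q a = vmap m1' (src (qdom m1') b)" "tgt ?Q a = vmap m1' (tgt (qdom m1') b)"
        "src (qdom m1') b \<in> ?V1" "tgt (qdom m1') b \<in> ?V1"
        using qmorD[OF q(3)] p by (auto intro: src_in tgt_in)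
      then show ?thesis using u(1) f(1) b familiesD[OF x1, unfolded p] by simp
    next
      assume "a \<in> amap m2' ` ?A2"
      then obtain b where b: "b \<in> ?A2" "a = amap m2' b" by auto
      then have "src ?Q a = vmap m2' (src (qdom m2') b)" "tgt ?Q a = vmap m2' (tgt (qdom m2') b)"
        "src (qdom m2') b \<in> ?V2" "tgt (qdom m2') b \<in> ?V2"
        using qmorD[OF q(4)] p by (auto intro: src_in tgt_in)
      then show ?thesis using u(2) f(2) b familiesD[OF x2, unfolded p] by simp
    qed
    show "f a \<in> Mor C" "Dom C (f a) = u (src ?Q a)" "Cod C (f a) = u (tgt ?Q a)" if "a \<in> arrs ?Q" for a
      using f'[OF that] by auto
  qed (rule qmorD(2)[OF q(4)])
  have 2: "fam_pull m1' x = x1"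
    by (rule families_eqI[OF fam_pull_families[OF q(3)] x1[unfolded p]])
      (use 1 u(1) f(1) qmorD(3,4)[OF q(3)] p(8) in \<open>auto simp: x_def\<close>)
  have 3: "fam_pull m2' x = x2"
    by (rule families_eqI[OF fam_pull_families[OF q(4)] x2[unfolded p]])
      (use 1 u(2) f(2) qmorD(3,4)[OF q(4)] in \<open>auto simp: x_def\<close>)
  show ?thesis
  proof (rule ex1I[of _ x])
    show "x \<in> families C (qcod m1') \<and> fam_pull m1' x = x1 \<and> fam_pull m2' x = x2"
      using 1 2 3 p(8) by simp
    fix y assume y: "y \<in> families C (qcod m1') \<and> fam_pull m1' y = x1 \<and> fam_pull m2' y = x2"
    show "y = x"
      by (rule families_jointly_determined[OF cfg]) (use y 1 2 3 p(8) in simp_all)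
  qed
qed

section \<open>The interpretation of a category satisfies the theory of categories\<close>

definition path_comp :: "('o, 'a) category \<Rightarrow> nat \<Rightarrow> ('o, 'a) family \<Rightarrow> 'a" where
  "path_comp C k x = walk_comp C x 0 [0..<k]"

lemma is_quiver_named: "is_quiver (PQ k)" "is_quiver Tri" "is_quiver D2" "is_quiver C2" "is_quiver MonoQ"
  "is_quiver CospanQ" "is_quiver empty_quiver"
  using ranked_PQ[of k] ranked_concrete ranked_CospanQ by (simp_all add: ranked_def)

lemma path_comp_Hom:
  assumes "is_category C" "x \<in> families C (PQ k)"
  shows "path_comp C k x \<in> Mor C" "Dom C (path_comp C k x) = fst x 0" "Cod C (path_comp C k x) = fst x k"
  using walk_comp_Hom[OF assms(1) is_quiver_named(1) assms(2) qwalk_PQ[of 0 k k]] by (auto simp: path_comp_def)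

lemma path_comp_simps:
  assumes "is_category C"
  shows "path_comp C 0 x = Ide C (fst x 0)"
    "x \<in> families C (PQ 1) \<Longrightarrow> path_comp C (Suc 0) x = snd x 0"
  using familiesD(2,3)[of x C "PQ 1" 0] walk_comp_simps(2)[of C x 0 "[]" 0] assms
  by (auto simp: path_comp_def categoryD)

lemma path_comp_pull:
  assumes "x \<in> families C Q" "p \<in> paths Q"
  shows "path_comp C (plen p) (fam_pull p x) = walk_comp C x (pstart p) (arrow_list p)"
  using walk_comp_pull[of 0 p "[0..<plen p]" C x] path_data[OF assms(2)]
  by (simp add: path_comp_def pstart_def arrow_list_def)

lemma comp_rel_fam:
  assumes C: "is_category C" and x: "x \<in> families C (PQ 1)" and y: "y \<in> families C (PQ 1)"
    and z: "z \<in> families C (PQ 1)"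
  shows "comp_rel (fam_interp C) x y z \<longleftrightarrow>
    Cod C (snd x 0) = Dom C (snd y 0) \<and> snd z 0 = Comp C (snd y 0) (snd x 0)" (is "?l \<longleftrightarrow> ?r")
proof -
  have tri: "w \<in> fam_commute C Tri \<longleftrightarrow> Comp C (snd w 2) (snd w 0) = snd w 1"
    if w: "w \<in> families C Tri" for w
    by (rule fam_commute_triangle[OF C w, where a = 0 and b = 1 and c = 2]) (auto simp: Tri_def)
  show ?thesis
  proof
    assume ?l
    then obtain w where w: "w \<in> families C Tri" "fam_pull (arrow_path Tri 0) w = x"
      "fam_pull (arrow_path Tri 2) w = y" "fam_pull (arrow_path Tri 1) w = z" "w \<in> fam_commute C Tri"
      by (auto simp: comp_rel_def)
    have s: "snd x 0 = snd w 0" "snd y 0 = snd w 2" "snd z 0 = snd w 1"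
      unfolding w(2-4)[symmetric] by (simp_all add: arrow_path_def)
    have "Cod C (snd w 0) = Dom C (snd w 2)"
      using familiesD(3,4)[OF w(1)] by (simp add: Tri_def)
    then show ?r using tri[OF w(1)] w(5) unfolding s by simp
  next
    assume r: ?r
    note xD = familiesD[OF x, of 0] and yD = familiesD[OF y, of 0] and zD = familiesD[OF z, of 0]
    have o1: "fst x 1 \<in> Ob C" "fst y 1 \<in> Ob C" "fst z 1 \<in> Ob C"
      using familiesD(1)[OF x, of 1] familiesD(1)[OF y, of 1] familiesD(1)[OF z, of 1] by auto
    define w where "w = (restrict (\<lambda>v. if v = 0 then fst x 0 else if v = 1 then fst x 1 else fst y 1) (verts Tri),
      restrict (\<lambda>a. if a = 0 then snd x 0 else if a = 1 then snd z 0 else snd y 0) (arrs Tri))"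
    have e: "Dom C (snd x 0) = fst x 0" "Cod C (snd x 0) = fst x 1" "Dom C (snd y 0) = fst y 0"
      "Cod C (snd y 0) = fst y 1" "Dom C (snd z 0) = fst z 0" "Cod C (snd z 0) = fst z 1"
      "fst y 0 = fst x 1" "snd x 0 \<in> Mor C" "snd y 0 \<in> Mor C" "snd z 0 \<in> Mor C"
      using xD yD zD r by auto
    have e': "fst z 0 = fst x 0" "fst z 1 = fst y 1" using r e C by (auto simp: categoryD)
    have w: "w \<in> families C Tri" unfolding w_def
      by (rule familiesI) (use xD(1) o1 e e' is_quiver_named(2) in \<open>auto simp: Tri_def\<close>)
    have pw: "fam_pull (arrow_path Tri a) w \<in> families C (PQ 1)" if "a \<in> arrs Tri" for a
      using fam_pull_families[of "arrow_path Tri a" w C] w arrow_path_paths[OF is_quiver_named(2) that]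
      by (auto simp: paths_def)
    have "fam_pull (arrow_path Tri 0) w = x"
      by (rule families_eqI[OF pw x]) (auto simp: arrow_path_def Tri_def w_def le_Suc_eq)
    moreover have "fam_pull (arrow_path Tri 2) w = y"
      by (rule families_eqI[OF pw y]) (use e in \<open>auto simp: arrow_path_def Tri_def w_def le_Suc_eq\<close>)
    moreover have "fam_pull (arrow_path Tri 1) w = z"
      by (rule families_eqI[OF pw z]) (use e' in \<open>auto simp: arrow_path_def Tri_def w_def le_Suc_eq\<close>)
    moreover have "w \<in> fam_commute C Tri" using tri[OF w] r by (simp add: w_def Tri_def)
    ultimately show ?l using w by (auto simp: comp_rel_def)
  qed
qed

text \<open>The universal quantifier in \<open>EqPath_pos\<close> is not vacuous: once the ends
  agree, \<open>x\<close> and \<open>y\<close> glue to a family over \<open>bipath k l\<close>,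
  which commutes iff the two composites agree.\<close>

lemma eq_pos_rel_fam:
  assumes C: "is_category C" and x: "x \<in> families C (PQ k)" and y: "y \<in> families C (PQ l)"
    and k: "0 < k" and l: "0 < l"
  shows "eq_pos_rel (fam_interp C) k l x y \<longleftrightarrow> path_comp C k x = path_comp C l y" (is "?l \<longleftrightarrow> ?r")
proof -
  note cfg = pushout_config_bipath[OF k l]
  have com: "w \<in> fam_commute C (bipath k l) \<longleftrightarrow>
      path_comp C k (fam_pull (bipath1 k l) w) = path_comp C l (fam_pull (bipath2 k l) w)"
    if w: "w \<in> families C (bipath k l)" for w
  proof -
    have "map (amap (bipath1 k l)) [0..<k] = [0..<k]" "map (amap (bipath2 k l)) [0..<l] = [k..<k + l]"
      by (rule nth_equalityI; simp add: bipath1_def bipath2_def)+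
    then show ?thesis
      using walk_comp_pull[of 0 "bipath1 k l" "[0..<k]" C w] walk_comp_pull[of 0 "bipath2 k l" "[0..<l]" C w] l
      by (simp add: fam_commute_bipath[OF k l w] path_comp_def) (simp add: bipath1_def bipath2_def bipath_vert_def)
  qed
  show ?thesis
  proof
    assume e: ?l
    then obtain w where "w \<in> families C (bipath k l)" "fam_pull (bipath1 k l) w = x" "fam_pull (bipath2 k l) w = y"
      using families_glue[OF cfg, of x C y] x y by (auto simp: eq_pos_rel_def)
    then show ?r using e com by (auto simp: eq_pos_rel_def)
  next
    assume r: ?r
    \<comment> \<open>Equal composites have equal sources and targets, which gives the equation
      between the restrictions to \<open>D2\<close>.\<close>
    then have e: "fst x 0 = fst y 0" "fst x k = fst y l"
      using path_comp_Hom[OF C x] path_comp_Hom[OF C y] by auto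
    have "fam_pull (st k) x \<in> families C D2" "fam_pull (st l) y \<in> families C D2"
      using fam_pull_families[of "st k" x C] fam_pull_families[of "st l" y C] x y pushout_configD(1,2)[OF cfg]
      by (auto simp: acyclic_embD st_def)
    then have "fam_pull (st k) x = fam_pull (st l) y"
      by (rule families_eqI) (use e in \<open>auto simp: D2_def st_def\<close>)
    then show ?l using com r by (auto simp: eq_pos_rel_def)
  qed
qed

lemma PQ1_eqI:
  assumes x: "x \<in> families C (PQ 1)" and y: "y \<in> families C (PQ 1)"
    and "snd x 0 = snd y 0"
  shows "x = y"
proof (rule families_eqI[OF x y])
  show "fst x v = fst y v" if "v \<in> verts (PQ 1)" for v
    using that familiesD(3,4)[OF x, of 0] familiesD(3,4)[OF y, of 0] assms(3)
    by (auto simp: le_Suc_eq)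
qed (use assms(3) in auto)

lemma eq_pos_rel_one:
  assumes C: "is_category C" and x: "x \<in> families C (PQ 1)" and y: "y \<in> families C (PQ 1)"
  shows "eq_pos_rel (fam_interp C) 1 1 x y \<longleftrightarrow> x = y"
  using eq_pos_rel_fam[OF C x y] PQ1_eqI[OF x y] x y path_comp_simps(2)[OF C] by auto

definition arrow_family :: "('o, 'a) category \<Rightarrow> 'a \<Rightarrow> ('o, 'a) family" where
  "arrow_family C f = (restrict (\<lambda>i. if i = 0 then Dom C f else Cod C f) (verts (PQ 1)),
     restrict (\<lambda>_. f) (arrs (PQ 1)))"

definition object_family :: "'o \<Rightarrow> ('o, 'a) family" where
  "object_family c = (restrict (\<lambda>_. c) (verts (PQ 0)), restrict (\<lambda>_. undefined) (arrs (PQ 0)))"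

lemma arrow_family:
  assumes "is_category C" "f \<in> Mor C"
  shows "arrow_family C f \<in> families C (PQ 1)" "snd (arrow_family C f) 0 = f"
    "fst (arrow_family C f) 0 = Dom C f" "fst (arrow_family C f) (Suc 0) = Cod C f"
proof -
  show "arrow_family C f \<in> families C (PQ 1)" unfolding arrow_family_def
    by (rule familiesI) (use assms is_quiver_named(1) in \<open>auto simp: categoryD\<close>)
qed (simp_all add: arrow_family_def)

lemma object_family:
  assumes "c \<in> Ob C"
  shows "object_family c \<in> families C (PQ 0)" "fst (object_family c) 0 = c"
proof -
  show "object_family c \<in> families C (PQ 0)" unfolding object_family_def
    by (rule familiesI) (use assms is_quiver_named(1) in auto)
qed (simp add: object_family_def)

lemma id_rel_fam:
  assumes C: "is_category C" and x: "x \<in> families C (PQ 0)" and y: "y \<in> families C (PQ 1)"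
  shows "id_rel (fam_interp C) x y \<longleftrightarrow> snd y 0 = Ide C (fst x 0)" (is "?l \<longleftrightarrow> ?r")
proof -
  have sp: "fam_pull (sp 0 1) y = x \<longleftrightarrow> fst y 0 = fst x 0"
  proof -
    have p: "fam_pull (sp 0 1) y \<in> families C (PQ 0)"
      using fam_pull_families[of "sp 0 1" y C] y sptp_emb(1)[of 0 1] by (simp add: acyclic_embD)
    have "fst (fam_pull (sp 0 1) y) 0 = fst y 0" by (simp add: sp_def)
    then show ?thesis using families_eqI[OF p x] by auto
  qed
  note yD = familiesD(2-4)[OF y, of 0]
  show ?thesis
  proof
    assume l: ?l
    \<comment> \<open>Test \<open>y\<close> against the identity of its target: the composite is
      \<open>y\<close> again, so \<open>id_rel\<close> forces \<open>y\<close> to be that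
      identity.\<close>
    let ?z = "arrow_family C (Ide C (fst y (Suc 0)))"
    have i: "Ide C (fst y (Suc 0)) \<in> Mor C" "Dom C (Ide C (fst y (Suc 0))) = fst y (Suc 0)"
      using C familiesD(1)[OF y, of "Suc 0"] by (auto simp: categoryD)
    note z = arrow_family[OF C i(1)]
    have "comp_rel (fam_interp C) y ?z y"
      unfolding comp_rel_fam[OF C y z(1) y] using yD C by (auto simp: z i categoryD)
    then have "eq_pos_rel (fam_interp C) 1 1 ?z y" using l y z(1) unfolding id_rel_def by simp
    then have "y = ?z" using eq_pos_rel_one[OF C z(1) y] by simp
    then have "snd y 0 = Ide C (fst y (Suc 0))" "fst y 0 = fst y (Suc 0)" using z(2-4) i(2) by metis+
    then show ?r using l sp by (simp add: id_rel_def)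
  next
    assume r: ?r
    have "fst x 0 \<in> Ob C" using familiesD(1)[OF x] by simp
    then have i: "Dom C (snd y 0) = fst x 0" "Cod C (snd y 0) = fst x 0" using r C by (auto simp: categoryD)
    have "eq_pos_rel (fam_interp C) 1 1 z w"
      if "z \<in> families C (PQ 1)" "w \<in> families C (PQ 1)"
        "comp_rel (fam_interp C) y z w \<or> comp_rel (fam_interp C) z y w" for z w
    proof -
      have "snd w 0 = snd z 0"
        using that comp_rel_fam[OF C y that(1,2)] comp_rel_fam[OF C that(1) y that(2)] r i C
          familiesD(2)[OF that(1), of 0] by (auto simp: categoryD)
      then show ?thesis using PQ1_eqI[OF that(1,2)] eq_pos_rel_one[OF C that(1,2)] by simp
    qed
    then show ?l unfolding id_rel_def using sp i yD by auto
  qed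
qed

lemma eq_zero_pos_rel_fam:
  assumes C: "is_category C" and x: "x \<in> families C (PQ 0)" and y: "y \<in> families C (PQ l)" and l: "0 < l"
  shows "eq_zero_pos_rel (fam_interp C) l x y \<longleftrightarrow> path_comp C 0 x = path_comp C l y"
proof -
  have "fst x 0 \<in> Ob C" using familiesD(1)[OF x] by simp
  then have i: "Ide C (fst x 0) \<in> Mor C" using C by (simp add: categoryD)
  have "eq_zero_pos_rel (fam_interp C) l x y \<longleftrightarrow>
      (\<exists>z\<in>families C (PQ 1). snd z 0 = Ide C (fst x 0) \<and> snd z 0 = path_comp C l y)"
    unfolding eq_zero_pos_rel_def fam_interp_simps
    using id_rel_fam[OF C x] eq_pos_rel_fam[OF C _ y _ l, of _ 1] path_comp_simps(2)[OF C] by (intro bex_cong) auto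
  also have "\<dots> \<longleftrightarrow> Ide C (fst x 0) = path_comp C l y" using arrow_family[OF C i] by auto
  finally show ?thesis by (simp add: path_comp_simps[OF C])
qed

lemma eq_rel_fam:
  assumes C: "is_category C" and x: "x \<in> families C (PQ k)" and y: "y \<in> families C (PQ l)"
  shows "eq_rel (fam_interp C) k l x y \<longleftrightarrow> path_comp C k x = path_comp C l y"
proof (cases "k = 0 \<and> l = 0")
  case True
  \<comment> \<open>For two trivial paths \<open>EqPath\<close> is plain equality; it agrees with
    equality of composites because an identity determines its object.\<close>
  have "fst x 0 = fst y 0" if "Ide C (fst x 0) = Ide C (fst y 0)"
    using that C familiesD(1)[OF x, of 0] familiesD(1)[OF y, of 0] by (metis True PQ_simps(1) atLeastAtMost_iff categoryD(4) le_refl)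
  then have "path_comp C 0 x = path_comp C 0 y \<longleftrightarrow> x = y"
    using True x y families_eqI[of x C "PQ 0" y C] by (auto simp: path_comp_simps[OF C])
  then show ?thesis using True by (simp add: eq_rel_def)
next
  case False
  then show ?thesis
    using eq_pos_rel_fam[OF C x y] eq_zero_pos_rel_fam[OF C, of x y l] eq_zero_pos_rel_fam[OF C, of y x k] x y
    by (auto simp: eq_rel_def)
qed

lemma path_comp_concat:
  assumes C: "is_category C" and x: "x \<in> families C (PQ (k + l))"
  shows "path_comp C (k + l) x =
    Comp C (path_comp C l (fam_pull (tp l (k + l)) x)) (path_comp C k (fam_pull (sp k (k + l)) x))"
proof -
  have "map (amap (sp k (k + l))) [0..<k] = [0..<k]" "map (amap (tp l (k + l))) [0..<l] = [k..<k + l]"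
    by (rule nth_equalityI; simp add: sp_def tp_def)+
  moreover have "vmap (sp k (k + l)) 0 = 0" "vmap (tp l (k + l)) 0 = k" by (simp_all add: sp_def tp_def)
  ultimately have "path_comp C k (fam_pull (sp k (k + l)) x) = walk_comp C x 0 [0..<k]"
    "path_comp C l (fam_pull (tp l (k + l)) x) = walk_comp C x k [k..<k + l]"
    using walk_comp_pull[of 0 "sp k (k + l)" "[0..<k]" C x] walk_comp_pull[of 0 "tp l (k + l)" "[0..<l]" C x]
    by (simp_all add: path_comp_def)
  then show ?thesis
    using walk_comp_append[OF C is_quiver_named(1) x qwalk_PQ[of 0 k "k + l"] qwalk_PQ[of k "k + l" "k + l"]]
    by (simp add: path_comp_def upt_add_eq_append[of 0 k l])
qed

text \<open>By \<open>eq_rel_fam\<close>, \<open>EqPath\<close> means equality of composites. This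
  makes it an equivalence relation, and \<open>path_comp_concat\<close> makes it compatible with
  concatenation.\<close>

lemma fam_interp_T_cat:
  assumes C: "is_category C" and "\<phi> \<in> T_cat"
  shows "sat (fam_interp C) e \<phi>"
proof -
  let ?M = "fam_interp C"
  have EmptyEU: "sat ?M e EmptyEU"
  proof -
    have "(restrict (\<lambda>_. undefined) (verts empty_quiver), restrict (\<lambda>_. undefined) (arrs empty_quiver))
      \<in> families C empty_quiver"
      by (rule familiesI) (auto simp: empty_quiver_def is_quiver_def)
    moreover have "x = y" if "x \<in> families C empty_quiver" "y \<in> families C empty_quiver" for x y
      by (rule families_eqI[OF that]) (auto simp: empty_quiver_def)
    ultimately show ?thesis by (auto simp: EmptyEU_def)
  qed
  have RestrComp: "sat ?M e (RestrComp m m')"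
    if "acyclic_emb m" "acyclic_emb m'" "qcod m = qdom m'" for m m'
    using that by (simp add: RestrComp_def fam_pull_qcomp acyclic_embD)
  have PushoutEU: "sat ?M e (PushoutEU m1 m2 m1' m2')" if "pushout_config m1 m2 m1' m2'" for m1 m2 m1' m2'
    using families_glue[OF that, of _ C] by (simp add: PushoutEU_def Cospan_fm_def numeral_2_eq_2)
  have CompE: "sat ?M e CompE"
  proof -
    have "\<exists>z\<in>families C (PQ 1). comp_rel ?M x y z"
      if x: "x \<in> families C (PQ 1)" and y: "y \<in> families C (PQ 1)"
        and eq: "fam_pull (tp 0 1) x = fam_pull (sp 0 1) y" for x y
    proof -
      have "Cod C (snd x 0) = Dom C (snd y 0)"
        using arg_cong[OF eq, of "\<lambda>z. fst z 0"] familiesD(4)[OF x, of 0] familiesD(3)[OF y, of 0]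
        by (simp add: tp_def sp_def)
      moreover from this have "Comp C (snd y 0) (snd x 0) \<in> Mor C"
        using C familiesD(2)[OF x, of 0] familiesD(2)[OF y, of 0] by (simp add: categoryD)
      ultimately show ?thesis
        using arrow_family[OF C, of "Comp C (snd y 0) (snd x 0)"] comp_rel_fam[OF C x y] by auto
    qed
    then show ?thesis by (simp add: CompE_def sat_defined numeral_2_eq_2)
  qed
  have IdE: "sat ?M e IdE"
  proof -
    have "\<exists>y\<in>families C (PQ 1). id_rel ?M x y" if x: "x \<in> families C (PQ 0)" for x
      using familiesD(1)[OF x, of 0] arrow_family[OF C, of "Ide C (fst x 0)"] id_rel_fam[OF C x] C
      by (auto simp: categoryD)
    then show ?thesis by (simp add: IdE_def sat_Id_fm)
  qed
  have EqPath: "sat ?M e (EqPathRefl k)" "sat ?M e (EqPathSym k l)" "sat ?M e (EqPathTrans k l n)" for k l n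
    by (simp_all add: EqPathRefl_def EqPathSym_def EqPathTrans_def sat_EqPath eq_rel_fam[OF C] numeral_2_eq_2)
  have EqPathConcat: "sat ?M e (EqPathConcat k1 k2 k1' k2')" for k1 k2 k1' k2'
    using path_comp_concat[OF C]
    by (auto simp: EqPathConcat_def sat_EqPath eq_rel_fam[OF C] Cospan_fm_def eval_nat_numeral)
  have ComEq: "sat ?M e ComEq"
  proof -
    have "fam_pull (arrow_path C2 0) x = fam_pull (arrow_path C2 1) x" if x: "x \<in> fam_commute C C2" for x
    proof -
      have x': "x \<in> families C C2" using x by (simp add: fam_commute_def)
      have "fam_pull (arrow_path C2 a) x \<in> families C (PQ 1)" if "a \<in> {0, 1}" for a
        using fam_pull_families[of "arrow_path C2 a" x C] x' that arrow_path_paths[OF is_quiver_named(4), of a]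
        by (auto simp: paths_def C2_def)
      then show ?thesis
        by (intro PQ1_eqI) (use fam_commute_C2[OF C x'] x in \<open>auto simp: arrow_path_def\<close>)
    qed
    then show ?thesis by (simp add: ComEq_def)
  qed
  have PathCom: "sat ?M e (PathCom Q)" if Q: "acyclic_quiver Q" for Q
  proof -
    have "eq_rel ?M (plen p) (plen q) (fam_pull p x) (fam_pull q x) \<longleftrightarrow>
        walk_comp C x (pstart p) (arrow_list p) = walk_comp C x (pstart q) (arrow_list q)"
      if x: "x \<in> families C Q" and "(p, q) \<in> BP Q" for x p q
    proof -
      have pq: "p \<in> paths Q" "q \<in> paths Q" using that(2) by (auto simp: BP_def)
      then have "fam_pull p x \<in> families C (PQ (plen p))" "fam_pull q x \<in> families C (PQ (plen q))"
        using fam_pull_families[of p x C] fam_pull_families[of q x C] x path_data[OF pq(1)] path_data[OF pq(2)]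
        by (auto simp: paths_def)
      then show ?thesis using path_comp_pull[OF x pq(1)] path_comp_pull[OF x pq(2)] by (simp add: eq_rel_fam[OF C])
    qed
    then show ?thesis
      using fam_commute_iff_BP[of _ C Q]
      by (auto simp: PathCom_def sat_conj_over[OF finite_BP[OF Q]] sat_EqPath)
  qed
  show ?thesis
    using assms(2) EmptyEU RestrComp PushoutEU CompE IdE EqPath EqPathConcat ComEq PathCom
    unfolding T_cat_def by (elim UnE CollectE exE conjE insertE emptyE) simp_all
qed

section \<open>The category of a model\<close>

lemma path_emb: "acyclic_quiver Q \<Longrightarrow> p \<in> paths Q \<Longrightarrow> acyclic_emb p"
proof -
  assume "acyclic_quiver Q" "p \<in> paths Q"
  moreover from this(2) have "qdom p = PQ (plen p)" "qcod p = Q" using path_data by auto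
  ultimately show "acyclic_emb p"
    using ranked_acyclic[OF ranked_PQ] by (simp add: acyclic_emb_def) (simp add: acyclic_quiver_def)
qed

lemma vertex_path_emb: "acyclic_quiver Q \<Longrightarrow> v \<in> verts Q \<Longrightarrow> acyclic_emb (vertex_path Q v)"
  by (simp add: path_emb vertex_path_paths acyclic_is_quiver)

lemma arrow_path_emb: "acyclic_quiver Q \<Longrightarrow> a \<in> arrs Q \<Longrightarrow> acyclic_emb (arrow_path Q a)"
  by (simp add: path_emb arrow_path_paths acyclic_is_quiver)

lemma acyclic_named: "acyclic_quiver (PQ k)" "acyclic_quiver Tri" "acyclic_quiver D2" "acyclic_quiver C2"
  "acyclic_quiver empty_quiver"
  using ranked_acyclic ranked_PQ ranked_concrete by auto

lemma qcomp_sp_tp: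
  assumes "j \<le> k" "k \<le> l"
  shows "qcomp (sp k l) (sp j k) = sp j l" "qcomp (tp k l) (tp j k) = tp j l"
  using assms by (auto simp: qcomp_def sp_def tp_def compose_def fun_eq_iff)

lemma qcomp_arrow_sp_tp:
  assumes "a \<in> arrs Q" "is_quiver Q"
  shows "qcomp (arrow_path Q a) (sp 0 1) = vertex_path Q (src Q a)"
    "qcomp (arrow_path Q a) (tp 0 1) = vertex_path Q (tgt Q a)"
  by (auto simp: qcomp_def sp_def tp_def arrow_path_def vertex_path_def compose_def fun_eq_iff)

lemma qcomp_vertex_arrow:
  "v \<in> verts (qdom m) \<Longrightarrow> qcomp m (vertex_path (qdom m) v) = vertex_path (qcod m) (vmap m v)"
  "is_qmor m \<Longrightarrow> a \<in> arrs (qdom m) \<Longrightarrow> qcomp m (arrow_path (qdom m) a) = arrow_path (qcod m) (amap m a)"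
  by (auto simp: qcomp_def arrow_path_def vertex_path_def compose_def fun_eq_iff qmorD src_in tgt_in)

text \<open>The initial and the final segment of \<open>PQ (k + l)\<close> share exactly the vertex
  \<open>k\<close>; thus \<open>PushoutEU\<close> provides concatenation of paths in a
  model.\<close>

lemma pushout_config_concat:
  "pushout_config (tp 0 k) (sp 0 l) (sp k (k + l)) (tp l (k + l))"
proof -
  have "vmap (sp k (k + l)) ` {0..k} = {0..k}" "amap (sp k (k + l)) ` {0..<k} = {0..<k}"
    by (auto simp: sp_def)
  moreover have "vmap (tp l (k + l)) ` {0..l} = {k..k + l}" "amap (tp l (k + l)) ` {0..<l} = {k..<k + l}"
  proof -
    have "vmap (tp l (k + l)) ` {0..l} = (\<lambda>i. i + k) ` {0..l}" "amap (tp l (k + l)) ` {0..<l} = (\<lambda>i. i + k) ` {0..<l}"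
      by (rule image_cong; simp add: tp_def)+
    then show "vmap (tp l (k + l)) ` {0..l} = {k..k + l}" "amap (tp l (k + l)) ` {0..<l} = {k..<k + l}"
      by (simp_all add: add.commute)
  qed
  moreover have "vmap (qcomp (sp k (k + l)) (tp 0 k)) ` {0..0} = {k}"
    by (auto simp: qcomp_def sp_def tp_def compose_def)
  moreover have "qcomp (sp k (k + l)) (tp 0 k) = qcomp (tp l (k + l)) (sp 0 l)"
    by (auto simp: qcomp_def sp_def tp_def compose_def fun_eq_iff)
  ultimately show ?thesis
    unfolding pushout_config_def by (auto simp: sptp_emb)
qed

lemma arrow_list_sp_tp: "arrow_list (sp k l) = [0..<k]" "k \<le> l \<Longrightarrow> arrow_list (tp k l) = [l - k..<l]"
proof -
  show "arrow_list (sp k l) = [0..<k]"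
    by (rule nth_equalityI) (simp_all add: arrow_list_def plen_def, simp add: sp_def)
  show "arrow_list (tp k l) = [l - k..<l]" if "k \<le> l"
    by (rule nth_equalityI) (use that in \<open>simp_all add: arrow_list_def plen_def\<close>, simp add: tp_def)
qed

lemma sp_tp_paths: "k \<le> l \<Longrightarrow> sp k l \<in> paths (PQ l)" "k \<le> l \<Longrightarrow> tp k l \<in> paths (PQ l)"
  using sptp_emb[of k l] by (auto simp: paths_def acyclic_embD)

text \<open>Serves to recognise the two edges of a triangle in the path of length two that runs
  through them.\<close>

lemma qcomp_pconcat:
  assumes Q: "is_quiver Q" and p: "p \<in> paths Q" and q: "q \<in> paths Q" and e: "pend p = pstart q"
  shows "qcomp (pconcat p q) (sp (plen p) (plen p + plen q)) = p"
    "qcomp (pconcat p q) (tp (plen q) (plen p + plen q)) = q"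
proof -
  let ?c = "pconcat p q" and ?k = "plen p" and ?l = "plen q"
  have c: "?c \<in> paths Q" "is_qmor ?c" "qdom ?c = PQ (?k + ?l)" "qcod ?c = Q"
    using pconcat_paths[OF assms] by (auto simp: paths_def pconcat_def)
  have am: "amap ?c i = amap p i" if "i < ?k" for i using that by (simp add: pconcat_def)
  have am': "amap ?c (?k + i) = amap q i" if "i < ?l" for i using that by (simp add: pconcat_def)
  have s: "sp ?k (?k + ?l) \<in> paths (qdom ?c)" "tp ?l (?k + ?l) \<in> paths (qdom ?c)"
    using sp_tp_paths[of ?k "?k + ?l"] sp_tp_paths[of ?l "?k + ?l"] c(3) by auto
  show "qcomp ?c (sp ?k (?k + ?l)) = p"
  proof (rule path_eqI)
    show "qcomp ?c (sp ?k (?k + ?l)) \<in> paths Q" using qcomp_paths[OF c(2) s(1)] c(4) by simp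
    show "pstart (qcomp ?c (sp ?k (?k + ?l))) = pstart p"
      using pstart_qcomp(1)[OF s(1)] by (simp add: pstart_def sp_def pconcat_def)
    show "arrow_list (qcomp ?c (sp ?k (?k + ?l))) = arrow_list p"
      unfolding arrow_list_qcomp[OF s(1)] arrow_list_sp_tp by (simp add: arrow_list_def am)
  qed (rule p)
  show "qcomp ?c (tp ?l (?k + ?l)) = q"
  proof (rule path_eqI)
    show "qcomp ?c (tp ?l (?k + ?l)) \<in> paths Q" using qcomp_paths[OF c(2) s(2)] c(4) by simp
    have "pstart (tp ?l (?k + ?l)) = ?k" by (simp add: pstart_def tp_def)
    moreover have "vmap ?c ?k = pstart q" using e by (simp add: pconcat_def pend_def)
    ultimately show "pstart (qcomp ?c (tp ?l (?k + ?l))) = pstart q"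
      using pstart_qcomp(1)[OF s(2)] by simp
    show "arrow_list (qcomp ?c (tp ?l (?k + ?l))) = arrow_list q"
      unfolding arrow_list_qcomp[OF s(2)] arrow_list_sp_tp(2)[OF le_add2]
      by (rule nth_equalityI) (simp_all add: arrow_list_def am')
  qed (rule q)
qed

text \<open>The chosen elements are used only through \<open>id_rel\<close> and
  \<open>comp_rel\<close>. The latter takes its arguments in the order of the arrows, hence
  \<open>f\<close> before \<open>g\<close>.\<close>

definition model_cat :: "'m fo_struct \<Rightarrow> ('m, 'm) category" where
  "model_cat M = \<lparr>Ob = carr M (PQ 0), Mor = carr M (PQ 1), Dom = restr M (sp 0 1), Cod = restr M (tp 0 1),
     Ide = (\<lambda>x. SOME y. y \<in> carr M (PQ 1) \<and> id_rel M x y),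
     Comp = (\<lambda>g f. SOME h. h \<in> carr M (PQ 1) \<and> comp_rel M f g h)\<rparr>"

definition model_family :: "'m fo_struct \<Rightarrow> quiver \<Rightarrow> 'm \<Rightarrow> ('m, 'm) family" where
  "model_family M Q x = (restrict (\<lambda>v. restr M (vertex_path Q v) x) (verts Q),
     restrict (\<lambda>a. restr M (arrow_path Q a) x) (arrs Q))"

text \<open>The category of a model depends on \<open>T_cat\<close> alone; the abelian axioms are
  read off afterwards, by transfer along the isomorphism built here.\<close>

locale T_cat_model =
  fixes M :: "'m fo_struct"
  assumes T_cat_model: "model_of M T_cat"
begin

section \<open>The axioms as rules about a model\<close>

lemma T_cat_sat: "\<phi> \<in> T_cat \<Longrightarrow> sat M e \<phi>"
  using T_cat_model by (simp add: model_of_def)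

lemma restr_in: "acyclic_emb m \<Longrightarrow> x \<in> carr M (qcod m) \<Longrightarrow> restr M m x \<in> carr M (qdom m)"
  using T_cat_model by (auto simp: model_of_def is_structure_def)

lemma restr_restr:
  assumes "acyclic_emb m" "acyclic_emb m'" "qcod m = qdom m'" "x \<in> carr M (qcod m')"
  shows "restr M m (restr M m' x) = restr M (qcomp m' m) x"
proof -
  have "RestrComp m m' \<in> T_cat" unfolding T_cat_def using assms by blast
  from T_cat_sat[OF this] assms(4) show ?thesis by (simp add: RestrComp_def)
qed

lemma pushout_unique:
  assumes "pushout_config m1 m2 m1' m2'" "x1 \<in> carr M (qcod m1)" "x2 \<in> carr M (qcod m2)"
    "restr M m1 x1 = restr M m2 x2"
  shows "\<exists>!x. x \<in> carr M (qcod m1') \<and> restr M m1' x = x1 \<and> restr M m2' x = x2"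
proof -
  have "PushoutEU m1 m2 m1' m2' \<in> T_cat" unfolding T_cat_def using assms by blast
  from T_cat_sat[OF this] assms(2-4) show ?thesis by (simp add: PushoutEU_def Cospan_fm_def numeral_2_eq_2)
qed

lemma empty_unique: "\<exists>!x. x \<in> carr M empty_quiver"
proof -
  have "EmptyEU \<in> T_cat" unfolding T_cat_def by blast
  from T_cat_sat[OF this] show ?thesis by (simp add: EmptyEU_def)
qed

lemma comp_ex:
  assumes "x \<in> carr M (PQ 1)" "y \<in> carr M (PQ 1)" "restr M (tp 0 1) x = restr M (sp 0 1) y"
  shows "\<exists>z\<in>carr M (PQ 1). comp_rel M x y z"
proof -
  have "CompE \<in> T_cat" unfolding T_cat_def by blast
  from T_cat_sat[OF this] assms show ?thesis by (simp add: CompE_def sat_defined numeral_2_eq_2)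
qed

lemma id_ex:
  assumes "x \<in> carr M (PQ 0)"
  shows "\<exists>y\<in>carr M (PQ 1). id_rel M x y"
proof -
  have "IdE \<in> T_cat" unfolding T_cat_def by blast
  from T_cat_sat[OF this] assms show ?thesis by (simp add: IdE_def sat_Id_fm)
qed

lemma eq_rel_refl:
  assumes "x \<in> carr M (PQ k)"
  shows "eq_rel M k k x x"
proof -
  have "EqPathRefl k \<in> T_cat" unfolding T_cat_def by blast
  from T_cat_sat[OF this] assms show ?thesis by (simp add: EqPathRefl_def sat_EqPath)
qed

lemma eq_rel_sym:
  assumes "x \<in> carr M (PQ k)" "y \<in> carr M (PQ l)" "eq_rel M k l x y"
  shows "eq_rel M l k y x"
proof -
  have "EqPathSym k l \<in> T_cat" unfolding T_cat_def by blast
  from T_cat_sat[OF this] assms show ?thesis by (simp add: EqPathSym_def sat_EqPath)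
qed

lemma eq_rel_trans:
  assumes "x \<in> carr M (PQ k)" "y \<in> carr M (PQ l)" "z \<in> carr M (PQ n)" "eq_rel M k l x y" "eq_rel M l n y z"
  shows "eq_rel M k n x z"
proof -
  have "EqPathTrans k l n \<in> T_cat" unfolding T_cat_def by blast
  from T_cat_sat[OF this, of "\<lambda>_. undefined"]
  have "\<forall>x\<in>carr M (PQ k). \<forall>y\<in>carr M (PQ l). \<forall>z\<in>carr M (PQ n).
      eq_rel M k l x y \<and> eq_rel M l n y z \<longrightarrow> eq_rel M k n x z"
    by (simp add: EqPathTrans_def sat_EqPath numeral_2_eq_2)
  then show ?thesis using assms by blast
qed

lemma eq_rel_concat:
  assumes "z1 \<in> carr M (PQ (k1 + l1))" "z2 \<in> carr M (PQ (k2 + l2))"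
    and "eq_rel M k1 k2 (restr M (sp k1 (k1 + l1)) z1) (restr M (sp k2 (k2 + l2)) z2)"
    and "eq_rel M l1 l2 (restr M (tp l1 (k1 + l1)) z1) (restr M (tp l2 (k2 + l2)) z2)"
  shows "eq_rel M (k1 + l1) (k2 + l2) z1 z2"
proof -
  have in1: "restr M (sp k (k + l)) z \<in> carr M (PQ k)" "restr M (tp l (k + l)) z \<in> carr M (PQ l)"
    if "z \<in> carr M (PQ (k + l))" for k l z
    using restr_in[of "sp k (k + l)" z] restr_in[of "tp l (k + l)" z] sptp_emb[of k "k + l"] sptp_emb[of l "k + l"] that
    by auto
  note cfg = pushout_configD[OF pushout_config_concat[of k1 l1]]
  have e: "restr M (tp 0 k1) (restr M (sp k1 (k1 + l1)) z1) = restr M (sp 0 l1) (restr M (tp l1 (k1 + l1)) z1)"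
    using restr_restr[of "tp 0 k1" "sp k1 (k1 + l1)" z1] restr_restr[of "sp 0 l1" "tp l1 (k1 + l1)" z1]
      cfg(1-4,9) assms(1) by simp
  have "EqPathConcat k1 k2 l1 l2 \<in> T_cat" unfolding T_cat_def by blast
  from T_cat_sat[OF this, of "\<lambda>_. undefined"]
  have "\<forall>x1\<in>carr M (PQ k1). \<forall>x2\<in>carr M (PQ k2). \<forall>y1\<in>carr M (PQ l1). \<forall>y2\<in>carr M (PQ l2).
      eq_rel M k1 k2 x1 x2 \<and> eq_rel M l1 l2 y1 y2 \<and> restr M (tp 0 k1) x1 = restr M (sp 0 l1) y1 \<longrightarrow>
      (\<forall>z1\<in>carr M (PQ (k1 + l1)). \<forall>z2\<in>carr M (PQ (k2 + l2)).
        (restr M (sp k1 (k1 + l1)) z1 = x1 \<and> restr M (tp l1 (k1 + l1)) z1 = y1) \<and>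
        (restr M (sp k2 (k2 + l2)) z2 = x2 \<and> restr M (tp l2 (k2 + l2)) z2 = y2) \<longrightarrow>
        eq_rel M (k1 + l1) (k2 + l2) z1 z2)"
    by (simp add: EqPathConcat_def sat_EqPath Cospan_fm_def eval_nat_numeral)
  from this[rule_format, OF in1(1)[OF assms(1)] in1(1)[OF assms(2)] in1(2)[OF assms(1)] in1(2)[OF assms(2)]]
  show ?thesis using assms e by simp
qed

lemma commute_C2:
  assumes "x \<in> carr M C2" "x \<in> commute M C2"
  shows "restr M (arrow_path C2 0) x = restr M (arrow_path C2 1) x"
proof -
  have "ComEq \<in> T_cat" unfolding T_cat_def by blast
  from T_cat_sat[OF this] assms show ?thesis by (simp add: ComEq_def)
qed

lemma commute_iff:
  assumes Q: "acyclic_quiver Q" and x: "x \<in> carr M Q"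
  shows "x \<in> commute M Q \<longleftrightarrow> (\<forall>(p, q)\<in>BP Q. eq_rel M (plen p) (plen q) (restr M p x) (restr M q x))"
proof -
  have "PathCom Q \<in> T_cat" unfolding T_cat_def using Q by blast
  from T_cat_sat[OF this, of "\<lambda>_. undefined"] x show ?thesis
    by (simp add: PathCom_def sat_conj_over[OF finite_BP[OF Q]] case_prod_beta sat_EqPath)
qed

text \<open>Restriction along an identity is idempotent by functoriality and injective by the uniqueness of
  pushouts; the axioms do not state that it is the identity.\<close>

lemma restr_identity:
  assumes m: "acyclic_emb m" "qdom m = qcod m" "qcomp m m = m"
    and "vmap m ` verts (qcod m) = verts (qcod m)" "amap m ` arrs (qcod m) = arrs (qcod m)"
    and x: "x \<in> carr M (qcod m)"
  shows "restr M m x = x"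
proof -
  have cfg: "pushout_config m m m m" using assms by (simp add: pushout_config_def)
  have i: "restr M m x \<in> carr M (qcod m)" using restr_in[OF m(1) x] m(2) by simp
  have "restr M m (restr M m x) = restr M m x" using restr_restr[OF m(1) m(1) _ x] m(2,3) by simp
  from pushout_unique[OF cfg i x this] show ?thesis by metis
qed

lemma restr_vertex_PQ0: "x \<in> carr M (PQ 0) \<Longrightarrow> restr M (vertex_path (PQ 0) 0) x = x"
  by (rule restr_identity)
    (auto simp: vertex_path_emb acyclic_named, auto simp: vertex_path_def qcomp_def compose_def fun_eq_iff)

lemma restr_arrow_PQ1: "x \<in> carr M (PQ 1) \<Longrightarrow> restr M (arrow_path (PQ 1) 0) x = x"
proof (rule restr_identity)
  show "qcomp (arrow_path (PQ 1) 0) (arrow_path (PQ 1) 0) = arrow_path (PQ 1) 0"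
    using qcomp_vertex_arrow(2)[of "arrow_path (PQ 1) 0" 0] arrow_path_emb[OF acyclic_named(1), of 0 1]
    by (auto simp: acyclic_embD) (simp add: arrow_path_def)
  have "vmap (arrow_path (PQ 1) 0) ` {0, 1} = {0, 1}" by (auto simp: arrow_path_def)
  moreover have "{0..1} = {0, 1 :: nat}" by auto
  ultimately show "vmap (arrow_path (PQ 1) 0) ` verts (qcod (arrow_path (PQ 1) 0)) = verts (qcod (arrow_path (PQ 1) 0))"
    by simp
qed (auto simp: arrow_path_emb acyclic_named, auto simp: arrow_path_def)

section \<open>Elements of the model as families\<close>

abbreviation (input) "C \<equiv> model_cat M"

lemma model_cat_simps: "Ob C = carr M (PQ 0)" "Mor C = carr M (PQ 1)" "Dom C = restr M (sp 0 1)"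
  "Cod C = restr M (tp 0 1)"
  by (simp_all add: model_cat_def)

lemma model_family_in:
  assumes Q: "acyclic_quiver Q" and x: "x \<in> carr M Q"
  shows "model_family M Q x \<in> families C Q"
  unfolding model_family_def
proof (rule familiesI)
  note q = acyclic_is_quiver[OF Q]
  fix a assume a: "a \<in> arrs Q"
  note e = arrow_path_emb[OF Q a]
  show "Dom C (restr M (arrow_path Q a) x) = restr M (vertex_path Q (src Q a)) x"
    "Cod C (restr M (arrow_path Q a) x) = restr M (vertex_path Q (tgt Q a)) x"
    using restr_restr[of "sp 0 1" "arrow_path Q a" x] restr_restr[of "tp 0 1" "arrow_path Q a" x]
      sptp_emb[of 0 1] e x qcomp_arrow_sp_tp[OF a q] by (simp_all add: model_cat_simps)
  show "restr M (arrow_path Q a) x \<in> Mor C" using restr_in[OF e] x by (simp add: model_cat_simps)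
next
  fix v assume v: "v \<in> verts Q"
  show "restr M (vertex_path Q v) x \<in> Ob C"
    using restr_in[OF vertex_path_emb[OF Q v]] x by (simp add: model_cat_simps)
qed (rule acyclic_is_quiver[OF Q])

lemma model_family_restr:
  assumes m: "acyclic_emb m" and x: "x \<in> carr M (qcod m)"
  shows "model_family M (qdom m) (restr M m x) = fam_pull m (model_family M (qcod m) x)"
proof -
  note a = acyclic_embD[OF m]
  have "restr M (vertex_path (qdom m) v) (restr M m x) = restr M (vertex_path (qcod m) (vmap m v)) x"
    if "v \<in> verts (qdom m)" for v
    using restr_restr[OF vertex_path_emb[OF a(2) that] m _ x] qcomp_vertex_arrow(1)[OF that] by simp
  moreover have "restr M (arrow_path (qdom m) b) (restr M m x) = restr M (arrow_path (qcod m) (amap m b)) x"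
    if "b \<in> arrs (qdom m)" for b
    using restr_restr[OF arrow_path_emb[OF a(2) that] m _ x] qcomp_vertex_arrow(2)[OF a(1) that] by simp
  ultimately show ?thesis
    using qmorD(3,4)[OF a(1)] by (auto simp: model_family_def fam_pull_def compose_def fun_eq_iff)
qed

text \<open>Both the model and the families turn the configuration into a pullback of sets, and
  \<open>model_family\<close> is natural. Bijectivity on the two pieces yields preimages
  \<open>x1\<close> and \<open>x2\<close>; injectivity on the common part shows that these agree
  there, so that they glue.\<close>

lemma model_family_pushout:
  assumes cfg: "pushout_config m1 m2 m1' m2'"
    and inj: "inj_on (model_family M (qdom m1)) (carr M (qdom m1))"
    and b1: "bij_betw (model_family M (qcod m1)) (carr M (qcod m1)) (families C (qcod m1))"
    and b2: "bij_betw (model_family M (qcod m2)) (carr M (qcod m2)) (families C (qcod m2))"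
  shows "bij_betw (model_family M (qcod m1')) (carr M (qcod m1')) (families C (qcod m1'))"
proof -
  note p = pushout_configD[OF cfg]
  note ac = acyclic_embD(3)[OF p(3)]
  have com: "restr M m1 (restr M m1' x) = restr M m2 (restr M m2' x)" if "x \<in> carr M (qcod m1')" for x
    using restr_restr[OF p(1,3,6)] restr_restr[OF p(2,4,7)] p(8,9) that by simp
  have in1: "restr M m1' x \<in> carr M (qcod m1)" and in2: "restr M m2' x \<in> carr M (qcod m2)"
    if "x \<in> carr M (qcod m1')" for x
    using restr_in[OF p(3)] restr_in[OF p(4)] p(6-8) that by simp_all
  have nat: "model_family M (qcod m1) (restr M m1' x) = fam_pull m1' (model_family M (qcod m1') x)"
    "model_family M (qcod m2) (restr M m2' x) = fam_pull m2' (model_family M (qcod m1') x)"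
    if "x \<in> carr M (qcod m1')" for x
    using model_family_restr[OF p(3)] model_family_restr[OF p(4)] p(6-8) that by simp_all
  have "x = y" if x: "x \<in> carr M (qcod m1')" and y: "y \<in> carr M (qcod m1')"
    and e: "model_family M (qcod m1') x = model_family M (qcod m1') y" for x y
  proof -
    have "restr M m1' x = restr M m1' y"
      by (rule inj_onD[OF bij_betw_imp_inj_on[OF b1] _ in1[OF x] in1[OF y]])
        (simp add: nat(1)[OF x] nat(1)[OF y] e)
    moreover have "restr M m2' x = restr M m2' y"
      by (rule inj_onD[OF bij_betw_imp_inj_on[OF b2] _ in2[OF x] in2[OF y]])
        (simp add: nat(2)[OF x] nat(2)[OF y] e)
    ultimately show ?thesis using pushout_unique[OF cfg in1[OF x] in2[OF x] com[OF x]] x y by metis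
  qed
  then have "inj_on (model_family M (qcod m1')) (carr M (qcod m1'))" by (rule inj_onI)
  moreover have "y \<in> model_family M (qcod m1') ` carr M (qcod m1')" if y: "y \<in> families C (qcod m1')" for y
  proof -
    have y1: "fam_pull m1' y \<in> families C (qcod m1)" and y2: "fam_pull m2' y \<in> families C (qcod m2)"
      using fam_pull_families[of m1' y C] fam_pull_families[of m2' y C] p y by (auto simp: acyclic_embD)
    obtain x1 where x1: "x1 \<in> carr M (qcod m1)" "model_family M (qcod m1) x1 = fam_pull m1' y"
      using bij_betw_imp_surj_on[OF b1] y1 by (metis imageE)
    obtain x2 where x2: "x2 \<in> carr M (qcod m2)" "model_family M (qcod m2) x2 = fam_pull m2' y"
      using bij_betw_imp_surj_on[OF b2] y2 by (metis imageE)
    have "model_family M (qdom m1) (restr M m1 x1) = fam_pull (qcomp m1' m1) y"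
      using model_family_restr[OF p(1) x1(1)] x1(2) fam_pull_qcomp[OF acyclic_embD(1)[OF p(1)] p(6)] by simp
    moreover have "model_family M (qdom m1) (restr M m2 x2) = fam_pull (qcomp m1' m1) y"
      using model_family_restr[OF p(2) x2(1)] x2(2) fam_pull_qcomp[OF acyclic_embD(1)[OF p(2)] p(7)] p(5,9) by simp
    ultimately have "restr M m1 x1 = restr M m2 x2"
      using restr_in[OF p(1) x1(1)] restr_in[OF p(2) x2(1)] p(5) by - (rule inj_onD[OF inj], simp_all)
    from pushout_unique[OF cfg x1(1) x2(1) this]
    obtain x where x: "x \<in> carr M (qcod m1')" "restr M m1' x = x1" "restr M m2' x = x2" by blast
    have "model_family M (qcod m1') x = y"
      by (rule families_jointly_determined[OF cfg model_family_in[OF ac x(1)] y])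
        (use nat[OF x(1)] x(2,3) x1(2) x2(2) in auto)
    then show ?thesis using x(1) by blast
  qed
  ultimately show ?thesis
    unfolding bij_betw_def using model_family_in[OF ac] by blast
qed

lemma model_family_bij_PQ0: "bij_betw (model_family M (PQ 0)) (carr M (PQ 0)) (families C (PQ 0))"
proof -
  have f: "fst (model_family M (PQ 0) x) 0 = x" if "x \<in> carr M (PQ 0)" for x
    using restr_vertex_PQ0[OF that] by (simp add: model_family_def)
  have "y \<in> model_family M (PQ 0) ` carr M (PQ 0)" if y: "y \<in> families C (PQ 0)" for y
  proof -
    have x: "fst y 0 \<in> carr M (PQ 0)" using familiesD(1)[OF y, of 0] by (simp add: model_cat_simps)
    have "model_family M (PQ 0) (fst y 0) = y"
      by (rule families_eqI[OF model_family_in[OF acyclic_named(1) x] y]) (use f[OF x] in auto)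
    then show ?thesis by (rule image_eqI[OF sym x])
  qed
  moreover have "inj_on (model_family M (PQ 0)) (carr M (PQ 0))" by (rule inj_onI) (metis f)
  ultimately show ?thesis unfolding bij_betw_def using model_family_in[OF acyclic_named(1)] by blast
qed

lemma model_family_PQ1: "x \<in> carr M (PQ 1) \<Longrightarrow> snd (model_family M (PQ 1) x) 0 = x"
  using restr_arrow_PQ1[of x] by (simp add: model_family_def)

lemma model_family_bij_PQ1: "bij_betw (model_family M (PQ 1)) (carr M (PQ 1)) (families C (PQ 1))"
proof -
  note f = model_family_PQ1
  have "y \<in> model_family M (PQ 1) ` carr M (PQ 1)" if y: "y \<in> families C (PQ 1)" for y
  proof -
    have x: "snd y 0 \<in> carr M (PQ 1)" using familiesD(2)[OF y, of 0] by (simp add: model_cat_simps)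
    have "model_family M (PQ 1) (snd y 0) = y"
      by (rule PQ1_eqI[OF model_family_in[OF acyclic_named(1) x] y]) (rule f[OF x])
    then show ?thesis by (rule image_eqI[OF sym x])
  qed
  moreover have "inj_on (model_family M (PQ 1)) (carr M (PQ 1))" by (rule inj_onI) (metis f)
  ultimately show ?thesis unfolding bij_betw_def using model_family_in[OF acyclic_named(1)] by blast
qed

text \<open>Followed by the inclusion, a path of the subquiver becomes a path of \<open>Q\<close>,
  hence an embedding; so it was one already.\<close>

lemma subq_acyclic:
  assumes Q: "acyclic_quiver Q" and "V \<subseteq> verts Q" "A \<subseteq> arrs Q" "src Q ` A \<subseteq> V" "tgt Q ` A \<subseteq> V"
  shows "acyclic_emb (subq_incl Q V A)"
proof -
  have q: "is_quiver (subq Q V A)" "is_quiver Q"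
    using assms acyclic_is_quiver[OF Q] finite_subset unfolding is_quiver_def by (auto simp: subq_def)
  have m: "embedding (subq_incl Q V A)"
    unfolding embedding_def is_qmor_def using assms q by (auto simp: subq_incl_def inj_on_def) (auto simp: subq_def)
  have "embedding p" if p: "p \<in> paths (subq Q V A)" for p
  proof -
    have "qcomp (subq_incl Q V A) p \<in> paths Q"
      using qcomp_paths[of "subq_incl Q V A" p] m p by (auto simp: embedding_def)
    then have e: "embedding (qcomp (subq_incl Q V A) p)" using Q by (auto simp: acyclic_quiver_def)
    have "inj_on (vmap p) (verts (qdom p))" "inj_on (amap p) (arrs (qdom p))"
      using e unfolding embedding_def by (auto simp: inj_on_def qcomp_def compose_def)
    then show ?thesis using p by (simp add: embedding_def paths_def)
  qed
  then show ?thesis using m q Q by (simp add: acyclic_emb_def acyclic_quiver_def)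
qed

text \<open>A vertex is attached along the empty quiver, over which injectivity is the uniqueness in
  \<open>EmptyEU\<close>; existence and uniqueness together settle the base case.\<close>

lemma model_family_bij_discrete:
  "acyclic_quiver Q \<Longrightarrow> arrs Q = {} \<Longrightarrow> bij_betw (model_family M Q) (carr M Q) (families C Q)"
proof (induction "card (verts Q)" arbitrary: Q)
  case 0
  then have "verts Q = {}" using acyclic_is_quiver[of Q] by (simp add: is_quiver_def)
  then have Q: "Q = empty_quiver"
    using acyclic_is_quiver[OF 0(2)] 0(3) by (simp add: empty_quiver_def is_quiver_def)
  obtain x where x: "carr M Q = {x}" using empty_unique Q by auto
  have in1: "model_family M Q x \<in> families C Q" by (rule model_family_in[OF 0(2)]) (simp add: x)
  have "y = model_family M Q x" if "y \<in> families C Q" for y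
    by (rule families_eqI[OF that in1]) (simp_all add: \<open>verts Q = {}\<close> 0(3))
  with in1 have "families C Q = {model_family M Q x}" by blast
  then show ?case using x by (simp add: bij_betw_def)
next
  case (Suc n)
  then obtain v where v: "v \<in> verts Q" by (metis card_eq_0_iff ex_in_conv old.nat.distinct(2))
  let ?V = "verts Q - {v}"
  let ?R = "subq Q ?V {}"
  have sub: "acyclic_emb (subq_incl Q ?V {})" by (rule subq_acyclic[OF Suc(3)]) auto
  then have R: "acyclic_quiver ?R" by (simp add: acyclic_emb_def)
  have "n = card (verts ?R)" using v Suc(2) acyclic_is_quiver[OF Suc(3)] by (simp add: subq_def is_quiver_def)
  then have b1: "bij_betw (model_family M ?R) (carr M ?R) (families C ?R)"
    by (rule Suc(1)) (use R in \<open>auto simp: subq_def\<close>)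
  \<comment> \<open>The unique morphism out of the empty quiver.\<close>
  define ini where "ini P = \<lparr>qdom = empty_quiver, qcod = P, vmap = (\<lambda>_. undefined), amap = (\<lambda>_. undefined)\<rparr>" for P
  have ini: "acyclic_emb (ini P)" if "acyclic_quiver P" for P
    using that acyclic_named(5) acyclic_is_quiver[OF that] acyclic_is_quiver[OF acyclic_named(5)]
    by (simp add: acyclic_emb_def embedding_def is_qmor_def ini_def) (simp add: empty_quiver_def)
  have e: "qcomp m (ini P) = ini (qcod m)" for m P
    by (simp add: qcomp_def ini_def empty_quiver_def compose_def restrict_def)
  have ie: "vmap (ini P) ` verts empty_quiver = {}" "amap (ini P) ` arrs empty_quiver = {}" for P
    by (simp_all add: empty_quiver_def)
  have d: "qdom (ini P) = empty_quiver" "qcod (ini P) = P" for P by (simp_all add: ini_def)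
  have im: "vmap (subq_incl Q ?V {}) ` verts ?R = ?V" "amap (subq_incl Q ?V {}) ` arrs ?R = {}"
    "vmap (vertex_path Q v) 0 = v"
    by (auto simp: subq_incl_def subq_def vertex_path_def)
  have cfg: "pushout_config (ini ?R) (ini (PQ 0)) (subq_incl Q ?V {}) (vertex_path Q v)"
    unfolding pushout_config_def using v Suc(4)
    by (auto simp: e d ie im ini R acyclic_named vertex_path_emb[OF Suc(3)] sub)
  show ?case
  proof -
    have "inj_on (model_family M empty_quiver) (carr M empty_quiver)" using empty_unique by (auto simp: inj_on_def)
    from model_family_pushout[OF cfg, unfolded d, OF this b1 model_family_bij_PQ0] show ?thesis by simp
  qed
qed

text \<open>The discrete case is used twice: as the base of the induction, and for injectivity over
  \<open>D2\<close>, the two ends along which an arrow is attached.\<close>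

lemma model_family_bij:
  "acyclic_quiver Q \<Longrightarrow> bij_betw (model_family M Q) (carr M Q) (families C Q)"
proof (induction "card (arrs Q)" arbitrary: Q)
  case 0
  then have "arrs Q = {}" using acyclic_is_quiver[of Q] by (simp add: is_quiver_def)
  then show ?case using 0 model_family_bij_discrete by blast
next
  case (Suc n)
  then obtain a where a: "a \<in> arrs Q" by (metis card_eq_0_iff ex_in_conv old.nat.distinct(2))
  note q = acyclic_is_quiver[OF Suc(3)]
  let ?A = "arrs Q - {a}"
  let ?R = "subq Q (verts Q) ?A"
  have sub: "acyclic_emb (subq_incl Q (verts Q) ?A)"
    by (rule subq_acyclic[OF Suc(3)]) (use q in \<open>auto simp: src_in tgt_in\<close>)
  then have R: "acyclic_quiver ?R" by (simp add: acyclic_emb_def)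
  have "n = card (arrs ?R)" using a Suc(2) q by (simp add: subq_def is_quiver_def)
  then have b1: "bij_betw (model_family M ?R) (carr M ?R) (families C ?R)"
    by (rule Suc(1)) (rule R)
  note ae = arrow_path_emb[OF Suc(3) a]
  \<comment> \<open>Acyclicity excludes loops, so that the ends of \<open>a\<close> form an embedded
    copy of \<open>D2\<close>.\<close>
  have ne: "src Q a \<noteq> tgt Q a"
    using inj_onD[OF acyclic_embD(4)[OF ae], of 0 1] by (auto simp: arrow_path_def)
  define ends where "ends = \<lparr>qdom = D2, qcod = ?R,
    vmap = (\<lambda>i\<in>{0, 1}. if i = 0 then src Q a else tgt Q a), amap = (\<lambda>_. undefined)\<rparr>"
  have d: "qdom ends = D2" "qcod ends = ?R" by (simp_all add: ends_def)
  have ends: "acyclic_emb ends"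
    using R acyclic_named(3) acyclic_is_quiver[OF R] acyclic_is_quiver[OF acyclic_named(3)] ne src_in[OF q a] tgt_in[OF q a]
    by (simp add: acyclic_emb_def embedding_def is_qmor_def d) (auto simp: ends_def D2_def subq_def inj_on_def)
  have im: "vmap (subq_incl Q (verts Q) ?A) ` verts ?R = verts Q" "amap (subq_incl Q (verts Q) ?A) ` arrs ?R = ?A"
    "vmap (arrow_path Q a) ` verts (PQ 1) = {src Q a, tgt Q a}" "amap (arrow_path Q a) ` arrs (PQ 1) = {a}"
    by (auto simp: subq_incl_def subq_def arrow_path_def image_iff)
  have e: "qcomp (subq_incl Q (verts Q) ?A) ends = qcomp (arrow_path Q a) (st 1)"
    using src_in[OF q a] tgt_in[OF q a]
    by (auto simp: qcomp_def subq_incl_def ends_def arrow_path_def st_def compose_def D2_def fun_eq_iff)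
  have "vmap (qcomp (subq_incl Q (verts Q) ?A) ends) ` verts D2 = {src Q a, tgt Q a}"
    "amap (qcomp (subq_incl Q (verts Q) ?A) ends) ` arrs D2 = {}"
    using src_in[OF q a] tgt_in[OF q a]
    by (auto simp: qcomp_def subq_incl_def ends_def compose_def D2_def image_iff)
  then have cfg: "pushout_config ends (st 1) (subq_incl Q (verts Q) ?A) (arrow_path Q a)"
    unfolding pushout_config_def qmor_dom_cod d im
    using a sub ae ends e pushout_configD(1)[OF pushout_config_bipath[of 1 1]] src_in[OF q a] tgt_in[OF q a]
    by (simp add: d) auto
  have "inj_on (model_family M D2) (carr M D2)"
    using model_family_bij_discrete[OF acyclic_named(3)] by (simp add: D2_def bij_betw_def)
  from model_family_pushout[OF cfg, unfolded d qmor_dom_cod, OF this b1 model_family_bij_PQ1] show ?case .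
qed

section \<open>Composition in the model\<close>

lemma restr_sp_tp_in:
  assumes "x \<in> carr M (PQ l)" "k \<le> l"
  shows "restr M (sp k l) x \<in> carr M (PQ k)" "restr M (tp k l) x \<in> carr M (PQ k)"
  using restr_in[of "sp k l" x] restr_in[of "tp k l" x] sptp_emb[OF assms(2)] assms(1) by auto

lemma concat_ex:
  assumes "x \<in> carr M (PQ k)" "y \<in> carr M (PQ l)" "restr M (tp 0 k) x = restr M (sp 0 l) y"
  shows "\<exists>z\<in>carr M (PQ (k + l)). restr M (sp k (k + l)) z = x \<and> restr M (tp l (k + l)) z = y"
  using pushout_unique[OF pushout_config_concat, of x k y l] assms by auto

lemma arrow_of_restr:
  assumes x: "x \<in> carr M (PQ l)" and "k \<le> l" "i < k"
  shows "snd (model_family M (PQ k) (restr M (sp k l) x)) i = snd (model_family M (PQ l) x) i"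
    "snd (model_family M (PQ k) (restr M (tp k l) x)) i = snd (model_family M (PQ l) x) (i + l - k)"
  using model_family_restr[OF sptp_emb(1)[OF assms(2)], of x] model_family_restr[OF sptp_emb(2)[OF assms(2)], of x] assms
  by (simp_all, simp_all add: sp_def tp_def)

text \<open>The source of all uniqueness: related arrows have the same ends, so they glue to an
  element of sort \<open>C2\<close>; this element commutes by the definition of
  \<open>EqPath\<close>, and then \<open>ComEq\<close> identifies its two arrows.\<close>

lemma eq_rel_one:
  assumes x: "x \<in> carr M (PQ 1)" and y: "y \<in> carr M (PQ 1)" and e: "eq_rel M 1 1 x y"
  shows "x = y"
proof -
  have p: "eq_pos_rel M 1 1 x y" using e by (simp add: eq_rel_def)
  then have "restr M (st 1) x = restr M (st 1) y" by (simp add: eq_pos_rel_def)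
  from pushout_unique[OF pushout_config_bipath[of 1 1], unfolded qmor_dom_cod, OF _ _ x y this]
  obtain w where w: "w \<in> carr M C2" "restr M (bipath1 1 1) w = x" "restr M (bipath2 1 1) w = y"
    by (auto simp: C2_eq_bipath)
  have "bipath1 1 1 = arrow_path C2 0" "bipath2 1 1 = arrow_path C2 1"
    unfolding C2_eq_bipath
    by (auto simp: bipath1_def bipath2_def arrow_path_def fun_eq_iff, auto simp: bipath_def bipath_vert_def)
  then show ?thesis using commute_C2[OF w(1)] p w unfolding eq_pos_rel_def C2_eq_bipath[symmetric] by metis
qed

text \<open>In a commuting triangle the path along two edges is parallel to the third edge, so
  \<open>PathCom\<close> relates them. By uniqueness of gluing, that path restricts to
  \<open>p\<close>.\<close>

lemma comp_rel_eq:
  assumes "comp_rel M x y z"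
    and p: "p \<in> carr M (PQ 2)" "restr M (sp 1 2) p = x" "restr M (tp 1 2) p = y"
  shows "eq_rel M 2 1 p z" "restr M (sp 0 1) z = restr M (sp 0 1) x" "restr M (tp 0 1) z = restr M (tp 0 1) y"
proof -
  let ?a = "arrow_path Tri 0" and ?b = "arrow_path Tri 2" and ?c = "arrow_path Tri 1"
  obtain w where w: "w \<in> carr M Tri" "restr M ?a w = x" "restr M ?b w = y" "restr M ?c w = z" "w \<in> commute M Tri"
    using assms(1) by (auto simp: comp_rel_def)
  note q = is_quiver_named(2)
  have A: "?a \<in> paths Tri" "?b \<in> paths Tri" "?c \<in> paths Tri"
    using arrow_path_paths[OF q] by (simp_all add: Tri_def)
  have ab: "pend ?a = pstart ?b" "pstart ?a = pstart ?c" "pend ?b = pend ?c"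
    unfolding pstart_simps by (simp_all add: Tri_def)
  let ?p = "pconcat ?a ?b"
  note P = pconcat_paths[OF q A(1,2) ab(1)] qcomp_pconcat[OF q A(1,2) ab(1)]
  have len: "plen ?p = 2" "plen ?c = 1" "plen ?a = 1" "plen ?b = 1" by (simp_all add: plen_simps)
  have "(?p, ?c) \<in> BP Tri" using P(1,2) A ab by (simp add: BP_def pstart_pconcat)
  then have e: "eq_rel M 2 1 (restr M ?p w) z" using commute_iff[OF acyclic_named(2) w(1)] w(4,5) len by auto
  have pe: "acyclic_emb ?p" "qdom ?p = PQ 2" "qcod ?p = Tri"
    using path_emb[OF acyclic_named(2) P(1)] path_data[OF P(1)] len by auto
  have in2: "restr M ?p w \<in> carr M (PQ 2)" using restr_in[OF pe(1)] pe w(1) by simp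
  have r: "restr M (sp 1 2) (restr M ?p w) = x" "restr M (tp 1 2) (restr M ?p w) = y"
    using restr_restr[OF sptp_emb(1)[of 1 2] pe(1)] restr_restr[OF sptp_emb(2)[of 1 2] pe(1)] pe P(3,4) w len
    by (simp_all add: numeral_2_eq_2)
  have "restr M ?p w = p"
    using pushout_unique[OF pushout_config_concat[of 1 1], of x y] in2 p r restr_restr[of "tp 0 1" "sp 1 2" p]
      restr_restr[of "sp 0 1" "tp 1 2" p] pushout_configD(1-4,9)[OF pushout_config_concat[of 1 1]]
      restr_sp_tp_in[OF p(1), of 1]
    by (auto simp: numeral_2_eq_2)
  then show "eq_rel M 2 1 p z" using e by simp
  have emb: "acyclic_emb ?a" "acyclic_emb ?b" "acyclic_emb ?c" using path_emb[OF acyclic_named(2)] A by auto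
  have s: "restr M (sp 0 1) (restr M (arrow_path Tri i) w) = restr M (vertex_path Tri (src Tri i)) w"
    "restr M (tp 0 1) (restr M (arrow_path Tri i) w) = restr M (vertex_path Tri (tgt Tri i)) w"
    if "i \<in> arrs Tri" for i
    using restr_restr[OF sptp_emb(1)[of 0 1] arrow_path_emb[OF acyclic_named(2) that]]
      restr_restr[OF sptp_emb(2)[of 0 1] arrow_path_emb[OF acyclic_named(2) that]]
      qcomp_arrow_sp_tp[OF that q] w(1) by simp_all
  show "restr M (sp 0 1) z = restr M (sp 0 1) x" "restr M (tp 0 1) z = restr M (tp 0 1) y"
    unfolding w(2-4)[symmetric] using s[of 0] s[of 1] s[of 2] by (simp_all add: Tri_def)
qed

lemma model_comp:
  assumes f: "f \<in> carr M (PQ 1)" and g: "g \<in> carr M (PQ 1)" and fg: "restr M (tp 0 1) f = restr M (sp 0 1) g"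
  shows "Comp C g f \<in> carr M (PQ 1)" "comp_rel M f g (Comp C g f)"
    "restr M (sp 0 1) (Comp C g f) = restr M (sp 0 1) f" "restr M (tp 0 1) (Comp C g f) = restr M (tp 0 1) g"
proof -
  have "Comp C g f \<in> carr M (PQ 1) \<and> comp_rel M f g (Comp C g f)"
    unfolding model_cat_def category.select_convs by (rule someI_ex) (use comp_ex[OF assms] in blast)
  then show c: "Comp C g f \<in> carr M (PQ 1)" "comp_rel M f g (Comp C g f)" by auto
  obtain p where p: "p \<in> carr M (PQ 2)" "restr M (sp 1 2) p = f" "restr M (tp 1 2) p = g"
    using concat_ex[OF f g fg] by (auto simp: numeral_2_eq_2)
  show "restr M (sp 0 1) (Comp C g f) = restr M (sp 0 1) f" "restr M (tp 0 1) (Comp C g f) = restr M (tp 0 1) g"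
    using comp_rel_eq(2,3)[OF c(2) p] by auto
qed

lemma model_comp_eq_rel:
  assumes "p \<in> carr M (PQ 2)"
  shows "eq_rel M 2 1 p (Comp C (restr M (tp 1 2) p) (restr M (sp 1 2) p))"
    "restr M (tp 0 1) (restr M (sp 1 2) p) = restr M (sp 0 1) (restr M (tp 1 2) p)"
proof -
  have r: "restr M (sp 1 2) p \<in> carr M (PQ 1)" "restr M (tp 1 2) p \<in> carr M (PQ 1)"
    using restr_sp_tp_in[OF assms, of 1] by auto
  show e: "restr M (tp 0 1) (restr M (sp 1 2) p) = restr M (sp 0 1) (restr M (tp 1 2) p)"
    using restr_restr[of "tp 0 1" "sp 1 2" p] restr_restr[of "sp 0 1" "tp 1 2" p] assms
      pushout_configD(1-4,9)[OF pushout_config_concat[of 1 1]] by (simp add: numeral_2_eq_2)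
  show "eq_rel M 2 1 p (Comp C (restr M (tp 1 2) p) (restr M (sp 1 2) p))"
    by (rule comp_rel_eq(1)[OF model_comp(2)[OF r e] assms refl refl])
qed

text \<open>Let \<open>t\<close> be the path \<open>f, g, h\<close>. For either bracketing,
  \<open>EqPathConcat\<close> relates \<open>t\<close> to a path of length two, by replacing the
  inner pair with its composite and keeping the third arrow by reflexivity. So both triple
  composites are arrows related to \<open>t\<close>, hence to each other, and
  \<open>eq_rel_one\<close> applies.\<close>

lemma model_comp_assoc:
  assumes f: "f \<in> carr M (PQ 1)" and g: "g \<in> carr M (PQ 1)" and h: "h \<in> carr M (PQ 1)"
    and fg: "restr M (tp 0 1) f = restr M (sp 0 1) g" and gh: "restr M (tp 0 1) g = restr M (sp 0 1) h"
  shows "Comp C h (Comp C g f) = Comp C (Comp C h g) f"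
proof -
  note gf' = model_comp[OF f g fg] and hg' = model_comp[OF g h gh]
  have l: "restr M (tp 0 1) (Comp C g f) = restr M (sp 0 1) h" using gf'(4) gh by simp
  have r: "restr M (tp 0 1) f = restr M (sp 0 1) (Comp C h g)" using hg'(3) fg by simp
  obtain q where q: "q \<in> carr M (PQ 2)" "restr M (sp 1 2) q = g" "restr M (tp 1 2) q = h"
    using concat_ex[OF g h gh] by (auto simp: numeral_2_eq_2)
  have "restr M (sp 0 2) q = restr M (sp 0 1) g"
    using restr_restr[OF sptp_emb(1)[of 0 1] sptp_emb(1)[of 1 2], of q] q qcomp_sp_tp(1)[of 0 1 2] by simp
  then obtain t where t: "t \<in> carr M (PQ 3)" "restr M (sp 1 3) t = f" "restr M (tp 2 3) t = q"
    using concat_ex[OF f q(1)] fg by (auto simp: numeral_eq_Suc)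
  \<comment> \<open>The segments of \<open>t\<close> are recognised below by the arrows in their
    families.\<close>
  have arrow: "snd (model_family M (PQ 3) t) 0 = f" "snd (model_family M (PQ 3) t) 1 = g"
    "snd (model_family M (PQ 3) t) 2 = h"
  proof -
    show "snd (model_family M (PQ 3) t) 0 = f"
      using arrow_of_restr(1)[OF t(1), of 1 0] t(2) model_family_PQ1[OF f] by simp
    have "snd (model_family M (PQ 2) q) 0 = g" "snd (model_family M (PQ 2) q) 1 = h"
      using arrow_of_restr(1)[OF q(1), of 1 0] arrow_of_restr(2)[OF q(1), of 1 0] q(2,3)
        model_family_PQ1[OF g] model_family_PQ1[OF h] by simp_all
    then show "snd (model_family M (PQ 3) t) 1 = g" "snd (model_family M (PQ 3) t) 2 = h"
      using arrow_of_restr(2)[OF t(1), of 2 0] arrow_of_restr(2)[OF t(1), of 2 1] t(3) by simp_all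
  qed
  let ?p = "restr M (sp 2 3) t"
  have p: "?p \<in> carr M (PQ 2)" and t3: "restr M (tp 1 3) t \<in> carr M (PQ 1)"
    using restr_sp_tp_in[OF t(1)] by auto
  have ph: "restr M (tp 1 3) t = h"
    using model_family_PQ1[OF t3] arrow_of_restr(2)[OF t(1), of 1 0] arrow(3) by simp
  have "restr M (sp 1 2) ?p = f"
    using model_family_PQ1[OF restr_sp_tp_in(1)[OF p, of 1]] arrow_of_restr(1)[OF p, of 1 0]
      arrow_of_restr(1)[OF t(1), of 2 0] arrow(1) by simp
  moreover have "restr M (tp 1 2) ?p = g"
    using model_family_PQ1[OF restr_sp_tp_in(2)[OF p, of 1]] arrow_of_restr(2)[OF p, of 1 0]
      arrow_of_restr(1)[OF t(1), of 2 1] arrow(2) by simp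
  ultimately have pc: "eq_rel M 2 1 ?p (Comp C g f)" using model_comp_eq_rel(1)[OF p] by simp
  obtain s where s: "s \<in> carr M (PQ 2)" "restr M (sp 1 2) s = Comp C g f" "restr M (tp 1 2) s = h"
    using concat_ex[OF gf'(1) h l] by (auto simp: numeral_2_eq_2)
  have "eq_rel M 3 2 t s"
    using eq_rel_concat[of t 2 1 s 1 1] t(1) s pc eq_rel_refl[OF h] ph by (simp add: numeral_eq_Suc)
  then have 1: "eq_rel M 3 1 t (Comp C h (Comp C g f))"
    using eq_rel_trans[OF t(1) s(1) model_comp(1)[OF gf'(1) h l]] model_comp_eq_rel(1)[OF s(1)] s(2,3) by simp
  obtain s' where s': "s' \<in> carr M (PQ 2)" "restr M (sp 1 2) s' = f" "restr M (tp 1 2) s' = Comp C h g"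
    using concat_ex[OF f hg'(1) r] by (auto simp: numeral_2_eq_2)
  have "eq_rel M 2 1 q (Comp C h g)" using model_comp_eq_rel(1)[OF q(1)] q(2,3) by simp
  then have "eq_rel M 3 2 t s'"
    using eq_rel_concat[of t 1 2 s' 1 1] t s' eq_rel_refl[OF f] by (simp add: numeral_eq_Suc)
  then have 2: "eq_rel M 3 1 t (Comp C (Comp C h g) f)"
    using eq_rel_trans[OF t(1) s'(1) model_comp(1)[OF f hg'(1) r]] model_comp_eq_rel(1)[OF s'(1)] s'(2,3) by simp
  note c1 = model_comp(1)[OF gf'(1) h l] and c2 = model_comp(1)[OF f hg'(1) r]
  show ?thesis
    by (rule eq_rel_one[OF c1 c2 eq_rel_trans[OF c1 t(1) c2 eq_rel_sym[OF t(1) c1 1] 2]])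
qed

text \<open>The formula \<open>Id\<close> fixes the source of \<open>y\<close> only; that \<open>y\<close> is an endomorphism follows by composing
  it with an identity of its target.\<close>

lemma id_rel_neutral:
  assumes x: "x \<in> carr M (PQ 0)" and y: "y \<in> carr M (PQ 1)" "id_rel M x y"
  shows "restr M (sp 0 1) y = x" "restr M (tp 0 1) y = x"
    "z \<in> carr M (PQ 1) \<Longrightarrow> restr M (sp 0 1) z = x \<Longrightarrow> Comp C z y = z"
    "z \<in> carr M (PQ 1) \<Longrightarrow> restr M (tp 0 1) z = x \<Longrightarrow> Comp C y z = z"
proof -
  have eq: "z = w" if "z \<in> carr M (PQ 1)" "w \<in> carr M (PQ 1)" "eq_pos_rel M 1 1 z w" for z w
    using eq_rel_one[OF that(1,2)] that(3) by (simp add: eq_rel_def)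
  have pre: "Comp C z y = z" if "z \<in> carr M (PQ 1)" "restr M (tp 0 1) y = restr M (sp 0 1) z" "id_rel M x y"
    "y \<in> carr M (PQ 1)" for x y z
    using eq[OF that(1) model_comp(1)[OF that(4,1,2)]] model_comp(1,2)[OF that(4,1,2)] that(1,3)
    unfolding id_rel_def by metis
  have post: "Comp C y z = z" if "z \<in> carr M (PQ 1)" "restr M (tp 0 1) z = restr M (sp 0 1) y" "id_rel M x y"
    "y \<in> carr M (PQ 1)" for x y z
    using eq[OF that(1) model_comp(1)[OF that(1,4,2)]] model_comp(1,2)[OF that(1,4,2)] that(1,3)
    unfolding id_rel_def by metis
  show s: "restr M (sp 0 1) y = x" using y(2) by (simp add: id_rel_def)
  have "restr M (tp 0 1) y \<in> carr M (PQ 0)" using restr_sp_tp_in[OF y(1), of 0] by simp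
  then obtain y' where y': "y' \<in> carr M (PQ 1)" "id_rel M (restr M (tp 0 1) y) y'" using id_ex by blast
  then have e: "restr M (tp 0 1) y = restr M (sp 0 1) y'" by (simp add: id_rel_def)
  have "y' = y" using pre[OF y'(1) e y(2,1)] post[OF y(1) e y'(2,1)] by simp
  then show t: "restr M (tp 0 1) y = x" using e s by simp
  show "Comp C z y = z" if "z \<in> carr M (PQ 1)" "restr M (sp 0 1) z = x"
    using pre[OF that(1) _ y(2,1)] that(2) t by simp
  show "Comp C y z = z" if "z \<in> carr M (PQ 1)" "restr M (tp 0 1) z = x"
    using post[OF that(1) _ y(2,1)] that(2) s by simp
qed

lemma is_category_model_cat: "is_category C"
proof -
  have ide: "Ide C x \<in> carr M (PQ 1)" "id_rel M x (Ide C x)" if "x \<in> carr M (PQ 0)" for x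
  proof -
    have "Ide C x \<in> carr M (PQ 1) \<and> id_rel M x (Ide C x)"
      unfolding model_cat_def category.select_convs by (rule someI_ex) (use id_ex[OF that] in blast)
    then show "Ide C x \<in> carr M (PQ 1)" "id_rel M x (Ide C x)" by auto
  qed
  note n = id_rel_neutral[OF _ ide]
  have o: "restr M (sp 0 1) f \<in> carr M (PQ 0)" "restr M (tp 0 1) f \<in> carr M (PQ 0)" if "f \<in> carr M (PQ 1)" for f
    using restr_sp_tp_in[OF that, of 0] by auto
  show ?thesis
    unfolding is_category_def Hom_def model_cat_simps
    using o ide(1) n model_comp model_comp_assoc by simp
qed

text \<open>Split off the last arrow and replace the initial segment by its composite, to which it
  is related by induction. What remains is a path of length two, related to its own
  composite.\<close>

lemma eq_rel_path_comp:
  assumes "x \<in> carr M (PQ (Suc k))"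
  shows "eq_rel M (Suc k) 1 x (path_comp C (Suc k) (model_family M (PQ (Suc k)) x))"
  using assms
proof (induction k arbitrary: x)
  case 0
  then show ?case
    using eq_rel_refl[of x 1] model_family_PQ1[of x] path_comp_simps(2)[OF is_category_model_cat model_family_in[OF acyclic_named(1), of x 1]]
    by simp
next
  case (Suc k)
  let ?l = "Suc k" and ?n = "Suc k + 1"
  have x: "x \<in> carr M (PQ ?n)" using Suc(2) by simp
  note C = is_category_model_cat and fx = model_family_in[OF acyclic_named(1) x]
  let ?u = "restr M (sp ?l ?n) x" and ?g = "restr M (tp 1 ?n) x"
  have u: "?u \<in> carr M (PQ ?l)" and g: "?g \<in> carr M (PQ 1)" using restr_sp_tp_in[OF x] by auto
  let ?c = "path_comp C ?l (model_family M (PQ ?l) ?u)"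
  have nu: "model_family M (PQ ?l) ?u = fam_pull (sp ?l ?n) (model_family M (PQ ?n) x)"
    using model_family_restr[OF sptp_emb(1)[of ?l ?n]] x by simp
  have ng: "model_family M (PQ 1) ?g = fam_pull (tp 1 ?n) (model_family M (PQ ?n) x)"
    using model_family_restr[OF sptp_emb(2)[of 1 ?n]] x by simp
  note fu = model_family_in[OF acyclic_named(1) u] and fg = model_family_in[OF acyclic_named(1) g]
  have pg: "path_comp C 1 (model_family M (PQ 1) ?g) = ?g"
    using path_comp_simps(2)[OF C fg] model_family_PQ1[OF g] by simp
  have pc: "path_comp C ?n (model_family M (PQ ?n) x) = Comp C ?g ?c"
    using path_comp_concat[OF C fx] pg unfolding nu ng by simp
  note cH = path_comp_Hom[OF C fu, unfolded model_cat_simps]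
  have "fst (model_family M (PQ ?l) ?u) ?l = fst (model_family M (PQ 1) ?g) 0"
    unfolding nu ng by (simp add: sp_def tp_def)
  then have e: "restr M (tp 0 1) ?c = restr M (sp 0 1) ?g"
    using cH(3) familiesD(3)[OF fg, of 0] model_family_PQ1[OF g] by (simp add: model_cat_simps)
  obtain p where p: "p \<in> carr M (PQ 2)" "restr M (sp 1 2) p = ?c" "restr M (tp 1 2) p = ?g"
    using concat_ex[OF cH(1) g e] by (auto simp: numeral_2_eq_2)
  have "eq_rel M ?n 2 x p"
    using eq_rel_concat[of x ?l 1 p 1 1] x p Suc.IH[OF u] eq_rel_refl[OF g] by (simp add: numeral_2_eq_2)
  moreover have "eq_rel M 2 1 p (Comp C ?g ?c)" using model_comp_eq_rel(1)[OF p(1)] p(2,3) by simp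
  ultimately have "eq_rel M ?n 1 x (Comp C ?g ?c)"
    by (rule eq_rel_trans[OF x p(1) model_comp(1)[OF cH(1) g e]])
  then show ?case using pc by simp
qed

text \<open>Each path is related to its composite, and related arrows are equal.\<close>

lemma eq_rel_iff_path_comp:
  assumes x: "x \<in> carr M (PQ k)" and y: "y \<in> carr M (PQ l)" and "0 < k" "0 < l"
  shows "eq_rel M k l x y \<longleftrightarrow> path_comp C k (model_family M (PQ k) x) = path_comp C l (model_family M (PQ l) y)"
proof -
  let ?x = "path_comp C k (model_family M (PQ k) x)" and ?y = "path_comp C l (model_family M (PQ l) y)"
  have c: "?x \<in> carr M (PQ 1)" "?y \<in> carr M (PQ 1)"
    using path_comp_Hom(1)[OF is_category_model_cat model_family_in[OF acyclic_named(1)]] x y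
    by (simp_all add: model_cat_simps)
  have ex: "eq_rel M k 1 x ?x" using eq_rel_path_comp[of x "k - 1"] x \<open>0 < k\<close> by simp
  have ey: "eq_rel M l 1 y ?y" using eq_rel_path_comp[of y "l - 1"] y \<open>0 < l\<close> by simp
  show ?thesis
  proof
    assume "eq_rel M k l x y"
    then have "eq_rel M k 1 x ?y" using eq_rel_trans[OF x y c(2)] ey by blast
    then have "eq_rel M 1 1 ?x ?y" using eq_rel_trans[OF c(1) x c(2)] eq_rel_sym[OF x c(1) ex] by blast
    then show "?x = ?y" by (rule eq_rel_one[OF c])
  next
    assume "?x = ?y"
    then have "eq_rel M k 1 x ?y" using ex by simp
    then show "eq_rel M k l x y" using eq_rel_trans[OF x c(2) y] eq_rel_sym[OF y c(2) ey] by blast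
  qed
qed

lemma model_family_iso: "struct_iso (model_family M) M (fam_interp C)"
proof -
  note C = is_category_model_cat
  have "x \<in> commute M Q \<longleftrightarrow> model_family M Q x \<in> fam_commute C Q"
    if Q: "acyclic_quiver Q" and x: "x \<in> carr M Q" for Q x
  proof -
    note fx = model_family_in[OF Q x]
    have "eq_rel M (plen p) (plen q) (restr M p x) (restr M q x) \<longleftrightarrow>
        walk_comp C (model_family M Q x) (pstart p) (arrow_list p) =
        walk_comp C (model_family M Q x) (pstart q) (arrow_list q)"
      if b: "(p, q) \<in> BP Q" for p q
    proof -
      have pq: "p \<in> paths Q" "q \<in> paths Q" "pstart p = pstart q" "pend p = pend q" using b by (auto simp: BP_def)
      note pd = path_data[OF pq(1)] and qd = path_data[OF pq(2)]
      note pe = path_emb[OF Q pq(1)] and qe = path_emb[OF Q pq(2)]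
      have r: "restr M p x \<in> carr M (PQ (plen p))" "restr M q x \<in> carr M (PQ (plen q))"
        using restr_in[OF pe] restr_in[OF qe] x pd qd by simp_all
      \<comment> \<open>A path is an embedding, so it is trivial iff its ends coincide. Hence of two
        parallel paths either both are trivial, and then equal, or neither is.\<close>
      have trivial: "plen r = 0 \<longleftrightarrow> pstart r = pend r" if "r \<in> paths Q" for r
        using inj_onD[OF acyclic_embD(4)[OF path_emb[OF Q that]], of 0 "plen r"] path_data[OF that]
        by (auto simp: pstart_def pend_def)
      show ?thesis
      proof (cases "plen p = 0")
        case True
        then have "plen q = 0" using trivial[OF pq(1)] trivial[OF pq(2)] pq(3,4) by simp
        then have "p = q" using True by (intro path_eqI[OF pq(1-3)]) (simp add: arrow_list_def)
        then show ?thesis using eq_rel_refl[OF r(1)] by simp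
      next
        case False
        then have l: "0 < plen p" "0 < plen q" using trivial[OF pq(1)] trivial[OF pq(2)] pq(3,4) by auto
        have "model_family M (PQ (plen p)) (restr M p x) = fam_pull p (model_family M Q x)"
          "model_family M (PQ (plen q)) (restr M q x) = fam_pull q (model_family M Q x)"
          using model_family_restr[OF pe] model_family_restr[OF qe] x pd qd by simp_all
        then show ?thesis
          using eq_rel_iff_path_comp[OF r l] path_comp_pull[OF fx pq(1)] path_comp_pull[OF fx pq(2)] by simp
      qed
    qed
    then show ?thesis unfolding commute_iff[OF Q x] fam_commute_iff_BP[OF fx] by (intro ball_cong refl) auto
  qed
  then show ?thesis
    unfolding struct_iso_def by (auto simp: model_family_bij model_family_restr)
qed

end

section \<open>Limits in the interpretation of a category\<close>

definition is_cone :: "('o, 'a) category \<Rightarrow> quiver \<Rightarrow> ('o, 'a) family \<Rightarrow> ('o, 'a) family \<Rightarrow> bool" where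
  "is_cone C Q x y \<longleftrightarrow> fam_pull (cone_incl Q) y = x \<and>
     (\<forall>a\<in>arrs Q. Comp C (snd x a) (snd y (leg Q (src Q a))) = snd y (leg Q (tgt Q a)))"

text \<open>The usual universal property: the mediating arrow \<open>h\<close> takes the place of
  the cone over \<open>cone Q\<close> in \<open>Limit_fm\<close>.\<close>

definition is_limit :: "('o, 'a) category \<Rightarrow> quiver \<Rightarrow> ('o, 'a) family \<Rightarrow> ('o, 'a) family \<Rightarrow> bool" where
  "is_limit C Q x y \<longleftrightarrow> is_cone C Q x y \<and> (\<forall>z\<in>families C (cone Q). is_cone C Q x z \<longrightarrow>
     (\<exists>!h. h \<in> Hom C (fst z (apex Q)) (fst y (apex Q)) \<and>
       (\<forall>v\<in>verts Q. Comp C (snd y (leg Q v)) h = snd z (leg Q v))))"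

lemma cone_incl_qmor: "is_quiver Q \<Longrightarrow> is_qmor (cone_incl Q)"
  by (auto simp: is_qmor_def cone_incl_def cone_quiver cone_simps src_in tgt_in)

lemma cone_incl_pull:
  assumes "is_quiver Q" "y \<in> families C (cone Q)"
  shows "fam_pull (cone_incl Q) y \<in> families C Q"
    "v \<in> verts Q \<Longrightarrow> fst (fam_pull (cone_incl Q) y) v = fst y v"
    "a \<in> arrs Q \<Longrightarrow> snd (fam_pull (cone_incl Q) y) a = snd y a"
  using fam_pull_families[OF cone_incl_qmor[OF assms(1)], of y C] assms(2)
  by simp (simp_all add: cone_incl_def)

lemma cone_families:
  assumes "is_quiver Q" "y \<in> families C (cone Q)"
  shows "fst y (apex Q) \<in> Ob C" "v \<in> verts Q \<Longrightarrow> fst y v \<in> Ob C"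
    "v \<in> verts Q \<Longrightarrow> snd y (leg Q v) \<in> Hom C (fst y (apex Q)) (fst y v)"
    "a \<in> arrs Q \<Longrightarrow> snd y a \<in> Hom C (fst y (src Q a)) (fst y (tgt Q a))"
  using familiesD[OF assms(2)] by (auto simp: cone_simps[OF assms(1)] Hom_def)

lemma ranked_quiver: "ranked Q \<Longrightarrow> is_quiver Q"
  by (simp add: ranked_def)

lemma cone_mor_qmor:
  assumes "acyclic_emb m" "ranked (qdom m)" "ranked (qcod m)"
  shows "is_qmor (cone_mor m)"
  using cone_mor_emb[OF _ assms(2,3)] assms(1) by (auto simp: acyclic_emb_def embedding_def)

lemma fresh_atMost: "fresh {0..k} = Suc k" "fresh {0..<Suc k} = Suc k"
  by (auto simp: fresh_def intro!: Max_eqI)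

lemma sat_Cone_fm:
  assumes C: "is_category C" and rQ: "ranked Q"
    and y: "tm_val (fam_interp C) e t \<in> families C (cone Q)"
  shows "sat (fam_interp C) e (Cone_fm Q s t) \<longleftrightarrow>
    is_cone C Q (tm_val (fam_interp C) e s) (tm_val (fam_interp C) e t)"
proof -
  let ?y = "tm_val (fam_interp C) e t"
  note Q = ranked_quiver[OF rQ]
  have P: "is_quiver (PQ 1)" by (rule is_quiver_named)
  have "fam_pull (cone_mor (arrow_path Q a)) ?y \<in> fam_commute C (cone (PQ 1)) \<longleftrightarrow>
      Comp C (snd ?y a) (snd ?y (leg Q (src Q a))) = snd ?y (leg Q (tgt Q a))" if a: "a \<in> arrs Q" for a
  proof -
    let ?m = "cone_mor (arrow_path Q a)"
    \<comment> \<open>\<open>cone (PQ 1)\<close> is the triangle 2, 0, 1: arrow 1 is the leg to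
      vertex 0, arrow 0 is the original arrow and arrow 2 is the leg to vertex 1.\<close>
    have "apex (PQ 1) = 2" "leg (PQ 1) 0 = 1" "leg (PQ 1) 1 = 2"
      using fresh_atMost(1)[of 1] fresh_atMost(2)[of 0] by (simp_all add: apex_def leg_def)
    note c1 = cone_simps[OF P] and c2 = cone_simps[OF Q] and al = this
    have P1: "verts (PQ 1) = {0, 1}" "arrs (PQ 1) = {0}" by auto
    have V: "verts (cone (PQ 1)) = {2, 0, 1}" and A: "arrs (cone (PQ 1)) = {1, 0, 2}"
      unfolding c1(7,8) P1 using al by auto
    have vm: "vmap ?m 0 = src Q a" "vmap ?m 1 = tgt Q a" "vmap ?m 2 = apex Q"
      using al V by (auto simp: cone_mor_def arrow_path_def)
    have am: "amap ?m 0 = a" "amap ?m 1 = leg Q (src Q a)" "amap ?m 2 = leg Q (tgt Q a)"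
      using al A fresh_atMost(2)[of 0] by (auto simp: cone_mor_def arrow_path_def)
    have s: "src (cone (PQ 1)) 0 = 0" "tgt (cone (PQ 1)) 0 = 1" "src (cone (PQ 1)) 1 = 2"
      "tgt (cone (PQ 1)) 1 = 0" "src (cone (PQ 1)) 2 = 2" "tgt (cone (PQ 1)) 2 = 1"
      using c1(3,4)[of 0] c1(5,6)[of 0] c1(5,6)[of 1] al by auto
    have "is_qmor ?m" using cone_mor_qmor[OF arrow_emb[OF rQ a]] ranked_PQ rQ by simp
    then have w: "fam_pull ?m ?y \<in> families C (cone (PQ 1))"
      using fam_pull_families[of ?m ?y C] y by simp
    have "fam_pull ?m ?y \<in> fam_commute C (cone (PQ 1)) \<longleftrightarrow>
        Comp C (snd (fam_pull ?m ?y) 0) (snd (fam_pull ?m ?y) 1) = snd (fam_pull ?m ?y) 2"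
      by (rule fam_commute_triangle[OF C w V _ A]) (use s in auto)
    then show ?thesis using am A by simp
  qed
  note com = this
  have fin: "finite (arrs Q)" using Q by (simp add: is_quiver_def)
  show ?thesis
  proof (cases "fam_pull (cone_incl Q) ?y = tm_val (fam_interp C) e s")
    case True
    \<comment> \<open>The triangles speak of the arrows of the cone; by the first conjunct these are
      the arrows of the base.\<close>
    have "snd (tm_val (fam_interp C) e s) a = snd ?y a" if "a \<in> arrs Q" for a
      using cone_incl_pull(3)[OF Q y that] unfolding True .
    then show ?thesis using True com fin by (simp add: Cone_fm_def is_cone_def sat_conj_over)
  qed (simp add: Cone_fm_def is_cone_def)
qed

lemma ex1_transfer:
  assumes "\<And>w. P w \<Longrightarrow> R (f w)" "\<And>w w'. P w \<Longrightarrow> P w' \<Longrightarrow> f w = f w' \<Longrightarrow> w = w'"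
    "\<And>h. R h \<Longrightarrow> \<exists>w. P w \<and> f w = h"
  shows "(\<exists>!w. P w) \<longleftrightarrow> (\<exists>!h. R h)"
  using assms by metis

text \<open>A cone \<open>w\<close> over the cone \<open>y\<close> is determined by its leg \<open>h\<close> to the apex of \<open>y\<close>: the cone
  condition at a leg \<open>v\<close> of \<open>y\<close> says that the leg of \<open>w\<close> to \<open>v\<close> is the composite of \<open>h\<close> and that leg.\<close>

lemma cone_of_cones:
  assumes C: "is_category C" and rQ: "ranked Q"
    and y: "y \<in> families C (cone Q)" "is_cone C Q x y" and z: "z \<in> families C (cone Q)" "is_cone C Q x z"
  shows "(\<exists>!w. w \<in> families C (cone (cone Q)) \<and> is_cone C (cone Q) y w \<and>
      fam_pull (cone_mor (cone_incl Q)) w = z) \<longleftrightarrow>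
    (\<exists>!h. h \<in> Hom C (fst z (apex Q)) (fst y (apex Q)) \<and>
      (\<forall>v\<in>verts Q. Comp C (snd y (leg Q v)) h = snd z (leg Q v)))"
proof -
  let ?K = "cone Q" and ?m = "cone_mor (cone_incl Q)"
  note Q = ranked_quiver[OF rQ]
  note K = cone_quiver[OF Q] and c = cone_simps[OF Q]
  note KK = cone_quiver[OF K] and cK = cone_simps[OF K]
  have vm: "vmap ?m (apex Q) = apex ?K" "v \<in> verts Q \<Longrightarrow> vmap ?m v = v" for v
    using c by (auto simp: cone_mor_def, auto simp: cone_incl_def)
  have am: "a \<in> arrs Q \<Longrightarrow> amap ?m a = a" "v \<in> verts Q \<Longrightarrow> amap ?m (leg Q v) = leg ?K v" for a v
    using c by (auto simp: cone_mor_def, auto simp: cone_incl_def)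
  have mq: "is_qmor ?m" using cone_mor_qmor[OF cone_incl_emb[OF rQ]] rQ ranked_cone[OF rQ] by simp
  have xy: "fst y v = fst z v" if "v \<in> verts Q" for v
    using y(2) z(2) cone_incl_pull(2)[OF Q y(1)] cone_incl_pull(2)[OF Q z(1)] that
    unfolding is_cone_def by metis
  have xa: "snd x a = snd z a" "snd y a = snd z a" if "a \<in> arrs Q" for a
    using y(2) z(2) cone_incl_pull(3)[OF Q y(1)] cone_incl_pull(3)[OF Q z(1)] that
    unfolding is_cone_def by metis+
  have zc: "Comp C (snd z a) (snd z (leg Q (src Q a))) = snd z (leg Q (tgt Q a))" if "a \<in> arrs Q" for a
  proof -
    have "Comp C (snd x a) (snd z (leg Q (src Q a))) = snd z (leg Q (tgt Q a))"
      using z(2) that unfolding is_cone_def by blast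
    then show ?thesis using xa(1)[OF that] by simp
  qed
  have pz: "fst w (apex ?K) = fst z (apex Q)" "v \<in> verts Q \<Longrightarrow> snd w (leg ?K v) = snd z (leg Q v)"
    if "fam_pull ?m w = z" for w v
    unfolding that[symmetric] using vm am c by auto
  have py: "v \<in> verts ?K \<Longrightarrow> fst w v = fst y v" "a \<in> arrs ?K \<Longrightarrow> snd w a = snd y a"
    if "w \<in> families C (cone ?K)" "is_cone C ?K y w" for w v a
    using that cone_incl_pull[OF K that(1)] by (auto simp: is_cone_def)
  show ?thesis
  proof (rule ex1_transfer[where f = "\<lambda>w. snd w (leg ?K (apex Q))"])
    fix w assume w: "w \<in> families C (cone ?K) \<and> is_cone C ?K y w \<and> fam_pull ?m w = z"
    then have "snd w (leg ?K (apex Q)) \<in> Hom C (fst z (apex Q)) (fst y (apex Q))"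
      using cone_families(3)[OF K, of w C "apex Q"] pz py(1) c by simp
    moreover have "Comp C (snd y (leg Q v)) (snd w (leg ?K (apex Q))) = snd z (leg Q v)" if v: "v \<in> verts Q" for v
    proof -
      have "Comp C (snd y (leg Q v)) (snd w (leg ?K (src ?K (leg Q v)))) = snd w (leg ?K (tgt ?K (leg Q v)))"
        using w v c unfolding is_cone_def by blast
      then show ?thesis using pz(2) w v c by simp
    qed
    ultimately show "snd w (leg ?K (apex Q)) \<in> Hom C (fst z (apex Q)) (fst y (apex Q)) \<and>
      (\<forall>v\<in>verts Q. Comp C (snd y (leg Q v)) (snd w (leg ?K (apex Q))) = snd z (leg Q v))" by blast
  next
    fix w w' assume w: "w \<in> families C (cone ?K) \<and> is_cone C ?K y w \<and> fam_pull ?m w = z"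
      and w': "w' \<in> families C (cone ?K) \<and> is_cone C ?K y w' \<and> fam_pull ?m w' = z"
      and e: "snd w (leg ?K (apex Q)) = snd w' (leg ?K (apex Q))"
    note W = pz[of w] pz[of w'] py[of w] py[of w']
    show "w = w'"
    proof (rule families_eqI[of w C "cone ?K" w' C])
      show "fst w v = fst w' v" if "v \<in> verts (cone ?K)" for v
        using that W(1,3,5,7) w w' unfolding cK(7) by auto
      show "snd w a = snd w' a" if "a \<in> arrs (cone ?K)" for a
        using that W(2,4,6,8) w w' e unfolding cK(8) c(7) by auto
    qed (use w w' in auto)
  next
    fix h assume h: "h \<in> Hom C (fst z (apex Q)) (fst y (apex Q)) \<and>
      (\<forall>v\<in>verts Q. Comp C (snd y (leg Q v)) h = snd z (leg Q v))"
    \<comment> \<open>The new legs are \<open>h\<close> to the apex of \<open>y\<close> and the legs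
      of \<open>z\<close> to the vertices of \<open>Q\<close>. Subtracting
      \<open>fresh (arrs ?K)\<close> recovers the vertex from the number of its leg.\<close>
    define w where "w = (restrict (\<lambda>v. if v \<in> verts ?K then fst y v else fst z (apex Q)) (verts (cone ?K)),
      restrict (\<lambda>a. if a \<in> arrs ?K then snd y a else if a = leg ?K (apex Q) then h
        else snd z (leg Q (a - fresh (arrs ?K)))) (arrs (cone ?K)))"
    have lf: "leg R v = leg R v' \<longleftrightarrow> v = v'" for R v v' by (simp add: leg_def)
    have av: "v \<noteq> apex Q" if "v \<in> verts Q" for v using that c(1) by auto
    have w1: "v \<in> verts ?K \<Longrightarrow> fst w v = fst y v" "fst w (apex ?K) = fst z (apex Q)"
      "a \<in> arrs ?K \<Longrightarrow> snd w a = snd y a" "snd w (leg ?K (apex Q)) = h"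
      "v \<in> verts Q \<Longrightarrow> snd w (leg ?K v) = snd z (leg Q v)" for v a
      using cK(1,2,9) av by (auto simp: w_def cK(7,8) c(7) lf)
    have "w \<in> families C (cone ?K)"
      unfolding w_def
    proof (rule familiesI[OF _ _ _ _ KK], goal_cases)
      case (1 v)
      then show ?case using familiesD(1)[OF y(1)] cone_families(1)[OF Q z(1)] by (auto simp: cK(7))
    next
      case (2 a)
      then show ?case using familiesD(2)[OF y(1)] h cone_families(3)[OF Q z(1)] cK(9)
        by (auto simp: cK(8) c(7) Hom_def)
    next
      case (3 a)
      then consider "a \<in> arrs ?K" | "a = leg ?K (apex Q)" | v where "v \<in> verts Q" "a = leg ?K v"
        by (auto simp: cK(8) c(7))
      then show ?case
      proof cases
        case 1
        then show ?thesis using familiesD(3)[OF y(1)] cK src_in[OF K] by simp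
      next
        case 2
        then show ?thesis using h cK c by (simp add: Hom_def)
      next
        case 3
        then show ?thesis using cone_families(3)[OF Q z(1)] cK c(7) av[of v] by (simp add: Hom_def lf)
      qed
    next
      case (4 a)
      then consider "a \<in> arrs ?K" | "a = leg ?K (apex Q)" | v where "v \<in> verts Q" "a = leg ?K v"
        by (auto simp: cK(8) c(7))
      then show ?case
      proof cases
        case 1
        then show ?thesis using familiesD(4)[OF y(1)] cK tgt_in[OF K] by simp
      next
        case 2
        then show ?thesis using h cK c by (simp add: Hom_def)
      next
        case 3
        then show ?thesis using cone_families(3)[OF Q z(1)] cK c(7) av[of v] xy by (simp add: Hom_def lf)
      qed
    qed
    moreover have "is_cone C ?K y w"
      unfolding is_cone_def
    proof
      show "fam_pull (cone_incl ?K) w = y"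
        by (rule families_eqI[OF cone_incl_pull(1)[OF K calculation] y(1)])
          (use cone_incl_pull(2,3)[OF K calculation] w1 in auto)
      show "\<forall>a\<in>arrs ?K. Comp C (snd y a) (snd w (leg ?K (src ?K a))) = snd w (leg ?K (tgt ?K a))"
      proof
        fix a assume "a \<in> arrs ?K"
        then consider "a \<in> arrs Q" | v where "v \<in> verts Q" "a = leg Q v" using c by auto
        then show "Comp C (snd y a) (snd w (leg ?K (src ?K a))) = snd w (leg ?K (tgt ?K a))"
        proof cases
          case 1
          then show ?thesis using zc xa c w1(5) src_in[OF Q] tgt_in[OF Q] by simp
        next
          case 2
          then show ?thesis using h c w1 by simp
        qed
      qed
    qed
    moreover have "fam_pull ?m w = z"
    proof (rule families_eqI[of _ C ?K z C])
      show "fam_pull ?m w \<in> families C ?K" using fam_pull_families[OF mq] calculation(1) by simp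
      show "fst (fam_pull ?m w) v = fst z v" if "v \<in> verts ?K" for v
        using that vm w1 xy by (auto simp: c(7))
      show "snd (fam_pull ?m w) a = snd z a" if "a \<in> arrs ?K" for a
        using that am w1 xa by (auto simp: c(8))
    qed (rule z(1))
    ultimately show "\<exists>w. (w \<in> families C (cone ?K) \<and> is_cone C ?K y w \<and> fam_pull ?m w = z) \<and>
        snd w (leg ?K (apex Q)) = h"
      using w1(4) by blast
  qed
qed

lemma sat_Limit_fm:
  assumes C: "is_category C" and Q: "ranked Q"
    and y: "tm_val (fam_interp C) e t \<in> families C (cone Q)"
  shows "sat (fam_interp C) e (Limit_fm Q s t) \<longleftrightarrow>
    is_limit C Q (tm_val (fam_interp C) e s) (tm_val (fam_interp C) e t)"
proof -
  let ?x = "tm_val (fam_interp C) e s" and ?y = "tm_val (fam_interp C) e t"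
  note K = ranked_cone[OF Q]
  have 1: "sat (fam_interp C) (case_nat z e) (Cone_fm Q (lift 1 s) (Var 0)) \<longleftrightarrow> is_cone C Q ?x z"
    if "z \<in> families C (cone Q)" for z
    using sat_Cone_fm[OF C Q, of "case_nat z e" "Var 0"] that by simp
  have 2: "sat (fam_interp C) (case_nat w (case_nat z e)) (Cone_fm (cone Q) (lift 2 t) (Var 0)) \<longleftrightarrow>
      is_cone C (cone Q) ?y w" if "w \<in> families C (cone (cone Q))" for w z
    using sat_Cone_fm[OF C K, of "case_nat w (case_nat z e)" "Var 0"] that by simp
  have "sat (fam_interp C) e (Limit_fm Q s t) \<longleftrightarrow> is_cone C Q ?x ?y \<and>
    (\<forall>z\<in>families C (cone Q). is_cone C Q ?x z \<longrightarrow> (\<exists>!w. w \<in> families C (cone (cone Q)) \<and>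
      is_cone C (cone Q) ?y w \<and> fam_pull (cone_mor (cone_incl Q)) w = z))"
    using 1 2 sat_Cone_fm[OF C Q y] by (simp add: Limit_fm_def cong: conj_cong)
  then show ?thesis
    unfolding is_limit_def by (simp only:) (intro conj_cong refl ball_cong imp_cong cone_of_cones[OF C Q y])
qed

section \<open>The axioms of abelian categories in the interpretation of a category\<close>

declare One_nat_def [simp del]

lemma tm_val_dual_fam:
  assumes "is_category C"
  shows "tm_val (fam_interp (op_cat C)) e (dual_tm t) = tm_val (fam_interp C) e t"
  using dual_struct_fam_interp[OF is_category_op[OF assms]] by (simp add: tm_val_dual)

text \<open>\<open>Colimit_fm\<close> dualises a limit formula applied to dualised terms. Passing to
  the opposite category absorbs the outer dualisation and returns the original values of the
  terms.\<close>

lemma sat_Colimit_fm: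
  assumes C: "is_category C" and Q: "ranked Q"
    and y: "tm_val (fam_interp C) e t \<in> families (op_cat C) (cone (dual_quiver Q))"
  shows "sat (fam_interp C) e (Colimit_fm Q s t) \<longleftrightarrow>
    is_limit (op_cat C) (dual_quiver Q) (tm_val (fam_interp C) e s) (tm_val (fam_interp C) e t)"
  using sat_Limit_fm[OF is_category_op[OF C] ranked_dual[OF Q], of e "dual_tm t" "dual_tm s"] y
  by (simp add: Colimit_fm_def sat_dual_fam[OF C] tm_val_dual_fam[OF C])

section \<open>Zero objects\<close>

lemma families_empty:
  "\<exists>x. families C empty_quiver = {x}"
proof -
  let ?x = "(restrict (\<lambda>_. undefined) (verts empty_quiver), restrict (\<lambda>_. undefined) (arrs empty_quiver))"
  have "?x \<in> families C empty_quiver"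
    by (rule familiesI) (use is_quiver_named in \<open>auto simp: empty_quiver_def\<close>)
  moreover have "y = ?x" if "y \<in> families C empty_quiver" for y
    by (rule families_eqI[OF that \<open>?x \<in> _\<close>]) (auto simp: empty_quiver_def)
  ultimately show ?thesis by blast
qed

text \<open>A cone over the empty quiver is a single object without legs, so the universal property
  is terminality.\<close>

lemma is_limit_empty:
  assumes x: "x \<in> families C empty_quiver" and y: "y \<in> families C (PQ 0)"
  shows "is_limit C empty_quiver x y \<longleftrightarrow> terminal C (fst y 0)"
proof -
  have cone: "is_cone C empty_quiver x z" if "z \<in> families C (PQ 0)" for z
  proof -
    have "fam_pull (cone_incl empty_quiver) z \<in> families C empty_quiver"
      using cone_incl_pull(1)[OF is_quiver_named(7)] that by (simp add: cone_empty)
    then have "fam_pull (cone_incl empty_quiver) z = x" using families_empty[of C] x by auto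
    then show ?thesis by (simp add: is_cone_def) (simp add: empty_quiver_def)
  qed
  have e: "apex empty_quiver = 0" "verts empty_quiver = {}"
    by (simp_all add: apex_def empty_quiver_def fresh_def)
  have "(\<forall>z\<in>families C (PQ 0). \<exists>!h. h \<in> Hom C (fst z 0) (fst y 0)) \<longleftrightarrow> (\<forall>c\<in>Ob C. \<exists>!h. h \<in> Hom C c (fst y 0))"
  proof (intro iffI ballI)
    show "\<exists>!h. h \<in> Hom C c (fst y 0)"
      if "\<forall>z\<in>families C (PQ 0). \<exists>!h. h \<in> Hom C (fst z 0) (fst y 0)" "c \<in> Ob C" for c
      using bspec[OF that(1) object_family(1)[OF that(2)]] by (simp add: object_family(2)[OF that(2)])
    show "\<exists>!h. h \<in> Hom C (fst z 0) (fst y 0)"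
      if "\<forall>c\<in>Ob C. \<exists>!h. h \<in> Hom C c (fst y 0)" "z \<in> families C (PQ 0)" for z
      using bspec[OF that(1)] familiesD(1)[OF that(2)] by simp
  qed
  then show ?thesis
    using familiesD(1)[OF y, of 0] cone y by (simp add: is_limit_def terminal_def cone_empty e)
qed

text \<open>The empty quiver and \<open>PQ 0\<close> are self-dual, so the limit and the colimit
  condition concern the same element, once in \<open>C\<close> and once in its opposite.\<close>

lemma sat_Zero_fm:
  assumes C: "is_category C" and y: "tm_val (fam_interp C) e t \<in> families C (PQ 0)"
  shows "sat (fam_interp C) e (Zero_fm t) \<longleftrightarrow> zero_object C (fst (tm_val (fam_interp C) e t) 0)"
proof -
  obtain x where x: "families C empty_quiver = {x}" using families_empty by blast
  have op: "families (op_cat C) empty_quiver = families C empty_quiver"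
    "families (op_cat C) (PQ 0) = families C (PQ 0)" "dual_quiver empty_quiver = empty_quiver"
    by (simp_all add: families_op dual_empty dual_PQ0)
  show ?thesis
    using sat_Limit_fm[OF C ranked_concrete(1), of "case_nat x e" "lift 1 t" "Var 0"]
      sat_Colimit_fm[OF C ranked_concrete(1), of "case_nat x e" "lift 1 t" "Var 0"]
      is_limit_empty[of x C] is_limit_empty[of x "op_cat C"] y x
    by (simp add: Zero_fm_def cone_empty op zero_object_def)
qed

lemma sat_ZeroE:
  assumes C: "is_category C"
  shows "sat (fam_interp C) e ZeroE \<longleftrightarrow> (\<exists>z. zero_object C z)"
proof -
  have "sat (fam_interp C) e ZeroE \<longleftrightarrow> (\<exists>x\<in>families C (PQ 0). zero_object C (fst x 0))"
    using sat_Zero_fm[OF C, of "case_nat _ e" "Var 0"] by (simp add: ZeroE_def)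
  also have "\<dots> \<longleftrightarrow> (\<exists>z. zero_object C z)"
    using object_family[of _ C] by (metis terminal_def zero_object_def)
  finally show ?thesis .
qed

section \<open>Products\<close>

lemma cone_incl_pull_eq_iff:
  assumes Q: "is_quiver Q" and z: "z \<in> families C (cone Q)" and x: "x \<in> families C Q"
  shows "fam_pull (cone_incl Q) z = x \<longleftrightarrow>
    (\<forall>v\<in>verts Q. fst z v = fst x v) \<and> (\<forall>a\<in>arrs Q. snd z a = snd x a)"
proof
  assume "fam_pull (cone_incl Q) z = x"
  then show "(\<forall>v\<in>verts Q. fst z v = fst x v) \<and> (\<forall>a\<in>arrs Q. snd z a = snd x a)"
    using cone_incl_pull(2,3)[OF Q z] by simp
next
  assume e: "(\<forall>v\<in>verts Q. fst z v = fst x v) \<and> (\<forall>a\<in>arrs Q. snd z a = snd x a)"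
  show "fam_pull (cone_incl Q) z = x"
    by (rule families_eqI[OF cone_incl_pull(1)[OF Q z] x])
      (simp_all only: cone_incl_pull(2,3)[OF Q z] e)
qed

lemma sat_ProductE:
  assumes C: "is_category C"
  shows "sat (fam_interp C) e ProductE \<longleftrightarrow> has_products C"
proof -
  \<comment> \<open>As \<open>D2\<close> has no arrow, legs are numbered from 0, and the leg to
    \<open>v\<close> has the number \<open>v\<close>.\<close>
  have al: "apex D2 = 2" "leg D2 v = v" "verts D2 = {0, 1}" "arrs D2 = {}" for v
    by (simp_all add: apex_def leg_def D2_def fresh_def)
  note c = cone_simps[OF is_quiver_named(3)] and K = cone_quiver[OF is_quiver_named(3)]
  have V: "verts (cone D2) = {2, 0, 1}" "arrs (cone D2) = {0, 1}"
    unfolding c(7,8) by (auto simp: al)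
  have s: "src (cone D2) 0 = 2" "src (cone D2) 1 = 2" "tgt (cone D2) 0 = 0" "tgt (cone D2) 1 = 1"
    using c(5,6)[of 0] c(5,6)[of 1] al by auto
  have cone: "is_cone C D2 x z \<longleftrightarrow> fst z 0 = fst x 0 \<and> fst z 1 = fst x 1"
    if x: "x \<in> families C D2" and z: "z \<in> families C (cone D2)" for x z
  proof -
    have "fam_pull (cone_incl D2) z = x \<longleftrightarrow> fst z 0 = fst x 0 \<and> fst z 1 = fst x 1"
      using cone_incl_pull_eq_iff[OF is_quiver_named(3) z x] by (simp add: al)
    then show ?thesis by (simp add: is_cone_def al)
  qed
  define fam where "fam c x f g = (restrict (\<lambda>v. if v = 2 then c else fst x v) (verts (cone D2)),
    restrict (\<lambda>a. if a = 0 then f else g) (arrs (cone D2)))" for c and x :: "('a, 'b) family" and f g :: 'b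
  have fam: "fam c x f g \<in> families C (cone D2)" "is_cone C D2 x (fam c x f g)"
    "fst (fam c x f g) 2 = c" "snd (fam c x f g) 0 = f" "snd (fam c x f g) 1 = g"
    if x: "x \<in> families C D2" and "c \<in> Ob C" "f \<in> Hom C c (fst x 0)" "g \<in> Hom C c (fst x 1)" for c x f g
  proof -
    show fm: "fam c x f g \<in> families C (cone D2)"
      unfolding fam_def
      by (rule familiesI[OF _ _ _ _ K]) (use that familiesD(1)[OF x] s in \<open>auto simp: V al Hom_def\<close>)
    show "is_cone C D2 x (fam c x f g)" using cone[OF x fm] by (simp add: fam_def V)
  qed (simp_all add: fam_def V)
  have lim: "is_limit C D2 x y \<longleftrightarrow> is_product C (fst x 0) (fst x 1) (fst y 2) (snd y 0) (snd y 1)"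
    if x: "x \<in> families C D2" and y: "y \<in> families C (cone D2)" "is_cone C D2 x y" for x y
  proof
    note yc = cone[OF x y(1), THEN iffD1, OF y(2)]
    note yf = cone_families[OF is_quiver_named(3) y(1), unfolded al]
    {
      assume l: "is_limit C D2 x y"
      show "is_product C (fst x 0) (fst x 1) (fst y 2) (snd y 0) (snd y 1)"
        unfolding is_product_def
      proof (intro conjI ballI)
        fix c f g assume cfg: "c \<in> Ob C" "f \<in> Hom C c (fst x 0)" "g \<in> Hom C c (fst x 1)"
        show "\<exists>!h. h \<in> Hom C c (fst y 2) \<and> Comp C (snd y 0) h = f \<and> Comp C (snd y 1) h = g"
        proof -
          note z = fam[OF x cfg]
          have "\<exists>!h. h \<in> Hom C (fst (fam c x f g) (apex D2)) (fst y (apex D2)) \<and>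
              (\<forall>v\<in>verts D2. Comp C (snd y (leg D2 v)) h = snd (fam c x f g) (leg D2 v))"
            using l[unfolded is_limit_def, THEN conjunct2, rule_format, OF z(1,2)] .
          then show ?thesis by (simp add: al z(3-5))
        qed
      qed (use yf(1) yf(3)[of 0] yf(3)[of 1] yc in auto)
    }
    assume p: "is_product C (fst x 0) (fst x 1) (fst y 2) (snd y 0) (snd y 1)"
    show "is_limit C D2 x y"
      unfolding is_limit_def
    proof (intro conjI ballI impI)
      fix z assume z: "z \<in> families C (cone D2)" "is_cone C D2 x z"
      note zf = cone_families[OF is_quiver_named(3) z(1), unfolded al]
      have "fst z 2 \<in> Ob C" "snd z 0 \<in> Hom C (fst z 2) (fst x 0)" "snd z 1 \<in> Hom C (fst z 2) (fst x 1)"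
        using zf(1) zf(3)[of 0] zf(3)[of 1] cone[OF x z(1)] z(2) by auto
      then have "\<exists>!h. h \<in> Hom C (fst z 2) (fst y 2) \<and> Comp C (snd y 0) h = snd z 0 \<and> Comp C (snd y 1) h = snd z 1"
        using p unfolding is_product_def by blast
      then show "\<exists>!h. h \<in> Hom C (fst z (apex D2)) (fst y (apex D2)) \<and>
          (\<forall>v\<in>verts D2. Comp C (snd y (leg D2 v)) h = snd z (leg D2 v))"
        by (simp add: al)
    qed (rule y(2))
  qed
  have "sat (fam_interp C) e ProductE \<longleftrightarrow>
      (\<forall>x\<in>families C D2. \<exists>y\<in>families C (cone D2). is_limit C D2 x y)"
    using sat_Limit_fm[OF C ranked_concrete(2), of "case_nat _ (case_nat _ e)" "Var 0" "Var 1"]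
    by (simp add: ProductE_def One_nat_def)
  also have "\<dots> \<longleftrightarrow> has_products C"
  proof
    assume l: "\<forall>x\<in>families C D2. \<exists>y\<in>families C (cone D2). is_limit C D2 x y"
    show "has_products C"
      unfolding has_products_def
    proof (intro ballI)
      fix a b assume ab: "a \<in> Ob C" "b \<in> Ob C"
      let ?x = "(restrict (\<lambda>v. if v = 0 then a else b) (verts D2), restrict (\<lambda>_. undefined) (arrs D2))"
      have x: "?x \<in> families C D2"
        by (rule familiesI[OF _ _ _ _ is_quiver_named(3)]) (use ab in \<open>auto simp: al\<close>)
      then obtain y where y: "y \<in> families C (cone D2)" "is_limit C D2 ?x y" using l by blast
      then have "is_cone C D2 ?x y" by (simp add: is_limit_def)
      then have "is_product C (fst ?x 0) (fst ?x 1) (fst y 2) (snd y 0) (snd y 1)" using lim[OF x y(1)] y(2) by simp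
      then show "\<exists>p p1 p2. is_product C a b p p1 p2" unfolding al by auto
    qed
  next
    assume h: "has_products C"
    show "\<forall>x\<in>families C D2. \<exists>y\<in>families C (cone D2). is_limit C D2 x y"
    proof
      fix x assume x: "x \<in> families C D2"
      then obtain p p1 p2 where p: "is_product C (fst x 0) (fst x 1) p p1 p2"
        using h familiesD(1)[OF x] unfolding has_products_def al by blast
      then have "p \<in> Ob C" "p1 \<in> Hom C p (fst x 0)" "p2 \<in> Hom C p (fst x 1)" by (auto simp: is_product_def)
      note f = fam[OF x this]
      have "is_limit C D2 x (fam p x p1 p2)" using lim[OF x f(1,2)] p unfolding f(3-5) by simp
      then show "\<exists>y\<in>families C (cone D2). is_limit C D2 x y" using f(1) by blast
    qed
  qed
  finally show ?thesis .
qed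

section \<open>Kernels as pullbacks along an arrow out of a zero object\<close>

lemma HomD: "f \<in> Hom C a b \<Longrightarrow> f \<in> Mor C" "f \<in> Hom C a b \<Longrightarrow> Dom C f = a" "f \<in> Hom C a b \<Longrightarrow> Cod C f = b"
  by (auto simp: Hom_def)

lemma Comp_Hom: "is_category C \<Longrightarrow> f \<in> Hom C a b \<Longrightarrow> g \<in> Hom C b c \<Longrightarrow> Comp C g f \<in> Hom C a c"
  by (simp add: Hom_def categoryD)

lemma zero_objectD:
  assumes "zero_object C z"
  shows "z \<in> Ob C" "c \<in> Ob C \<Longrightarrow> \<exists>!f. f \<in> Hom C c z" "c \<in> Ob C \<Longrightarrow> \<exists>!f. f \<in> Hom C z c"
proof -
  have "Hom (op_cat C) c z = Hom C z c" for c by (auto simp: Hom_def)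
  then show "z \<in> Ob C" "c \<in> Ob C \<Longrightarrow> \<exists>!f. f \<in> Hom C c z" "c \<in> Ob C \<Longrightarrow> \<exists>!f. f \<in> Hom C z c"
    using assms by (simp_all add: zero_object_def terminal_def)
qed

text \<open>The zero object that witnesses \<open>zero_mor\<close> may differ from \<open>z\<close>.
  An arrow \<open>r\<close> between the two turns one factorisation into the other, by uniqueness of
  arrows into and out of zero objects.\<close>

lemma zero_mor_factors:
  assumes C: "is_category C" and o: "zero_object C z" and m: "zero_mor C m"
    and t: "t \<in> Hom C (Dom C m) z" and u: "u \<in> Hom C z (Cod C m)"
  shows "m = Comp C u t"
proof -
  from m obtain z' v w where z': "zero_object C z'" and v: "v \<in> Hom C (Dom C m) z'"
    and w: "w \<in> Hom C z' (Cod C m)" and e: "m = Comp C w v" and "m \<in> Mor C"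
    by (auto simp: zero_mor_def)
  obtain r where r: "r \<in> Hom C z' z" using zero_objectD(3)[OF z'] zero_objectD(1)[OF o] by blast
  have ob: "Dom C m \<in> Ob C" "Cod C m \<in> Ob C" using \<open>m \<in> Mor C\<close> C by (auto simp: categoryD)
  have "Comp C r v = t" using zero_objectD(2)[OF o ob(1)] Comp_Hom[OF C v r] t by blast
  moreover have "Comp C u r = w" using zero_objectD(3)[OF z' ob(2)] Comp_Hom[OF C r u] w by blast
  ultimately show ?thesis using categoryD(11)[OF C, of v r u] v r u e by (auto simp: Hom_def)
qed

lemma cone_CospanQ:
  "apex CospanQ = 3" "leg CospanQ v = 2 + v" "verts CospanQ = {0, 1, 2}" "arrs CospanQ = {0, 1}"
  "src CospanQ 0 = 0" "tgt CospanQ 0 = 1" "src CospanQ 1 = 2" "tgt CospanQ 1 = 1"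
  by (simp_all add: apex_def leg_def CospanQ_def fresh_def)

lemma verts_cone_CospanQ: "verts (cone CospanQ) = {3, 0, 1, 2}" "arrs (cone CospanQ) = {0, 1, 2, 3, 4}"
  unfolding cone_simps(7,8)[OF is_quiver_named(6)] by (auto simp: cone_CospanQ)

lemma src_cone_CospanQ:
  "src (cone CospanQ) 0 = 0" "tgt (cone CospanQ) 0 = 1" "src (cone CospanQ) 1 = 2" "tgt (cone CospanQ) 1 = 1"
  "src (cone CospanQ) 2 = 3" "tgt (cone CospanQ) 2 = 0" "src (cone CospanQ) 3 = 3" "tgt (cone CospanQ) 3 = 1"
  "src (cone CospanQ) 4 = 3" "tgt (cone CospanQ) 4 = 2"
  using cone_simps(3,4)[OF is_quiver_named(6), of 0] cone_simps(3,4)[OF is_quiver_named(6), of 1]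
    cone_simps(5,6)[OF is_quiver_named(6), of 0] cone_simps(5,6)[OF is_quiver_named(6), of 1]
    cone_simps(5,6)[OF is_quiver_named(6), of 2]
  by (auto simp: cone_CospanQ)

text \<open>\<open>f\<close> and \<open>u\<close> form the cospan on \<open>a\<close>,
  \<open>b\<close>, \<open>o'\<close>; the legs \<open>g\<close>, \<open>m\<close>, \<open>t\<close>
  run from the apex \<open>c\<close> to \<open>a\<close>, \<open>b\<close>, \<open>o'\<close> and
  have the numbers 2, 3, 4.\<close>

definition cospan_cone :: "'o \<Rightarrow> 'o \<Rightarrow> 'o \<Rightarrow> 'o \<Rightarrow> 'a \<Rightarrow> 'a \<Rightarrow> 'a \<Rightarrow> 'a \<Rightarrow> 'a \<Rightarrow> ('o, 'a) family" where
  "cospan_cone a b o' c f u g m t =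
     (restrict (\<lambda>v. if v = 0 then a else if v = 1 then b else if v = 2 then o' else c) (verts (cone CospanQ)),
      restrict (\<lambda>i. if i = 0 then f else if i = 1 then u else if i = 2 then g else if i = 3 then m else t)
        (arrs (cone CospanQ)))"

lemma cospan_cone:
  assumes C: "is_category C"
    and "f \<in> Hom C a b" "u \<in> Hom C o' b" "g \<in> Hom C c a" "m \<in> Hom C c b" "t \<in> Hom C c o'"
  shows "cospan_cone a b o' c f u g m t \<in> families C (cone CospanQ)"
  unfolding cospan_cone_def
proof (rule familiesI[OF _ _ _ _ cone_quiver[OF is_quiver_named(6)]])
  have "a \<in> Ob C" "b \<in> Ob C" "c \<in> Ob C" "o' \<in> Ob C"
    using assms(2-6) categoryD(1,2)[OF C] by (auto simp: Hom_def)
  then show "(if v = 0 then a else if v = 1 then b else if v = 2 then o' else c) \<in> Ob C" for v :: nat by simp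
qed (use assms(2-6) in \<open>auto simp: Hom_def verts_cone_CospanQ src_cone_CospanQ\<close>)

lemma cospan_cone_simps:
  "fst (cospan_cone a b o' c f u g m t) 0 = a" "fst (cospan_cone a b o' c f u g m t) 1 = b"
  "fst (cospan_cone a b o' c f u g m t) 2 = o'" "fst (cospan_cone a b o' c f u g m t) 3 = c"
  "snd (cospan_cone a b o' c f u g m t) 0 = f" "snd (cospan_cone a b o' c f u g m t) 1 = u"
  "snd (cospan_cone a b o' c f u g m t) 2 = g" "snd (cospan_cone a b o' c f u g m t) 3 = m"
  "snd (cospan_cone a b o' c f u g m t) 4 = t"
  by (simp_all add: cospan_cone_def verts_cone_CospanQ)

lemma cospan_cone_families:
  assumes z: "z \<in> families C (cone CospanQ)"
  shows "snd z 0 \<in> Hom C (fst z 0) (fst z 1)" "snd z 1 \<in> Hom C (fst z 2) (fst z 1)"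
    "snd z 2 \<in> Hom C (fst z 3) (fst z 0)" "snd z 3 \<in> Hom C (fst z 3) (fst z 1)"
    "snd z 4 \<in> Hom C (fst z 3) (fst z 2)"
  using familiesD(2-4)[OF z, of 0] familiesD(2-4)[OF z, of 1] familiesD(2-4)[OF z, of 2]
    familiesD(2-4)[OF z, of 3] familiesD(2-4)[OF z, of 4]
  by (simp_all add: verts_cone_CospanQ src_cone_CospanQ Hom_def)

lemma is_cone_CospanQ:
  assumes x: "x \<in> families C CospanQ" and z: "z \<in> families C (cone CospanQ)"
  shows "is_cone C CospanQ x z \<longleftrightarrow> fst z 0 = fst x 0 \<and> fst z 1 = fst x 1 \<and> fst z 2 = fst x 2 \<and>
    snd z 0 = snd x 0 \<and> snd z 1 = snd x 1 \<and> Comp C (snd x 0) (snd z 2) = snd z 3 \<and>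
    Comp C (snd x 1) (snd z 4) = snd z 3"
proof -
  have "fam_pull (cone_incl CospanQ) z = x \<longleftrightarrow> fst z 0 = fst x 0 \<and> fst z 1 = fst x 1 \<and> fst z 2 = fst x 2 \<and>
    snd z 0 = snd x 0 \<and> snd z 1 = snd x 1"
    using cone_incl_pull_eq_iff[OF is_quiver_named(6) z x] by (simp add: cone_CospanQ conj_assoc)
  then show ?thesis using cone_CospanQ(5-8) by (auto simp: is_cone_def cone_CospanQ(2-4) numeral_eq_Suc)
qed

text \<open>When vertex 2 carries a zero object, a cone over the cospan amounts to an arrow into the
  source of \<open>f\<close> that \<open>f\<close> sends to zero.\<close>

lemma is_limit_CospanQ:
  assumes C: "is_category C" and x: "x \<in> families C CospanQ"
    and z: "z \<in> families C (cone CospanQ)" "is_cone C CospanQ x z" and o: "zero_object C (fst z 2)"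
  shows "is_limit C CospanQ x z \<longleftrightarrow> is_kernel C (snd z 0) (snd z 2)"
proof -
  note zH = cospan_cone_families[OF z(1)]
  note zc = is_cone_CospanQ[OF x z(1), THEN iffD1, OF z(2)]
  have zx: "fst x 0 = fst z 0" "fst x 1 = fst z 1" "fst x 2 = fst z 2" "snd x 0 = snd z 0" "snd x 1 = snd z 1"
    "Comp C (snd z 0) (snd z 2) = snd z 3" "Comp C (snd z 1) (snd z 4) = snd z 3"
    using zc by auto
  \<comment> \<open>The leg to vertex 1 factors through the zero object at vertex 2, so
    \<open>f\<close> composed with the leg to vertex 0 is zero.\<close>
  have zm: "zero_mor C (snd z 3)"
    unfolding zero_mor_def using o zH zx(7)[symmetric] HomD[OF zH(4)]
    by (intro conjI exI[of _ "fst z 2"] exI[of _ "snd z 4"] exI[of _ "snd z 1"]) simp_all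
  \<comment> \<open>The two other legs add no condition: one is forced by the cone conditions, the other one ends
    in a zero object.\<close>
  have leg: "(\<forall>v\<in>verts CospanQ. Comp C (snd z (leg CospanQ v)) h = snd z' (leg CospanQ v)) \<longleftrightarrow>
      Comp C (snd z 2) h = snd z' 2"
    if z': "z' \<in> families C (cone CospanQ)" "is_cone C CospanQ x z'" and h: "h \<in> Hom C (fst z' 3) (fst z 3)"
    for z' h
  proof -
    note z'H = cospan_cone_families[OF z'(1)]
    have zc': "fst z' 0 = fst z 0" "fst z' 1 = fst z 1" "fst z' 2 = fst z 2" "snd z' 0 = snd z 0"
      "Comp C (snd z 0) (snd z' 2) = snd z' 3"
      using is_cone_CospanQ[OF x z'(1), THEN iffD1, OF z'(2)] by (auto simp: zx)
    have "Comp C (snd z 3) h = Comp C (snd z 0) (Comp C (snd z 2) h)"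
      unfolding zx(6)[symmetric] using categoryD(11)[OF C, of h "snd z 2" "snd z 0"] h zH by (simp add: Hom_def)
    moreover have "Comp C (snd z 4) h = snd z' 4"
    proof -
      have "fst z' 3 \<in> Ob C" using categoryD(1)[OF C HomD(1)[OF h]] HomD(2)[OF h] by simp
      then show ?thesis
        using zero_objectD(2)[OF o] Comp_Hom[OF C h zH(5)] z'H(5)[unfolded zc'(3)] by blast
    qed
    ultimately show ?thesis using zc'(5) by (auto simp: cone_CospanQ(2,3) numeral_eq_Suc)
  qed
  have eq: "(\<exists>!h. h \<in> Hom C (fst z' (apex CospanQ)) (fst z (apex CospanQ)) \<and>
       (\<forall>v\<in>verts CospanQ. Comp C (snd z (leg CospanQ v)) h = snd z' (leg CospanQ v))) \<longleftrightarrow>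
      (\<exists>!h. h \<in> Hom C (fst z' 3) (fst z 3) \<and> Comp C (snd z 2) h = snd z' 2)"
    if "z' \<in> families C (cone CospanQ)" "is_cone C CospanQ x z'" for z'
    using leg[OF that] unfolding cone_CospanQ(1) by (intro arg_cong[of _ _ Ex1] ext conj_cong refl)
  show ?thesis
  proof
    assume l: "is_limit C CospanQ x z"
    show "is_kernel C (snd z 0) (snd z 2)"
      unfolding is_kernel_def
    proof (intro conjI ballI impI)
      fix g assume g: "g \<in> Mor C" and "Cod C g = Dom C (snd z 0) \<and> zero_mor C (Comp C (snd z 0) g)"
      then have gH: "g \<in> Hom C (Dom C g) (fst z 0)" and zg: "zero_mor C (Comp C (snd z 0) g)"
        using HomD[OF zH(1)] by (auto simp: Hom_def)
      have d: "Dom C g \<in> Ob C" using C g by (simp add: categoryD)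
      obtain t where t: "t \<in> Hom C (Dom C g) (fst z 2)" using zero_objectD(2)[OF o d] by blast
      note fg = Comp_Hom[OF C gH zH(1)]
      \<comment> \<open>The composite is zero through some zero object; it has to factor through the
        one in this cospan, with \<open>snd z 1\<close> as second factor, to give a cone.\<close>
      have ut: "Comp C (snd z 0) g = Comp C (snd z 1) t"
        by (rule zero_mor_factors[OF C o zg]) (use t zH(2) HomD[OF fg] in auto)
      let ?z = "cospan_cone (fst z 0) (fst z 1) (fst z 2) (Dom C g) (snd z 0) (snd z 1) g (Comp C (snd z 0) g) t"
      have z': "?z \<in> families C (cone CospanQ)" by (rule cospan_cone[OF C zH(1,2) gH fg t])
      have "is_cone C CospanQ x ?z" unfolding is_cone_CospanQ[OF x z'] by (simp add: cospan_cone_simps zx ut)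
      then have "\<exists>!h. h \<in> Hom C (fst ?z 3) (fst z 3) \<and> Comp C (snd z 2) h = snd ?z 2"
        using l z' eq[OF z'] unfolding is_limit_def by blast
      then show "\<exists>!h. h \<in> Hom C (Dom C g) (Dom C (snd z 2)) \<and> Comp C (snd z 2) h = g"
        using HomD[OF zH(3)] by (simp add: cospan_cone_simps)
    qed (use zH zm zx in \<open>auto simp: Hom_def\<close>)
  next
    assume k: "is_kernel C (snd z 0) (snd z 2)"
    have "\<exists>!h. h \<in> Hom C (fst z' 3) (fst z 3) \<and> Comp C (snd z 2) h = snd z' 2"
      if z': "z' \<in> families C (cone CospanQ)" "is_cone C CospanQ x z'" for z'
    proof -
      note z'H = cospan_cone_families[OF z'(1)]
      have zc': "fst z' 0 = fst z 0" "fst z' 1 = fst z 1" "fst z' 2 = fst z 2" "snd z' 1 = snd z 1"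
        "Comp C (snd z 0) (snd z' 2) = snd z' 3" "Comp C (snd z 1) (snd z' 4) = snd z' 3"
        using is_cone_CospanQ[OF x z'(1), THEN iffD1, OF z'(2)] by (auto simp: zx)
      have "zero_mor C (snd z' 3)"
        unfolding zero_mor_def using o z'H zc' HomD[OF z'H(4)]
        by (intro conjI exI[of _ "fst z 2"] exI[of _ "snd z' 4"] exI[of _ "snd z 1"]) simp_all
      moreover have "snd z' 2 \<in> Mor C" "Cod C (snd z' 2) = Dom C (snd z 0)"
        "Dom C (snd z' 2) = fst z' 3" "Dom C (snd z 2) = fst z 3"
        using z'H(3) zH(1,3) zc' by (auto simp: Hom_def)
      ultimately show ?thesis using k zc'(5) unfolding is_kernel_def by metis
    qed
    then show "is_limit C CospanQ x z" unfolding is_limit_def using z(2) eq by blast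
  qed
qed

lemma sat_Ker_fm:
  assumes C: "is_category C" and x: "tm_val (fam_interp C) e s \<in> families C (PQ 1)"
    and y: "tm_val (fam_interp C) e t \<in> families C (PQ 1)"
  shows "sat (fam_interp C) e (Ker_fm s t) \<longleftrightarrow>
    is_kernel C (snd (tm_val (fam_interp C) e s) 0) (snd (tm_val (fam_interp C) e t) 0)"
    (is "_ \<longleftrightarrow> is_kernel C (snd ?x 0) (snd ?y 0)")
proof -
  let ?K = "cone CospanQ" and ?M = "fam_interp C"
  note q = is_quiver_named(6) and K = cone_quiver[OF is_quiver_named(6)]
  have ap: "fam_pull (arrow_path ?K a) z \<in> families C (PQ 1)" "snd (fam_pull (arrow_path ?K a) z) 0 = snd z a"
    if "z \<in> families C ?K" "a \<in> arrs ?K" for z a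
    using fam_pull_families[of "arrow_path ?K a" z C] that arrow_path_paths[OF K that(2)]
    by (simp_all add: paths_def) (simp add: arrow_path_def)
  have vp: "fam_pull (vertex_path ?K 2) z \<in> families C (PQ 0)" "fst (fam_pull (vertex_path ?K 2) z) 0 = fst z 2"
    if "z \<in> families C ?K" for z
    using fam_pull_families[of "vertex_path ?K 2" z C] that vertex_path_paths[OF K, of 2]
    by (simp_all add: paths_def verts_cone_CospanQ) (simp add: vertex_path_def)
  have "sat ?M e (Ker_fm s t) \<longleftrightarrow> (\<exists>z\<in>families C ?K. fam_pull (arrow_path ?K 0) z = ?x \<and>
      fam_pull (arrow_path ?K 2) z = ?y \<and> zero_object C (fst z 2) \<and>
      is_limit C CospanQ (fam_pull (cone_incl CospanQ) z) z)"
    using sat_Zero_fm[OF C, of "case_nat _ e" "RestrTm (vertex_path ?K 2) (Var 0)"]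
      sat_Limit_fm[OF C ranked_CospanQ, of "case_nat _ e" "Var 0" "RestrTm (cone_incl CospanQ) (Var 0)"] vp
    by (auto simp: Ker_fm_def cone_CospanQ(2))
  also have "\<dots> \<longleftrightarrow> is_kernel C (snd ?x 0) (snd ?y 0)"
  proof
    assume "\<exists>z\<in>families C ?K. fam_pull (arrow_path ?K 0) z = ?x \<and> fam_pull (arrow_path ?K 2) z = ?y \<and>
      zero_object C (fst z 2) \<and> is_limit C CospanQ (fam_pull (cone_incl CospanQ) z) z"
    then obtain z where z: "z \<in> families C ?K" "fam_pull (arrow_path ?K 0) z = ?x"
      "fam_pull (arrow_path ?K 2) z = ?y" "zero_object C (fst z 2)"
      "is_limit C CospanQ (fam_pull (cone_incl CospanQ) z) z" by blast
    have "is_cone C CospanQ (fam_pull (cone_incl CospanQ) z) z" using z(5) by (simp add: is_limit_def)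
    then have "is_kernel C (snd z 0) (snd z 2)"
      using is_limit_CospanQ[OF C cone_incl_pull(1)[OF q z(1)] z(1) _ z(4)] z(5) by simp
    then show "is_kernel C (snd ?x 0) (snd ?y 0)"
      using ap(2)[OF z(1), of 0] ap(2)[OF z(1), of 2] unfolding z(2,3) by (simp add: verts_cone_CospanQ)
  next
    assume k: "is_kernel C (snd ?x 0) (snd ?y 0)"
    let ?f = "snd ?x 0" and ?k = "snd ?y 0"
    from k have fk: "?f \<in> Hom C (Dom C ?f) (Cod C ?f)" "?k \<in> Hom C (Dom C ?k) (Dom C ?f)"
      and zm: "zero_mor C (Comp C ?f ?k)" by (auto simp: is_kernel_def Hom_def)
    note c = Comp_Hom[OF C fk(2,1)]
    \<comment> \<open>The cospan is completed by the very zero object through which the composite of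
      \<open>?k\<close> and \<open>?f\<close> factors.\<close>
    from zm obtain z u t where o: "zero_object C z" and t: "t \<in> Hom C (Dom C ?k) z"
      and u: "u \<in> Hom C z (Cod C ?f)" and e: "Comp C ?f ?k = Comp C u t"
      using HomD[OF c] by (auto simp: zero_mor_def)
    let ?z = "cospan_cone (Dom C ?f) (Cod C ?f) z (Dom C ?k) ?f u ?k (Comp C ?f ?k) t"
    have z: "?z \<in> families C ?K" by (rule cospan_cone[OF C fk(1) u fk(2) c t])
    note p = cone_incl_pull[OF q z]
    have cn: "is_cone C CospanQ (fam_pull (cone_incl CospanQ) ?z) ?z"
      unfolding is_cone_CospanQ[OF p(1) z]
      using p(2)[of 0] p(2)[of 1] p(2)[of 2] p(3)[of 0] p(3)[of 1]
      by (simp add: cone_CospanQ cospan_cone_simps e)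
    have "is_limit C CospanQ (fam_pull (cone_incl CospanQ) ?z) ?z"
      using is_limit_CospanQ[OF C p(1) z cn] k o by (simp add: cospan_cone_simps)
    moreover have "fam_pull (arrow_path ?K 0) ?z = ?x" "fam_pull (arrow_path ?K 2) ?z = ?y"
      using ap[OF z, of 0] ap[OF z, of 2] PQ1_eqI[OF _ x] PQ1_eqI[OF _ y]
      by (simp_all add: verts_cone_CospanQ cospan_cone_simps)
    ultimately show "\<exists>z\<in>families C ?K. fam_pull (arrow_path ?K 0) z = ?x \<and> fam_pull (arrow_path ?K 2) z = ?y \<and>
      zero_object C (fst z 2) \<and> is_limit C CospanQ (fam_pull (cone_incl CospanQ) z) z"
      using z o by (intro bexI[of _ ?z]) (simp_all add: cospan_cone_simps)
  qed
  finally show ?thesis .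
qed

lemma sat_KerE:
  assumes C: "is_category C"
  shows "sat (fam_interp C) e KerE \<longleftrightarrow> has_kernels C"
proof -
  have "sat (fam_interp C) e KerE \<longleftrightarrow>
      (\<forall>x\<in>families C (PQ 1). \<exists>y\<in>families C (PQ 1). is_kernel C (snd x 0) (snd y 0))"
    using sat_Ker_fm[OF C, of "case_nat _ (case_nat _ e)" "Var 1" "Var 0"] by (simp add: KerE_def One_nat_def)
  also have "\<dots> \<longleftrightarrow> has_kernels C"
  proof
    assume l: "\<forall>x\<in>families C (PQ 1). \<exists>y\<in>families C (PQ 1). is_kernel C (snd x 0) (snd y 0)"
    show "has_kernels C" unfolding has_kernels_def
    proof
      fix f assume "f \<in> Mor C"
      then show "\<exists>k. is_kernel C f k" using l arrow_family(1,2)[OF C] by metis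
    qed
  next
    assume h: "has_kernels C"
    show "\<forall>x\<in>families C (PQ 1). \<exists>y\<in>families C (PQ 1). is_kernel C (snd x 0) (snd y 0)"
    proof
      fix x assume "x \<in> families C (PQ 1)"
      then obtain k where k: "is_kernel C (snd x 0) k" using h familiesD(2)[of x C "PQ 1" 0] by (auto simp: has_kernels_def)
      then have "k \<in> Mor C" by (simp add: is_kernel_def)
      then show "\<exists>y\<in>families C (PQ 1). is_kernel C (snd x 0) (snd y 0)" using k arrow_family(1,2)[OF C] by metis
    qed
  qed
  finally show ?thesis .
qed

section \<open>Monomorphisms and their normality\<close>

lemma sat_Mono_fm:
  assumes C: "is_category C" and x: "tm_val (fam_interp C) e s \<in> families C (PQ 1)"
  shows "sat (fam_interp C) e (Mono_fm s) \<longleftrightarrow> monomorphism C (snd (tm_val (fam_interp C) e s) 0)"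
    (is "_ \<longleftrightarrow> monomorphism C (snd ?x 0)")
proof -
  have M: "verts MonoQ = {0, 1, 2}" "arrs MonoQ = {0, 1, 2, 3}" "src MonoQ 0 = 0" "src MonoQ 1 = 0"
    "src MonoQ 2 = 1" "src MonoQ 3 = 0" "tgt MonoQ 0 = 1" "tgt MonoQ 1 = 1" "tgt MonoQ 2 = 2" "tgt MonoQ 3 = 2"
    by (simp_all add: MonoQ_def)
  have sub: "fam_pull (subq_incl MonoQ V A) w \<in> families C (subq MonoQ V A)"
    "a \<in> A \<Longrightarrow> snd (fam_pull (subq_incl MonoQ V A) w) a = snd w a"
    if "w \<in> families C MonoQ" "V \<subseteq> verts MonoQ" "A \<subseteq> arrs MonoQ" "src MonoQ ` A \<subseteq> V" "tgt MonoQ ` A \<subseteq> V"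
    for V A w a
    using fam_pull_families[of "subq_incl MonoQ V A" w C] subq_emb[OF ranked_concrete(5) that(2-5)] that(1)
    by (simp_all add: acyclic_embD) (simp add: subq_incl_def subq_def)
  \<comment> \<open>\<open>commute\<close> concerns whole quivers, and a commuting quiver that
    contains both parallel arrows 0 and 1 would identify them outright. Arrow 3 therefore serves as
    the common value of the two composites, one triangle for each.\<close>
  have t1: "fam_pull (subq_incl MonoQ {0, 1, 2} {i, 2, 3}) w \<in> fam_commute C (subq MonoQ {0, 1, 2} {i, 2, 3}) \<longleftrightarrow>
      Comp C (snd w 2) (snd w i) = snd w 3" if w: "w \<in> families C MonoQ" and i: "i = 0 \<or> i = 1" for w i
  proof -
    note s = sub[OF w, of "{0, 1, 2}" "{i, 2, 3}"]
    have f: "fam_pull (subq_incl MonoQ {0, 1, 2} {i, 2, 3}) w \<in> families C (subq MonoQ {0, 1, 2} {i, 2, 3})"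
      by (rule s(1)) (use i M in auto)
    have e: "snd (fam_pull (subq_incl MonoQ {0, 1, 2} {i, 2, 3}) w) a = snd w a" if "a \<in> {i, 2, 3}" for a
      by (rule s(2)) (use that i M in auto)
    let ?w = "fam_pull (subq_incl MonoQ {0, 1, 2} {i, 2, 3}) w"
    have "?w \<in> fam_commute C (subq MonoQ {0, 1, 2} {i, 2, 3}) \<longleftrightarrow> Comp C (snd ?w 2) (snd ?w i) = snd ?w 3"
      by (rule fam_commute_triangle[OF C f, where a = 0 and b = 1 and c = 2]) (use i M in \<open>auto simp: subq_def\<close>)
    then show ?thesis using e[of i] e[of 2] e[of 3] by simp
  qed
  have t2: "fam_pull (subq_incl MonoQ {0, 1} {0, 1}) w \<in> fam_commute C (subq MonoQ {0, 1} {0, 1}) \<longleftrightarrow>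
      snd w 0 = snd w 1" if w: "w \<in> families C MonoQ" for w
  proof -
    have "subq MonoQ {0, 1} {0, 1} = C2"
      by (auto simp: subq_def C2_def MonoQ_def fun_eq_iff)
    moreover have "fam_pull (subq_incl MonoQ {0, 1} {0, 1}) w \<in> families C (subq MonoQ {0, 1} {0, 1})"
      by (rule sub(1)[OF w]) (simp_all add: M)
    moreover have "snd (fam_pull (subq_incl MonoQ {0, 1} {0, 1}) w) a = snd w a" if "a \<in> {0, 1}" for a
      by (rule sub(2)[OF w]) (use that in \<open>simp_all add: M\<close>)
    ultimately show ?thesis
      using fam_commute_C2[OF C, of "fam_pull (subq_incl MonoQ {0, 1} {0, 1}) w"] by simp
  qed
  have ap: "fam_pull (arrow_path MonoQ 2) w = ?x \<longleftrightarrow> snd w 2 = snd ?x 0" if w: "w \<in> families C MonoQ" for w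
  proof -
    have p: "fam_pull (arrow_path MonoQ 2) w \<in> families C (PQ 1)"
      using fam_pull_families[of "arrow_path MonoQ 2" w C] w arrow_path_paths[OF is_quiver_named(5), of 2] M
      by (auto simp: paths_def)
    have "snd (fam_pull (arrow_path MonoQ 2) w) 0 = snd w 2" by (simp add: arrow_path_def)
    then show ?thesis using PQ1_eqI[OF p x] by metis
  qed
  have "sat (fam_interp C) e (Mono_fm s) \<longleftrightarrow> (\<forall>w\<in>families C MonoQ. snd w 2 = snd ?x 0 \<and>
      Comp C (snd w 2) (snd w 0) = snd w 3 \<and> Comp C (snd w 2) (snd w 1) = snd w 3 \<longrightarrow> snd w 0 = snd w 1)"
    using t1[of _ 0] t1[of _ 1] t2 ap by (simp add: Mono_fm_def)
  also have "\<dots> \<longleftrightarrow> monomorphism C (snd ?x 0)"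
  proof
    assume l: "\<forall>w\<in>families C MonoQ. snd w 2 = snd ?x 0 \<and>
      Comp C (snd w 2) (snd w 0) = snd w 3 \<and> Comp C (snd w 2) (snd w 1) = snd w 3 \<longrightarrow> snd w 0 = snd w 1"
    let ?f = "snd ?x 0"
    have f: "?f \<in> Mor C" using familiesD(2)[OF x, of 0] by simp
    show "monomorphism C ?f"
      unfolding monomorphism_def
    proof (intro conjI ballI impI f)
      fix g h assume gh: "g \<in> Mor C" "h \<in> Mor C" "Dom C g = Dom C h \<and> Cod C g = Dom C ?f \<and>
        Cod C h = Dom C ?f \<and> Comp C ?f g = Comp C ?f h"
      define w where "w = (restrict (\<lambda>v. if v = 0 then Dom C g else if v = 1 then Dom C ?f else Cod C ?f) (verts MonoQ),
        restrict (\<lambda>a. if a = 0 then g else if a = 1 then h else if a = 2 then ?f else Comp C ?f g) (arrs MonoQ))"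
      have "w \<in> families C MonoQ" unfolding w_def
        by (rule familiesI[OF _ _ _ _ is_quiver_named(5)]) (use gh f C M in \<open>auto simp: categoryD\<close>)
      then show "g = h" using bspec[OF l, of w] gh(3) by (simp add: w_def M)
    qed
  next
    assume m: "monomorphism C (snd ?x 0)"
    show "\<forall>w\<in>families C MonoQ. snd w 2 = snd ?x 0 \<and>
      Comp C (snd w 2) (snd w 0) = snd w 3 \<and> Comp C (snd w 2) (snd w 1) = snd w 3 \<longrightarrow> snd w 0 = snd w 1"
    proof (intro ballI impI)
      fix w assume w: "w \<in> families C MonoQ" and e: "snd w 2 = snd ?x 0 \<and>
        Comp C (snd w 2) (snd w 0) = snd w 3 \<and> Comp C (snd w 2) (snd w 1) = snd w 3"
      have "snd w 0 \<in> Mor C" "snd w 1 \<in> Mor C" "Dom C (snd w 0) = Dom C (snd w 1)"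
        "Cod C (snd w 0) = Dom C (snd w 2)" "Cod C (snd w 1) = Dom C (snd w 2)"
        using familiesD(2-4)[OF w, of 0] familiesD(2-4)[OF w, of 1] familiesD(2-4)[OF w, of 2] M by auto
      then show "snd w 0 = snd w 1" using m e unfolding monomorphism_def by metis
    qed
  qed
  finally show ?thesis .
qed

lemma sat_MonoNormal:
  assumes C: "is_category C"
  shows "sat (fam_interp C) e MonoNormal \<longleftrightarrow> monos_normal C"
proof -
  have "sat (fam_interp C) e MonoNormal \<longleftrightarrow> (\<forall>x\<in>families C (PQ 1). monomorphism C (snd x 0) \<longrightarrow>
      (\<exists>y\<in>families C (PQ 1). is_kernel C (snd y 0) (snd x 0)))"
    using sat_Ker_fm[OF C, of "case_nat _ (case_nat _ e)" "Var 0" "Var 1"] sat_Mono_fm[OF C, of "case_nat _ e" "Var 0"]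
    by (simp add: MonoNormal_def One_nat_def)
  also have "\<dots> \<longleftrightarrow> monos_normal C"
  proof
    assume l: "\<forall>x\<in>families C (PQ 1). monomorphism C (snd x 0) \<longrightarrow>
      (\<exists>y\<in>families C (PQ 1). is_kernel C (snd y 0) (snd x 0))"
    show "monos_normal C" unfolding monos_normal_def
    proof (intro allI impI)
      fix k assume k: "monomorphism C k"
      then have "k \<in> Mor C" by (simp add: monomorphism_def)
      then show "\<exists>f. is_kernel C f k" using l k arrow_family(1,2)[OF C] by metis
    qed
  next
    assume m: "monos_normal C"
    show "\<forall>x\<in>families C (PQ 1). monomorphism C (snd x 0) \<longrightarrow>
      (\<exists>y\<in>families C (PQ 1). is_kernel C (snd y 0) (snd x 0))"
    proof (intro ballI impI)
      fix x assume "monomorphism C (snd x 0)"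
      then obtain f where f: "is_kernel C f (snd x 0)" using m by (auto simp: monos_normal_def)
      then have "f \<in> Mor C" by (simp add: is_kernel_def)
      then show "\<exists>y\<in>families C (PQ 1). is_kernel C (snd y 0) (snd x 0)" using f arrow_family(1,2)[OF C] by metis
    qed
  qed
  finally show ?thesis .
qed

text \<open>A dual axiom for \<open>C\<close> is the original axiom for \<open>op_cat C\<close>,
  which matches the definition of abelian categories through opposites.\<close>

lemma fam_interp_T_ab:
  assumes C: "is_category C"
  shows "model_of (fam_interp C) T_ab \<longleftrightarrow> abelian_category C"
proof -
  note op = is_category_op[OF C]
  have "model_of (fam_interp C) T_ab \<longleftrightarrow> (\<forall>\<phi>\<in>T_cat. \<forall>e. sat (fam_interp C) e \<phi>) \<and>
    (\<exists>z. zero_object C z) \<and> has_products C \<and> has_products (op_cat C) \<and>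
    has_kernels C \<and> has_kernels (op_cat C) \<and> monos_normal C \<and> monos_normal (op_cat C)"
    by (simp add: model_of_def T_ab_def fam_interp_structure ball_Un sat_dual_fam[OF C] sat_ZeroE[OF C]
        sat_ProductE[OF C] sat_ProductE[OF op] sat_KerE[OF C] sat_KerE[OF op]
        sat_MonoNormal[OF C] sat_MonoNormal[OF op] conj_ac)
  then show ?thesis using fam_interp_T_cat[OF C] C by (simp add: abelian_category_def)
qed


section \<open>The theorem\<close>

lemma model_of_cat_interp_T_ab:
  assumes "is_category C"
  shows "model_of (cat_interp C) T_ab \<longleftrightarrow> abelian_category C"
  using model_of_iso[OF fam_interp_iso[OF assms] fam_interp_structure cat_interp_structure[OF assms] T_ab_sentences]
    fam_interp_T_ab[OF assms] by blast

theorem theorem24: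
  shows "(\<forall>A :: ('o, 'a) category. abelian_category A \<longrightarrow> model_of (cat_interp A) T_ab) \<and>
    (\<forall>M :: 'm fo_struct. model_of M T_ab \<longrightarrow>
       (\<exists>A :: ('m, 'm) category. abelian_category A \<and> isomorphic M (cat_interp A)))"
proof (intro conjI allI impI)
  fix A :: "('o, 'a) category" assume "abelian_category A"
  then show "model_of (cat_interp A) T_ab"
    using model_of_cat_interp_T_ab[of A] by (simp add: abelian_category_def)
next
  fix M :: "'m fo_struct" assume M: "model_of M T_ab"
  interpret T_cat_model M
    by unfold_locales (use M in \<open>simp add: model_of_def T_ab_def\<close>)
  let ?A = "model_cat M"
  have "isomorphic M (cat_interp ?A)"
    by (rule isomorphicI[OF struct_iso_trans[OF model_family_iso fam_interp_iso[OF is_category_model_cat]]])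
  moreover have "is_structure M" using M by (simp add: model_of_def)
  \<comment> \<open>The axioms are carried from \<open>M\<close> to the interpretation of its
    category, where they say that this category is abelian.\<close>
  then have "model_of (fam_interp ?A) T_ab"
    using model_of_iso[OF model_family_iso _ fam_interp_structure T_ab_sentences] M by blast
  then have "abelian_category ?A" using fam_interp_T_ab[OF is_category_model_cat] by blast
  ultimately show "\<exists>A :: ('m, 'm) category. abelian_category A \<and> isomorphic M (cat_interp A)" by blast
qed

end
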